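(* Let $\mathcal F$ be a singular foliation on a real finite-dimensional vector space $V$ such that the origin $p\in V$ is a leaf of $\mathcal F$, and let $$0\to\Gamma(E_n)\xrightarrow{\partial_n}\cdots\xrightarrow{\partial_1}\Gamma(E_0)\xrightarrow{\rho}\mathcal F\to0$$ be a resolution of $\mathcal F$ by sections of vector bundles over $V$ which is minimal at $p$. Then for $i=0,\dots,n$, $$(E_i)_p\cong H^i\big(\Gamma(\wedge^\bullet V^* )\otimes_{C^\infty(V)}\mathcal F(V),\,d_\bullet\otimes\mathrm{id}\big),$$ where $\wedge^{-1}(V^* )$ is understood to be $0$ and $d=\iota_{x^i\partial_{x^i}}$.
   Context: A singular foliation $\mathcal F$ on $V$ is a subsheaf of $C^\infty$-submodules of the sheaf of vector fields, locally finitely generated and closed under the Lie bracket. A resolution is minimal at $p$ if all the bundle maps $\partial_i$, $i\ge1$, vanish at $p$; $(E_i)_p$ is the fiber of $E_i$ at $p$. $\Gamma(\wedge^iV^* )=C^\infty(V,\wedge^iV^* )$, and $d_i:\Gamma(\wedge^iV^* )\to\Gamma(\wedge^{i-1}V^* )$ is contraction with the Euler vector field $x^i\partial_{x^i}$ (for $x^i$ linear coordinates). $H^i$ denotes the (co)homology at the term $\Gamma(\wedge^iV^* )\otimes_{C^\infty(V)}\mathcal F(V)$, i.e. $\ker(d_i\otimes\mathrm{id})/\mathrm{im}(d_{i+1}\otimes\mathrm{id})$. *)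

theory Defs
  imports "HOL-Analysis.Analysis" "HOL-Algebra.Module" "HOL-Algebra.AbelCoset"
    "HOL-Algebra.Free_Abelian_Groups"
begin

section \<open>Smooth functions and vector fields\<close>

text \<open>Meaningful for open \<open>U\<close>. Iterated directional derivatives suffice because the domain is
  finite-dimensional.\<close>

primrec Ck_on :: "nat \<Rightarrow> 'a::euclidean_space set \<Rightarrow> ('a \<Rightarrow> 'b::real_normed_vector) \<Rightarrow> bool" where
  "Ck_on 0 U f \<longleftrightarrow> continuous_on U f"
| "Ck_on (Suc k) U f \<longleftrightarrow>
     (\<forall>x\<in>U. f differentiable (at x)) \<and> (\<forall>v. Ck_on k U (\<lambda>x. frechet_derivative f (at x) v))"

definition smooth_on :: "'a::euclidean_space set \<Rightarrow> ('a \<Rightarrow> 'b::real_normed_vector) \<Rightarrow> bool" where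
  "smooth_on U f \<longleftrightarrow> (\<forall>k. Ck_on k U f)"

text \<open>Local sections over an open set \<open>U\<close> are represented by functions in \<open>extensional U\<close>, so that
  equality of functions is equality of sections and \<^const>\<open>restrict\<close> is the restriction of the sheaf.\<close>

definition vector_fields :: "'v::euclidean_space set \<Rightarrow> ('v \<Rightarrow> 'v) set" where
  "vector_fields U = {X \<in> extensional U. smooth_on U X}"

definition lie_bracket ::
  "'v::euclidean_space set \<Rightarrow> ('v \<Rightarrow> 'v) \<Rightarrow> ('v \<Rightarrow> 'v) \<Rightarrow> ('v \<Rightarrow> 'v)" where
  "lie_bracket U X Y =
     (\<lambda>x\<in>U. frechet_derivative Y (at x) (X x) - frechet_derivative X (at x) (Y x))"

text \<open>In linear coordinates this is \<open>\<Sum>\<^sub>i x\<^sup>i \<partial>/\<partial>x\<^sup>i\<close>.\<close>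

definition euler_field :: "'v::euclidean_space \<Rightarrow> 'v" where
  "euler_field x = (\<Sum>b\<in>Basis. (x \<bullet> b) *\<^sub>R b)"


section \<open>Singular foliations\<close>

text \<open>\<open>F U\<close> is the set of sections over \<open>U\<close>; only its values at open sets matter.\<close>

definition subsheaf_of_modules :: "('v::euclidean_space set \<Rightarrow> ('v \<Rightarrow> 'v) set) \<Rightarrow> bool" where
  "subsheaf_of_modules F \<longleftrightarrow>
     (\<forall>U. open U \<longrightarrow>
        F U \<subseteq> vector_fields U \<and>
        (\<lambda>x\<in>U. 0) \<in> F U \<and>
        (\<forall>X\<in>F U. \<forall>Y\<in>F U. (\<lambda>x\<in>U. X x + Y x) \<in> F U) \<and>
        (\<forall>f. \<forall>X\<in>F U. smooth_on U f \<longrightarrow> (\<lambda>x\<in>U. f x *\<^sub>R X x) \<in> F U)) \<and>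
     (\<forall>U W. open U \<and> open W \<and> W \<subseteq> U \<longrightarrow> (\<forall>X\<in>F U. restrict X W \<in> F W)) \<and>
     (\<forall>U. \<forall>X\<in>vector_fields U. open U \<and>
        (\<forall>x\<in>U. \<exists>W. open W \<and> x \<in> W \<and> W \<subseteq> U \<and> restrict X W \<in> F W) \<longrightarrow> X \<in> F U)"

definition locally_finitely_generated :: "('v::euclidean_space set \<Rightarrow> ('v \<Rightarrow> 'v) set) \<Rightarrow> bool" where
  "locally_finitely_generated F \<longleftrightarrow>
     (\<forall>x. \<exists>U S. open U \<and> x \<in> U \<and> finite S \<and> S \<subseteq> F U \<and>
        (\<forall>W X. open W \<and> W \<subseteq> U \<and> X \<in> F W \<longrightarrow>
           (\<forall>y\<in>W. \<exists>W' c. open W' \<and> y \<in> W' \<and> W' \<subseteq> W \<and> (\<forall>Y\<in>S. smooth_on W' (c Y)) \<and>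
              (\<forall>z\<in>W'. X z = (\<Sum>Y\<in>S. c Y z *\<^sub>R Y z)))))"

definition singular_foliation :: "('v::euclidean_space set \<Rightarrow> ('v \<Rightarrow> 'v) set) \<Rightarrow> bool" where
  "singular_foliation F \<longleftrightarrow>
     subsheaf_of_modules F \<and> locally_finitely_generated F \<and>
     (\<forall>U. open U \<longrightarrow> (\<forall>X\<in>F U. \<forall>Y\<in>F U. lie_bracket U X Y \<in> F U))"

text \<open>The leaves are the orbits of the local flows of sections of \<open>F\<close>. Unit time is enough, since
  sections can be rescaled by constants; for the same reason the relation is symmetric.\<close>

definition flow_step ::
  "('v::euclidean_space set \<Rightarrow> ('v \<Rightarrow> 'v) set) \<Rightarrow> 'v \<Rightarrow> 'v \<Rightarrow> bool" where
  "flow_step F x y \<longleftrightarrow>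
     (\<exists>U X \<gamma>. open U \<and> X \<in> F U \<and> \<gamma> 0 = x \<and> \<gamma> 1 = y \<and>
        (\<forall>t\<in>{0..1::real}. \<gamma> t \<in> U \<and> (\<gamma> has_vector_derivative X (\<gamma> t)) (at t within {0..1})))"

definition is_leaf :: "('v::euclidean_space set \<Rightarrow> ('v \<Rightarrow> 'v) set) \<Rightarrow> 'v set \<Rightarrow> bool" where
  "is_leaf F L \<longleftrightarrow> (\<exists>x. L = {y. (flow_step F)\<^sup>*\<^sup>* x y})"


section \<open>Smooth vector bundles over a vector space\<close>

text \<open>The fibres are linear subspaces of an ambient real vector space of arbitrary (possibly infinite)
  dimension; this is no restriction, since an arbitrary family of vector spaces embeds into its
  direct sum. The ambient space carries no topology: the smooth structure is given by an atlas
  of local frames \<open>(W, r, e)\<close>, where \<open>e 0, \<dots>, e (r - 1)\<close> is a frame over the open set \<open>W\<close>.\<close>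

record ('v, 'e) vector_bundle =
  fiber :: "'v \<Rightarrow> 'e set"
  frames :: "('v set \<times> nat \<times> (nat \<Rightarrow> 'v \<Rightarrow> 'e)) set"

definition sections ::
  "('v::euclidean_space, 'e::real_vector) vector_bundle \<Rightarrow> 'v set \<Rightarrow> ('v \<Rightarrow> 'e) set" where
  "sections B U =
     {s \<in> extensional U. (\<forall>x\<in>U. s x \<in> fiber B x) \<and>
        (\<forall>(W, r, e)\<in>frames B. \<exists>c. (\<forall>j<r. smooth_on (U \<inter> W) (c j :: 'v \<Rightarrow> real)) \<and>
           (\<forall>x\<in>U \<inter> W. s x = (\<Sum>j<r. c j x *\<^sub>R e j x)))}"

definition smooth_vector_bundle :: "('v::euclidean_space, 'e::real_vector) vector_bundle \<Rightarrow> bool" where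
  "smooth_vector_bundle B \<longleftrightarrow>
     (\<forall>x. subspace (fiber B x)) \<and>
     (\<forall>x. \<exists>(W, r, e)\<in>frames B. x \<in> W) \<and>
     (\<forall>(W, r, e)\<in>frames B. open W \<and>
        (\<forall>x\<in>W. inj_on (\<lambda>j. e j x) {..<r} \<and> independent ((\<lambda>j. e j x) ` {..<r}) \<and>
           span ((\<lambda>j. e j x) ` {..<r}) = fiber B x) \<and>
        (\<forall>j<r. restrict (e j) W \<in> sections B W))"

definition linear_on_fibers ::
  "('v, 'e::real_vector) vector_bundle \<Rightarrow> ('v \<Rightarrow> 'e \<Rightarrow> 'f::real_vector) \<Rightarrow> bool" where
  "linear_on_fibers B \<phi> \<longleftrightarrow>
     (\<forall>x. \<forall>u\<in>fiber B x. \<forall>v\<in>fiber B x. \<phi> x (u + v) = \<phi> x u + \<phi> x v) \<and>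
     (\<forall>x c. \<forall>u\<in>fiber B x. \<phi> x (c *\<^sub>R u) = c *\<^sub>R \<phi> x u)"

definition push :: "('v \<Rightarrow> 'e \<Rightarrow> 'f) \<Rightarrow> 'v set \<Rightarrow> ('v \<Rightarrow> 'e) \<Rightarrow> ('v \<Rightarrow> 'f)" where
  "push \<phi> U s = (\<lambda>x\<in>U. \<phi> x (s x))"

definition bundle_map ::
  "('v::euclidean_space, 'e::real_vector) vector_bundle \<Rightarrow> ('v, 'f::real_vector) vector_bundle \<Rightarrow>
     ('v \<Rightarrow> 'e \<Rightarrow> 'f) \<Rightarrow> bool" where
  "bundle_map B B' \<phi> \<longleftrightarrow>
     linear_on_fibers B \<phi> \<and> (\<forall>x. \<phi> x ` fiber B x \<subseteq> fiber B' x) \<and>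
     (\<forall>(W, r, e)\<in>frames B. \<forall>j<r. push \<phi> W (e j) \<in> sections B' W)"

text \<open>Bundle maps to the tangent bundle \<open>TV = V \<times> V\<close>.\<close>

definition anchor_map ::
  "('v::euclidean_space, 'e::real_vector) vector_bundle \<Rightarrow> ('v \<Rightarrow> 'e \<Rightarrow> 'v) \<Rightarrow> bool" where
  "anchor_map B \<rho> \<longleftrightarrow>
     linear_on_fibers B \<rho> \<and> (\<forall>(W, r, e)\<in>frames B. \<forall>j<r. push \<rho> W (e j) \<in> vector_fields W)"


section \<open>Resolutions\<close>

definition kernel_sheaf :: "('v set \<Rightarrow> ('v \<Rightarrow> 'e) set) \<Rightarrow> ('v \<Rightarrow> 'e \<Rightarrow> 'f::zero) \<Rightarrow>
    'v set \<Rightarrow> ('v \<Rightarrow> 'e) set" where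
  "kernel_sheaf \<A> \<phi> U = {s \<in> \<A> U. push \<phi> U s = (\<lambda>x\<in>U. 0)}"

text \<open>The image in the sense of sheaves: sections which locally are images of sections.\<close>

definition image_sheaf :: "('v::topological_space set \<Rightarrow> ('v \<Rightarrow> 'e) set) \<Rightarrow> ('v \<Rightarrow> 'e \<Rightarrow> 'f) \<Rightarrow>
    'v set \<Rightarrow> ('v \<Rightarrow> 'f) set" where
  "image_sheaf \<A> \<phi> U =
     {t \<in> extensional U. \<forall>x\<in>U. \<exists>W. open W \<and> x \<in> W \<and> W \<subseteq> U \<and> (\<exists>s\<in>\<A> W. restrict t W = push \<phi> W s)}"

text \<open>Exactness of the sequence of sheaves
  \<open>0 \<rightarrow> \<Gamma>(E n) \<rightarrow> \<dots> \<rightarrow> \<Gamma>(E 0) \<rightarrow> F \<rightarrow> 0\<close> with maps \<open>D i : E i \<rightarrow> E (i - 1)\<close> for \<open>1 \<le> i \<le> n\<close>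
  and \<open>\<rho> : E 0 \<rightarrow> TV\<close>; values of \<open>E\<close> and \<open>D\<close> at other indices are irrelevant.\<close>

definition resolution ::
  "('v::euclidean_space set \<Rightarrow> ('v \<Rightarrow> 'v) set) \<Rightarrow> nat \<Rightarrow> (nat \<Rightarrow> ('v, 'e::real_vector) vector_bundle) \<Rightarrow>
     (nat \<Rightarrow> 'v \<Rightarrow> 'e \<Rightarrow> 'e) \<Rightarrow> ('v \<Rightarrow> 'e \<Rightarrow> 'v) \<Rightarrow> bool" where
  "resolution F n E D \<rho> \<longleftrightarrow>
     (\<forall>i\<le>n. smooth_vector_bundle (E i)) \<and>
     (\<forall>i\<in>{1..n}. bundle_map (E i) (E (i - 1)) (D i)) \<and>
     anchor_map (E 0) \<rho> \<and>
     (\<forall>U. open U \<longrightarrow>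
        image_sheaf (sections (E 0)) \<rho> U = F U \<and>
        (\<forall>i\<le>n. (if i = 0 then kernel_sheaf (sections (E 0)) \<rho> U
                 else kernel_sheaf (sections (E i)) (D i) U) =
                (if i = n then {\<lambda>x\<in>U. 0}
                 else image_sheaf (sections (E (i + 1))) (D (i + 1)) U)))"

definition minimal_at ::
  "'v \<Rightarrow> nat \<Rightarrow> (nat \<Rightarrow> ('v, 'e::real_vector) vector_bundle) \<Rightarrow> (nat \<Rightarrow> 'v \<Rightarrow> 'e \<Rightarrow> 'e) \<Rightarrow> bool" where
  "minimal_at p n E D \<longleftrightarrow> (\<forall>i\<in>{1..n}. \<forall>u\<in>fiber (E i) p. D i p u = 0)"


section \<open>Tensor products and homology of modules\<close>

text \<open>In module records the fields \<open>mult\<close> and \<open>one\<close> have no meaning.\<close>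

definition bilinear_relations ::
  "('r, 'x) ring_scheme \<Rightarrow> ('r, 'm) module \<Rightarrow> ('r, 'n) module \<Rightarrow> (('m \<times> 'n) \<Rightarrow>\<^sub>0 int) set" where
  "bilinear_relations R M N =
     {frag_of (m \<oplus>\<^bsub>M\<^esub> m', n) - frag_of (m, n) - frag_of (m', n) | m m' n.
        m \<in> carrier M \<and> m' \<in> carrier M \<and> n \<in> carrier N} \<union>
     {frag_of (m, n \<oplus>\<^bsub>N\<^esub> n') - frag_of (m, n) - frag_of (m, n') | m n n'.
        m \<in> carrier M \<and> n \<in> carrier N \<and> n' \<in> carrier N} \<union>
     {frag_of (a \<odot>\<^bsub>M\<^esub> m, n) - frag_of (m, a \<odot>\<^bsub>N\<^esub> n) | a m n.
        a \<in> carrier R \<and> m \<in> carrier M \<and> n \<in> carrier N}"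

definition tensor_null ::
  "('r, 'x) ring_scheme \<Rightarrow> ('r, 'm) module \<Rightarrow> ('r, 'n) module \<Rightarrow> (('m \<times> 'n) \<Rightarrow>\<^sub>0 int) set" where
  "tensor_null R M N =
     generate (free_Abelian_group (carrier M \<times> carrier N)) (bilinear_relations R M N)"

definition tensor_group ::
  "('r, 'x) ring_scheme \<Rightarrow> ('r, 'm) module \<Rightarrow> ('r, 'n) module \<Rightarrow> (('m \<times> 'n) \<Rightarrow>\<^sub>0 int) set monoid" where
  "tensor_group R M N =
     free_Abelian_group (carrier M \<times> carrier N) Mod tensor_null R M N"

text \<open>The map \<open>f \<otimes> g\<close> into \<open>M' \<otimes>\<^sub>R N'\<close>; the union is over representatives \<open>z\<close> of the coset \<open>C\<close>, all of
  which give the same coset when \<open>f\<close> and \<open>g\<close> are \<open>R\<close>-linear.\<close>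

definition tensor_map ::
  "('r, 'x) ring_scheme \<Rightarrow> ('r, 'm') module \<Rightarrow> ('r, 'n') module \<Rightarrow> ('m \<Rightarrow> 'm') \<Rightarrow> ('n \<Rightarrow> 'n') \<Rightarrow>
     (('m \<times> 'n) \<Rightarrow>\<^sub>0 int) set \<Rightarrow> (('m' \<times> 'n') \<Rightarrow>\<^sub>0 int) set" where
  "tensor_map R M' N' f g C =
     (\<Union>z\<in>C. tensor_null R M' N' #>\<^bsub>free_Abelian_group (carrier M' \<times> carrier N')\<^esub>
        frag_extend (\<lambda>(m, n). frag_of (f m, g n)) z)"

definition tensor_product ::
  "('r, 'x) ring_scheme \<Rightarrow> ('r, 'm) module \<Rightarrow> ('r, 'n) module \<Rightarrow>
     ('r, (('m \<times> 'n) \<Rightarrow>\<^sub>0 int) set) module" where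
  "tensor_product R M N =
     \<lparr>carrier = carrier (tensor_group R M N), monoid.mult = undefined, monoid.one = undefined,
      ring.zero = \<one>\<^bsub>tensor_group R M N\<^esub>, ring.add = (\<otimes>\<^bsub>tensor_group R M N\<^esub>),
      smult = (\<lambda>a. tensor_map R M N (\<lambda>m. a \<odot>\<^bsub>M\<^esub> m) id)\<rparr>"

definition quotient_module :: "('r, 'm) module \<Rightarrow> 'm set \<Rightarrow> ('r, 'm set) module" where
  "quotient_module M N =
     \<lparr>carrier = a_rcosets\<^bsub>M\<^esub> N, monoid.mult = undefined, monoid.one = undefined,
      ring.zero = N, ring.add = set_add M,
      smult = (\<lambda>a C. \<Union>m\<in>C. N +>\<^bsub>M\<^esub> (a \<odot>\<^bsub>M\<^esub> m))\<rparr>"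

text \<open>The homology \<open>ker g / im f\<close> at the middle term of \<open>M' \<rightarrow> M \<rightarrow> M''\<close>.\<close>

definition homology_module ::
  "('r, 'a) module \<Rightarrow> ('a \<Rightarrow> 'b) \<Rightarrow> ('r, 'b) module \<Rightarrow> ('b \<Rightarrow> 'c) \<Rightarrow> ('r, 'c) module \<Rightarrow>
     ('r, 'b set) module" where
  "homology_module M' f M g M'' =
     quotient_module (M\<lparr>carrier := a_kernel M M'' g\<rparr>) (f ` carrier M')"


section \<open>The Koszul complex of the Euler vector field\<close>

definition smooth_ring :: "('v::euclidean_space \<Rightarrow> real) ring" where
  "smooth_ring =
     \<lparr>carrier = {f. smooth_on UNIV f}, monoid.mult = (\<lambda>f g x. f x * g x), monoid.one = (\<lambda>x. 1),
      ring.zero = (\<lambda>x. 0), ring.add = (\<lambda>f g x. f x + g x)\<rparr>"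

text \<open>Elements of \<open>\<And>\<^sup>k V\<^sup>*\<close> are alternating \<open>k\<close>-linear forms, extended by \<open>0\<close> to lists of length
  other than \<open>k\<close>. The degree is an integer so that \<open>\<And>\<^sup>k V\<^sup>* = 0\<close> for \<open>k < 0\<close>.\<close>

definition alternating_form :: "int \<Rightarrow> ('v::real_vector list \<Rightarrow> real) \<Rightarrow> bool" where
  "alternating_form k \<omega> \<longleftrightarrow>
     (\<forall>vs. int (length vs) \<noteq> k \<longrightarrow> \<omega> vs = 0) \<and>
     (\<forall>vs j. int (length vs) = k \<and> j < length vs \<longrightarrow> linear (\<lambda>u. \<omega> (vs[j := u]))) \<and>
     (\<forall>vs. int (length vs) = k \<and> \<not> distinct vs \<longrightarrow> \<omega> vs = 0)"

text \<open>\<open>\<Gamma>(\<And>\<^sup>k V\<^sup>*) = C\<^sup>\<infinity>(V, \<And>\<^sup>k V\<^sup>*)\<close>; smoothness may be tested on constant arguments because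
  \<open>\<And>\<^sup>k V\<^sup>*\<close> is finite-dimensional.\<close>

definition forms_module ::
  "int \<Rightarrow> ('v::euclidean_space \<Rightarrow> real, 'v \<Rightarrow> 'v list \<Rightarrow> real) module" where
  "forms_module k =
     \<lparr>carrier = {\<omega>. (\<forall>x. alternating_form k (\<omega> x)) \<and> (\<forall>vs. smooth_on UNIV (\<lambda>x. \<omega> x vs))},
      monoid.mult = undefined, monoid.one = undefined, ring.zero = (\<lambda>x vs. 0),
      ring.add = (\<lambda>\<omega> \<eta> x vs. \<omega> x vs + \<eta> x vs),
      smult = (\<lambda>f \<omega> x vs. f x * \<omega> x vs)\<rparr>"

definition contraction ::
  "('v \<Rightarrow> 'v) \<Rightarrow> ('v \<Rightarrow> 'v list \<Rightarrow> real) \<Rightarrow> ('v \<Rightarrow> 'v list \<Rightarrow> real)" where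
  "contraction X \<omega> = (\<lambda>x vs. \<omega> x (X x # vs))"

definition foliation_module ::
  "('v::euclidean_space set \<Rightarrow> ('v \<Rightarrow> 'v) set) \<Rightarrow> ('v \<Rightarrow> real, 'v \<Rightarrow> 'v) module" where
  "foliation_module F =
     \<lparr>carrier = F UNIV, monoid.mult = undefined, monoid.one = undefined, ring.zero = (\<lambda>x. 0),
      ring.add = (\<lambda>X Y x. X x + Y x), smult = (\<lambda>f X x. f x *\<^sub>R X x)\<rparr>"

definition koszul_term ::
  "('v::euclidean_space set \<Rightarrow> ('v \<Rightarrow> 'v) set) \<Rightarrow> int \<Rightarrow>
     ('v \<Rightarrow> real, ((('v \<Rightarrow> 'v list \<Rightarrow> real) \<times> ('v \<Rightarrow> 'v)) \<Rightarrow>\<^sub>0 int) set) module" where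
  "koszul_term F k = tensor_product smooth_ring (forms_module k) (foliation_module F)"

text \<open>\<open>d\<^sub>k \<otimes> id\<close>, from degree \<open>k\<close> to degree \<open>k - 1\<close>.\<close>

definition koszul_map ::
  "('v::euclidean_space set \<Rightarrow> ('v \<Rightarrow> 'v) set) \<Rightarrow> int \<Rightarrow>
     ((('v \<Rightarrow> 'v list \<Rightarrow> real) \<times> ('v \<Rightarrow> 'v)) \<Rightarrow>\<^sub>0 int) set \<Rightarrow>
     ((('v \<Rightarrow> 'v list \<Rightarrow> real) \<times> ('v \<Rightarrow> 'v)) \<Rightarrow>\<^sub>0 int) set" where
  "koszul_map F k =
     tensor_map smooth_ring (forms_module (k - 1)) (foliation_module F) (contraction euler_field) id"

definition koszul_homology ::
  "('v::euclidean_space set \<Rightarrow> ('v \<Rightarrow> 'v) set) \<Rightarrow> int \<Rightarrow>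
     ('v \<Rightarrow> real, ((('v \<Rightarrow> 'v list \<Rightarrow> real) \<times> ('v \<Rightarrow> 'v)) \<Rightarrow>\<^sub>0 int) set set) module" where
  "koszul_homology F k =
     homology_module (koszul_term F (k + 1)) (koszul_map F (k + 1)) (koszul_term F k)
       (koszul_map F k) (koszul_term F (k - 1))"

text \<open>Isomorphism of a linear subspace with a \<open>C\<^sup>\<infinity>(V)\<close>-module as real vector spaces; \<open>\<real>\<close> acts on
  the latter through the constant functions.\<close>

definition real_isomorphic :: "'e::real_vector set \<Rightarrow> ('v \<Rightarrow> real, 'm) module \<Rightarrow> bool" where
  "real_isomorphic S M \<longleftrightarrow>
     (\<exists>\<phi>. bij_betw \<phi> S (carrier M) \<and>
        (\<forall>u\<in>S. \<forall>v\<in>S. \<phi> (u + v) = \<phi> u \<oplus>\<^bsub>M\<^esub> \<phi> v) \<and>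
        (\<forall>c. \<forall>u\<in>S. \<phi> (c *\<^sub>R u) = (\<lambda>x. c) \<odot>\<^bsub>M\<^esub> \<phi> u))"

end

theory Submission
  imports Defs
begin

text \<open>Both sides of the claimed isomorphism compute \<open>Tor\<^sub>i(\<real>, F(V))\<close> over \<open>C\<^sup>\<infinity>(V)\<close>, where \<open>\<real>\<close> is the
  residue field at the origin. Since \<open>\<Gamma>(\<And>\<^sup>k V\<^sup>*)\<close> is free, \<open>\<Gamma>(\<And>\<^sup>k V\<^sup>*) \<otimes> F(V)\<close> is the module of
  \<open>k\<close>-forms with values in \<open>F\<close>, and \<open>d \<otimes> id\<close> becomes contraction with the Euler field. For forms with
  values in a vector bundle \<open>E\<close> this Koszul complex is exact in positive degrees, with cokernel the
  fibre of \<open>E\<close> at \<open>0\<close>: away from \<open>0\<close> a contracting homotopy is the wedge product with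
  \<open>\<langle>x, \<cdot>\<rangle> / |x|\<^sup>2\<close>, near \<open>0\<close> it is \<open>c \<mapsto> \<integral>\<^sub>0\<^sup>1 t\<^sup>k (dc)(t x) dt\<close> in a local frame, and
  smooth partitions of unity glue the two. They also make the resolution exact on global sections.
  Splitting the resolution into short exact sequences
  \<open>0 \<rightarrow> Z\<^sub>j \<rightarrow> \<Gamma>(E\<^sub>j) \<rightarrow> Z\<^sub>j\<^sub>-\<^sub>1 \<rightarrow> 0\<close> then shifts \<open>H\<^sub>i(F)\<close> down to \<open>H\<^sub>0(Z\<^sub>i\<^sub>-\<^sub>1)\<close>, which is the fibre
  of \<open>E\<^sub>i\<close>; minimality enters because it makes every section in \<open>Z\<^sub>j\<close> vanish at \<open>0\<close>.\<close>


section \<open>Smooth functions\<close>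

text \<open>The long exact sequence alone would give H_1(Z_{j-1}) only as the kernel of H_0(Z_j) ->
  H_0(\<Gamma>(E_j)). The target is the fibre of E_j at 0 and the map is evaluation at 0, so it is
  zero once all sections in Z_j vanish there; hence every step of the shift, the last one included,
  is an isomorphism. For the same reason H_0(Z_{i-1}) is the whole fibre of E_i and not a proper
  quotient of it. F(V) and the Z_j need not be section modules of bundles. Forms are therefore
  allowed values in any set of functions closed under sums and smooth scalings, and a bundle is
  required only for Koszul exactness. As the fibres carry no topology, differentiation and
  integration act on coefficients in a single frame over a ball around 0, which is why a second
  homotopy and gluing are needed elsewhere. On the tensor side the obstacle is injectivity of the
  evaluation of tensors as forms. It comes from a normal form: expanding in a finite family of
  constant forms moves all function coefficients into the factor F(V).\<close>

lemma frechet_derivative_cong_open: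
  assumes "open U" "x \<in> U" "\<And>y. y \<in> U \<Longrightarrow> f y = g y"
  shows "frechet_derivative f (at x) = frechet_derivative g (at x)"
proof -
  have "(f has_derivative f') (at x) \<longleftrightarrow> (g has_derivative f') (at x)" for f'
    using has_derivative_transform_within_open[of _ _ x UNIV U] assms by metis
  then show ?thesis by (simp add: frechet_derivative_def)
qed

lemma Ck_on_cong:
  assumes "open U" "\<And>y. y \<in> U \<Longrightarrow> f y = g y"
  shows "Ck_on k U f \<longleftrightarrow> Ck_on k U g"
  using assms(2)
proof (induction k arbitrary: f g)
  case 0
  then show ?case by (simp cong: continuous_on_cong)
next
  case (Suc k)
  have "f differentiable (at x) \<longleftrightarrow> g differentiable (at x)" if "x \<in> U" for x
    unfolding differentiable_def
    using has_derivative_transform_within_open[of _ _ x UNIV U] that assms(1) Suc.prems by metis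
  moreover have "Ck_on k U (\<lambda>x. frechet_derivative f (at x) v) \<longleftrightarrow>
      Ck_on k U (\<lambda>x. frechet_derivative g (at x) v)" for v
    by (rule Suc.IH) (use frechet_derivative_cong_open[OF assms(1)] Suc.prems in metis)
  ultimately show ?case by simp
qed

lemma Ck_on_subset: "Ck_on k U f \<Longrightarrow> W \<subseteq> U \<Longrightarrow> Ck_on k W f"
  by (induction k arbitrary: f) (auto intro: continuous_on_subset)

lemma Ck_on_imp_continuous_on: "Ck_on k U f \<Longrightarrow> continuous_on U f"
  by (cases k) (auto intro!: differentiable_imp_continuous_on differentiable_at_imp_differentiable_on)

lemma Ck_on_SucD: "Ck_on (Suc k) U f \<Longrightarrow> Ck_on k U f"
proof (induction k arbitrary: f)
  case 0
  then show ?case using Ck_on_imp_continuous_on[OF 0] by simp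
next
  case (Suc k)
  then show ?case by (metis Ck_on.simps(2))
qed

lemma Ck_on_has_derivative:
  assumes "Ck_on (Suc k) U f" "x \<in> U"
  shows "(f has_derivative frechet_derivative f (at x)) (at x)"
  using assms by (simp add: frechet_derivative_works)

text \<open>\<open>Ck_on\<close> refers to the chosen derivative \<open>frechet_derivative\<close>,
  whereas the rules of calculus produce some derivative \<open>f'\<close>. Uniqueness identifies the
  two on \<open>U\<close>, and openness of \<open>U\<close> carries the agreement over to all
  further derivatives.\<close>

lemma Ck_on_SucI:
  assumes "open U" "\<And>x. x \<in> U \<Longrightarrow> (f has_derivative f' x) (at x)" "\<And>v. Ck_on k U (\<lambda>x. f' x v)"
  shows "Ck_on (Suc k) U f"
proof -
  have "Ck_on k U (\<lambda>x. frechet_derivative f (at x) v)" for v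
    using assms(3)[of v] Ck_on_cong[OF assms(1), of "\<lambda>x. f' x v" "\<lambda>x. frechet_derivative f (at x) v"]
      frechet_derivative_at[OF assms(2)] by metis
  then show ?thesis using assms(2) by (auto simp: differentiable_def)
qed

lemma Ck_on_local:
  assumes "\<And>x. x \<in> U \<Longrightarrow> \<exists>N. open N \<and> x \<in> N \<and> Ck_on k N f"
  shows "Ck_on k U f"
  using assms
proof (induction k arbitrary: f)
  case 0
  then show ?case
    by (metis Ck_on.simps(1) continuous_at_imp_continuous_on continuous_on_eq_continuous_at)
next
  case (Suc k)
  show ?case unfolding Ck_on.simps
  proof (intro conjI ballI allI)
    show "f differentiable at x" if "x \<in> U" for x
      using Suc.prems[OF that] by auto
    show "Ck_on k U (\<lambda>x. frechet_derivative f (at x) v)" for v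
      by (rule Suc.IH) (use Suc.prems in fastforce)
  qed
qed

lemma Ck_on_const: "open U \<Longrightarrow> Ck_on k U (\<lambda>x. c)"
proof (induction k arbitrary: c)
  case (Suc k)
  show ?case by (rule Ck_on_SucI[where f' = "\<lambda>x v. 0"]) (use Suc in auto)
qed auto

lemma Ck_on_bounded_linear:
  assumes "open U" "bounded_linear f"
  shows "Ck_on k U f"
proof (cases k)
  case 0
  then show ?thesis using assms by (simp add: linear_continuous_on)
next
  case (Suc k')
  show ?thesis unfolding Suc
    by (rule Ck_on_SucI[where f' = "\<lambda>x. f"])
      (use assms in \<open>auto intro: bounded_linear_imp_has_derivative Ck_on_const\<close>)
qed

lemma Ck_on_add:
  assumes "open U" "Ck_on k U f" "Ck_on k U g"
  shows "Ck_on k U (\<lambda>x. f x + g x)"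
  using assms(2,3)
proof (induction k arbitrary: f g)
  case 0
  then show ?case by (simp add: continuous_on_add)
next
  case (Suc k)
  show ?case
  proof (rule Ck_on_SucI[OF assms(1)])
    show "((\<lambda>x. f x + g x) has_derivative
        (\<lambda>v. frechet_derivative f (at x) v + frechet_derivative g (at x) v)) (at x)" if "x \<in> U" for x
      by (intro has_derivative_add Ck_on_has_derivative[OF Suc.prems(1) that]
          Ck_on_has_derivative[OF Suc.prems(2) that])
    show "Ck_on k U (\<lambda>x. frechet_derivative f (at x) v + frechet_derivative g (at x) v)" for v
      using Suc by auto
  qed
qed

lemma Ck_on_mult:
  fixes f g :: "'v::euclidean_space \<Rightarrow> real"
  assumes "open U" "Ck_on k U f" "Ck_on k U g"
  shows "Ck_on k U (\<lambda>x. f x * g x)"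
  using assms(2,3)
proof (induction k arbitrary: f g)
  case 0
  then show ?case by (simp add: continuous_on_mult)
next
  case (Suc k)
  show ?case
  proof (rule Ck_on_SucI[OF assms(1)])
    show "((\<lambda>x. f x * g x) has_derivative
        (\<lambda>v. f x * frechet_derivative g (at x) v + frechet_derivative f (at x) v * g x)) (at x)"
      if "x \<in> U" for x
      by (intro has_derivative_mult Ck_on_has_derivative[OF Suc.prems(1) that]
          Ck_on_has_derivative[OF Suc.prems(2) that])
    show "Ck_on k U (\<lambda>x. f x * frechet_derivative g (at x) v + frechet_derivative f (at x) v * g x)" for v
      by (intro Ck_on_add assms Suc.IH) (use Suc.prems Ck_on_SucD in auto)
  qed
qed

text \<open>The derivative of 1/f is built from 1/f itself and the derivative of f, so an induction
  on the order closes with \<open>f\<close> fixed.\<close>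

lemma Ck_on_inverse:
  fixes f :: "'v::euclidean_space \<Rightarrow> real"
  assumes "open U" "Ck_on k U f" "\<And>x. x \<in> U \<Longrightarrow> f x \<noteq> 0"
  shows "Ck_on k U (\<lambda>x. inverse (f x))"
  using assms(2)
proof (induction k)
  case 0
  then show ?case using assms(3) by (auto intro!: continuous_on_inverse)
next
  case (Suc k)
  show ?case
  proof (rule Ck_on_SucI[OF assms(1)])
    show "((\<lambda>x. inverse (f x)) has_derivative
        (\<lambda>v. - 1 * (inverse (f x) * frechet_derivative f (at x) v * inverse (f x)))) (at x)"
      if "x \<in> U" for x
      using Deriv.has_derivative_inverse[OF assms(3)[OF that] Ck_on_has_derivative[OF Suc.prems that]]
      by simp
    show "Ck_on k U (\<lambda>x. - 1 * (inverse (f x) * frechet_derivative f (at x) v * inverse (f x)))" for v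
      by (intro Ck_on_mult Ck_on_const assms Suc.IH) (use Suc.prems Ck_on_SucD in auto)
  qed
qed

lemma smooth_on_cong:
  assumes "open U" "\<And>y. y \<in> U \<Longrightarrow> f y = g y"
  shows "smooth_on U f \<longleftrightarrow> smooth_on U g"
  using Ck_on_cong[OF assms] by (simp add: smooth_on_def)

lemma smooth_on_subset: "smooth_on U f \<Longrightarrow> W \<subseteq> U \<Longrightarrow> smooth_on W f"
  unfolding smooth_on_def using Ck_on_subset by blast

lemma smooth_on_local:
  assumes "\<And>x. x \<in> U \<Longrightarrow> \<exists>N. open N \<and> x \<in> N \<and> smooth_on N f"
  shows "smooth_on U f"
  unfolding smooth_on_def
proof
  fix k show "Ck_on k U f"
    by (rule Ck_on_local) (use assms in \<open>auto simp: smooth_on_def\<close>)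
qed

lemma smooth_on_const: "open U \<Longrightarrow> smooth_on U (\<lambda>x. c)"
  by (simp add: smooth_on_def Ck_on_const)

lemma smooth_on_bounded_linear: "open U \<Longrightarrow> bounded_linear f \<Longrightarrow> smooth_on U f"
  by (simp add: smooth_on_def Ck_on_bounded_linear)

lemma smooth_on_add: "open U \<Longrightarrow> smooth_on U f \<Longrightarrow> smooth_on U g \<Longrightarrow> smooth_on U (\<lambda>x. f x + g x)"
  by (simp add: smooth_on_def Ck_on_add)

lemma smooth_on_mult:
  fixes f g :: "'v::euclidean_space \<Rightarrow> real"
  shows "open U \<Longrightarrow> smooth_on U f \<Longrightarrow> smooth_on U g \<Longrightarrow> smooth_on U (\<lambda>x. f x * g x)"
  by (simp add: smooth_on_def Ck_on_mult)

lemma smooth_on_inverse: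
  fixes f :: "'v::euclidean_space \<Rightarrow> real"
  shows "open U \<Longrightarrow> smooth_on U f \<Longrightarrow> (\<And>x. x \<in> U \<Longrightarrow> f x \<noteq> 0) \<Longrightarrow> smooth_on U (\<lambda>x. inverse (f x))"
  by (simp add: smooth_on_def Ck_on_inverse)

lemma smooth_on_sum:
  assumes "open U" "\<And>i. i \<in> I \<Longrightarrow> smooth_on U (f i)"
  shows "smooth_on U (\<lambda>x. \<Sum>i\<in>I. f i x)"
  using assms(2)
  by (induction I rule: infinite_finite_induct) (auto intro: smooth_on_const smooth_on_add assms(1))

lemma smooth_on_uminus: "open U \<Longrightarrow> smooth_on U f \<Longrightarrow> smooth_on U (\<lambda>x. - f x :: real)"
  using smooth_on_mult[of U "\<lambda>x. -1" f] smooth_on_const by fastforce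

lemma smooth_on_inner_left: "open U \<Longrightarrow> smooth_on U (\<lambda>x. x \<bullet> b)"
  by (rule smooth_on_bounded_linear) (auto intro: bounded_linear_intros)

lemma smooth_on_norm_sq:
  assumes "open U"
  shows "smooth_on U (\<lambda>x::'v::euclidean_space. (x - y) \<bullet> (x - y))"
proof -
  have "(x - y) \<bullet> (x - y) = (\<Sum>b\<in>Basis. (x \<bullet> b + - (y \<bullet> b)) * (x \<bullet> b + - (y \<bullet> b)))" for x
    by (subst euclidean_inner) (simp add: inner_diff_left)
  then show ?thesis
    by (simp only:) (intro smooth_on_sum smooth_on_mult smooth_on_add smooth_on_const smooth_on_inner_left assms)
qed

lemma smooth_on_frechet_derivative: "smooth_on U f \<Longrightarrow> smooth_on U (\<lambda>x. frechet_derivative f (at x) v)"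
  using Ck_on.simps(2) by (metis smooth_on_def)

lemma smooth_on_has_derivative:
  "smooth_on U f \<Longrightarrow> x \<in> U \<Longrightarrow> (f has_derivative frechet_derivative f (at x)) (at x)"
  using Ck_on_has_derivative by (metis smooth_on_def)

text \<open>Extension by 0: \<open>W\<close> and \<open>- K\<close> cover the space, and on
  \<open>- K\<close> the product is constantly 0 whatever values \<open>f\<close> takes
  there.\<close>

lemma smooth_on_cutoff:
  fixes f g :: "'v::euclidean_space \<Rightarrow> real"
  assumes "open U" "open W" "closed K" "K \<subseteq> W" "smooth_on U g" "smooth_on (U \<inter> W) f"
    "\<And>x. x \<notin> K \<Longrightarrow> g x = 0"
  shows "smooth_on U (\<lambda>x. g x * f x)"
proof (rule smooth_on_local)
  fix x assume x: "x \<in> U"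
  show "\<exists>N. open N \<and> x \<in> N \<and> smooth_on N (\<lambda>x. g x * f x)"
  proof (cases "x \<in> W")
    case True
    then show ?thesis
      by (intro exI[of _ "U \<inter> W"] conjI smooth_on_mult)
        (use assms x in \<open>auto intro: smooth_on_subset\<close>)
  next
    case False
    have "smooth_on (- K) (\<lambda>x. g x * f x)"
      by (subst smooth_on_cong[where g = "\<lambda>x. 0"])
        (use assms in \<open>auto intro: smooth_on_const simp: open_Compl\<close>)
    then show ?thesis using False assms(3,4) by (intro exI[of _ "- K"]) auto
  qed
qed

section \<open>Flat functions and bump functions\<close>

text \<open>The span of these functions is closed under differentiation, so that one induction treats all
  derivatives of \<open>exp (-1/t)\<close>.\<close>

definition flat_fun :: "nat \<Rightarrow> real \<Rightarrow> real" where
  "flat_fun n t = (if t > 0 then exp (- 1 / t) / t ^ n else 0)"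

text \<open>The single term of index \<open>n + 2\<close> in the series of exp (1/t) bounds it from
  below, which beats t^n with two powers to spare. The quadratic bound forces the difference
  quotient at 0 to tend to 0.\<close>

lemma flat_fun_bound: "\<bar>flat_fun n t\<bar> \<le> fact (n + 2) * t\<^sup>2"
proof (cases "t > 0")
  case True
  have "(1 / t) ^ (n + 2) / fact (n + 2) \<le> (\<Sum>k<n + 3. (1 / t) ^ k / fact k)"
    by (rule member_le_sum[of "n + 2" "{..<n + 3}" "\<lambda>k. (1 / t) ^ k / fact k"]) (use True in auto)
  also have "\<dots> \<le> exp (1 / t)"
    using sum_le_suminf[OF summable_exp, of "{..<n+3}" "1/t"] True
    by (simp add: exp_def divide_inverse mult.commute scaleR_conv_of_real)
  finally have "exp (- (1 / t)) * ((1 / t) ^ (n + 2) / fact (n + 2)) \<le> exp (- (1 / t)) * exp (1 / t)"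
    by (rule mult_left_mono) simp
  also have "\<dots> = 1" by (simp add: exp_add[symmetric])
  finally have "exp (- (1 / t)) * (1 / t ^ (n + 2)) \<le> fact (n + 2)"
    by (simp only: times_divide_eq_right pos_divide_le_eq[OF fact_gt_zero] power_one_over mult_1)
  then have "exp (- (1 / t)) * (1 / t ^ (n + 2)) * t\<^sup>2 \<le> fact (n + 2) * t\<^sup>2"
    by (rule mult_right_mono) simp
  then show ?thesis using True
    by (simp add: flat_fun_def power_add power2_eq_square del: fact_Suc)
qed (simp add: flat_fun_def)

lemma has_derivative_flat_fun:
  "(flat_fun n has_real_derivative flat_fun (n + 2) t - n * flat_fun (n + 1) t) (at t)"
proof -
  consider "t > 0" | "t < 0" | "t = 0" by linarith
  then show ?thesis
  proof cases
    case 1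
    have "((\<lambda>t. exp (- 1 / t) / t ^ n) has_real_derivative
        flat_fun (n + 2) t - n * flat_fun (n + 1) t) (at t)"
    proof -
      have "real n * t ^ (n - Suc 0) = real n * t ^ n / t" using 1 by (cases n) auto
      then show ?thesis using 1
        by (auto intro!: derivative_eq_intros simp: flat_fun_def)
          (simp add: field_simps power2_eq_square)
    qed
    then show ?thesis
      by (rule has_field_derivative_transform_within_open[of _ _ _ "{0<..}"])
        (use 1 in \<open>auto simp: flat_fun_def\<close>)
  next
    case 2
    have "((\<lambda>t. 0) has_real_derivative flat_fun (n + 2) t - n * flat_fun (n + 1) t) (at t)"
      using 2 by (simp add: flat_fun_def)
    then show ?thesis
      by (rule has_field_derivative_transform_within_open[of _ _ _ "{..<0}"])
        (use 2 in \<open>auto simp: flat_fun_def\<close>)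
  next
    case 3
    have "((\<lambda>h. (flat_fun n (0 + h) - flat_fun n 0) / h) \<longlongrightarrow> 0) (at 0)"
    proof (rule Lim_null_comparison)
      show "\<forall>\<^sub>F h in at 0. norm ((flat_fun n (0 + h) - flat_fun n 0) / h) \<le> fact (n + 2) * \<bar>h\<bar>"
      proof (rule always_eventually, rule allI)
        fix h :: real
        show "norm ((flat_fun n (0 + h) - flat_fun n 0) / h) \<le> fact (n + 2) * \<bar>h\<bar>"
          using flat_fun_bound[of n h]
          by (cases "h = 0") (auto simp: flat_fun_def field_simps power2_eq_square abs_mult split: if_splits)
      qed
      show "((\<lambda>h. fact (n + 2) * \<bar>h\<bar>) \<longlongrightarrow> 0) (at (0::real))"
        by (auto intro!: tendsto_eq_intros)
    qed
    then show ?thesis using 3 by (simp add: has_field_derivative_iff flat_fun_def)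
  qed
qed

lemma Ck_on_flat_fun:
  fixes q :: "'v::euclidean_space \<Rightarrow> real"
  assumes "open U" "Ck_on k U q"
  shows "Ck_on k U (\<lambda>x. flat_fun n (q x))"
  using assms(2)
proof (induction k arbitrary: n)
  case 0
  have "continuous_on UNIV (flat_fun n)"
    by (rule DERIV_continuous_on) (use has_derivative_flat_fun in blast)
  from continuous_on_compose2[OF this, of U q] 0 show ?case by simp
next
  case (Suc k)
  show ?case
  proof (rule Ck_on_SucI[OF assms(1)])
    show "((\<lambda>x. flat_fun n (q x)) has_derivative
       (\<lambda>v. (flat_fun (n + 2) (q x) + (- real n) * flat_fun (n + 1) (q x)) * frechet_derivative q (at x) v)) (at x)"
      if "x \<in> U" for x
    proof -
      have "(flat_fun n has_derivative
          (*) (flat_fun (n + 2) (q x) + (- real n) * flat_fun (n + 1) (q x))) (at (q x))"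
        using has_derivative_flat_fun[of n "q x"] by (simp add: has_field_derivative_def)
      from has_derivative_compose[OF Ck_on_has_derivative[OF Suc.prems that] this]
      show ?thesis .
    qed
    show "Ck_on k U (\<lambda>x. (flat_fun (n + 2) (q x) + (- real n) * flat_fun (n + 1) (q x)) * frechet_derivative q (at x) v)" for v
      by (intro Ck_on_mult Ck_on_add Ck_on_const assms Suc.IH) (use Suc.prems Ck_on_SucD in auto)
  qed
qed

definition ball_bump :: "real \<Rightarrow> 'v::euclidean_space \<Rightarrow> 'v \<Rightarrow> real" where
  "ball_bump r y x = flat_fun 0 (r\<^sup>2 + - ((x - y) \<bullet> (x - y)))"

lemma smooth_on_ball_bump: "smooth_on UNIV (ball_bump r y)"
proof -
  have "smooth_on UNIV (\<lambda>x. r\<^sup>2 + - ((x - y) \<bullet> (x - y)))"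
    by (intro smooth_on_add smooth_on_const smooth_on_uminus smooth_on_norm_sq open_UNIV)
  then show ?thesis by (auto simp: smooth_on_def ball_bump_def[abs_def] intro: Ck_on_flat_fun)
qed

lemma ball_bump_nonneg: "ball_bump r y x \<ge> 0"
  by (simp add: ball_bump_def flat_fun_def)

lemma ball_bump_nonzero_iff:
  assumes "r > 0"
  shows "ball_bump r y x \<noteq> 0 \<longleftrightarrow> x \<in> ball y r"
proof -
  have "(x - y) \<bullet> (x - y) = (dist y x)\<^sup>2" by (simp add: dist_norm norm_minus_commute power2_norm_eq_inner)
  then have "ball_bump r y x \<noteq> 0 \<longleftrightarrow> (dist y x)\<^sup>2 < r\<^sup>2" by (simp add: ball_bump_def flat_fun_def)
  also have "\<dots> \<longleftrightarrow> x \<in> ball y r" using assms power_strict_mono[of "dist y x" r 2]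
      power2_less_imp_less[of "dist y x" r] by auto
  finally show ?thesis .
qed

text \<open>The exponent \<open>j\<close> is arbitrary for the sake of the induction: the chain rule
  along t -> t x contributes one more factor \<open>t\<close>, so the derivative is an integral of
  the same kind with \<open>Suc j\<close>.\<close>

lemma Ck_on_ray_integral:
  fixes g :: "'v::euclidean_space \<Rightarrow> real"
  assumes "open U" "convex U" "0 \<in> U" "Ck_on k U g"
  shows "Ck_on k U (\<lambda>x. integral {0..1} (\<lambda>t. t ^ j * g (t *\<^sub>R x)))"
  using assms(4)
proof (induction k arbitrary: j g)
  case 0
  have ray: "t *\<^sub>R x \<in> U" if "x \<in> U" "t \<in> {0..1}" for x :: 'v and t :: real
    using convexD[OF assms(2) assms(3) that(1), of "1 - t" t] that by auto
  have "continuous_on (U \<times> cbox 0 1) (\<lambda>p. g (snd p *\<^sub>R fst p))"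
    by (rule continuous_on_compose2[of U g _ "\<lambda>p. snd p *\<^sub>R fst p"])
      (use 0 ray in \<open>auto intro!: continuous_intros\<close>)
  then have "continuous_on (U \<times> cbox 0 1) (\<lambda>p. snd p ^ j * g (snd p *\<^sub>R fst p))"
    by (intro continuous_on_mult continuous_on_power continuous_on_snd continuous_on_id)
  then have "continuous_on U (\<lambda>x. integral (cbox 0 1) (\<lambda>t. t ^ j * g (t *\<^sub>R x)))"
    by (intro integral_continuous_on_param) (simp add: case_prod_unfold)
  then show ?case by simp
next
  case (Suc k)
  have ray: "t *\<^sub>R x \<in> U" if "x \<in> U" "t \<in> {0..1}" for x :: 'v and t :: real
    using convexD[OF assms(2) assms(3) that(1), of "1 - t" t] that by auto
  \<comment> \<open>\<open>leibniz_rule\<close> asks for a derivative that is continuous as a map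
    into the bounded linear maps; in finite dimension this can be tested on single vectors.\<close>
  define L where "L x t = Blinfun (\<lambda>v. t ^ Suc j * frechet_derivative g (at (t *\<^sub>R x)) v)" for x t
  have der: "(g has_derivative frechet_derivative g (at x)) (at x)" if "x \<in> U" for x
    using Ck_on_has_derivative[OF Suc.prems that] .
  have L: "L x t v = t ^ Suc j * frechet_derivative g (at (t *\<^sub>R x)) v" if "x \<in> U" "t \<in> {0..1}" for x t v
    unfolding L_def
    by (subst bounded_linear_Blinfun_apply)
      (auto intro!: bounded_linear_const_mult has_derivative_bounded_linear[OF der[OF ray[OF that]]])
  have cont: "continuous_on (U \<times> cbox 0 1) (\<lambda>p. L (fst p) (snd p) v)" for v
  proof -
    have "continuous_on U (\<lambda>x. frechet_derivative g (at x) v)"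
      by (intro Ck_on_imp_continuous_on[of k]) (use Suc.prems in simp)
    then have "continuous_on (U \<times> cbox 0 1) (\<lambda>p. frechet_derivative g (at (snd p *\<^sub>R fst p)) v)"
      by (rule continuous_on_compose2[of U "\<lambda>x. frechet_derivative g (at x) v" _ "\<lambda>p. snd p *\<^sub>R fst p"])
        (use ray in \<open>auto intro!: continuous_intros\<close>)
    then have "continuous_on (U \<times> cbox 0 1)
        (\<lambda>p. snd p ^ Suc j * frechet_derivative g (at (snd p *\<^sub>R fst p)) v)"
      by (intro continuous_on_mult continuous_on_power continuous_on_snd continuous_on_id)
    then show ?thesis by (rule continuous_on_eq) (use L in auto)
  qed
  have contL: "continuous_on (U \<times> cbox 0 1) (\<lambda>(x, t). L x t)"
    unfolding case_prod_unfold by (rule continuous_on_blinfun_componentwise) (rule cont)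
  show ?case
  proof (rule Ck_on_SucI[OF assms(1)])
    fix x assume x: "x \<in> U"
    have "((\<lambda>x. integral (cbox 0 1) (\<lambda>t. t ^ j * g (t *\<^sub>R x))) has_derivative
        blinfun_apply (integral (cbox 0 1) (L x))) (at x within U)"
    proof (rule leibniz_rule[OF _ _ contL x assms(2)])
      fix y :: 'v and t :: real assume yt: "y \<in> U" "t \<in> cbox 0 1"
      have "((\<lambda>x. t ^ j * g (t *\<^sub>R x)) has_derivative
          (\<lambda>v. t ^ j * frechet_derivative g (at (t *\<^sub>R y)) (t *\<^sub>R v))) (at y)"
        by (rule has_derivative_mult_right[OF has_derivative_compose[of "\<lambda>x. t *\<^sub>R x" "\<lambda>v. t *\<^sub>R v" y UNIV g]])
          (use yt der ray in \<open>auto intro!: derivative_eq_intros\<close>)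
      moreover have "t ^ j * frechet_derivative g (at (t *\<^sub>R y)) (t *\<^sub>R v) = L y t v" for v
        using L yt linear_cmul[OF has_derivative_linear[OF der[OF ray[of y t]]]] by simp
      ultimately show "((\<lambda>x. t ^ j * g (t *\<^sub>R x)) has_derivative blinfun_apply (L y t)) (at y within U)"
        by (simp add: has_derivative_at_withinI)
    next
      fix y assume "y \<in> U"
      then have "continuous_on (cbox 0 1) (\<lambda>t. g (t *\<^sub>R y))"
        by (intro continuous_on_compose2[OF Ck_on_imp_continuous_on[OF Suc.prems], of _ "\<lambda>t. t *\<^sub>R y"])
          (use ray in \<open>auto intro!: continuous_intros\<close>)
      then have "continuous_on (cbox 0 1) (\<lambda>t. t ^ j * g (t *\<^sub>R y))"
        by (intro continuous_on_mult continuous_on_power continuous_on_id)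
      then show "(\<lambda>t. t ^ j * g (t *\<^sub>R y)) integrable_on cbox 0 1"
        by (rule integrable_continuous)
    qed
    then have "((\<lambda>x. integral {0..1} (\<lambda>t. t ^ j * g (t *\<^sub>R x))) has_derivative
        blinfun_apply (integral {0..1} (L x))) (at x)"
      unfolding at_within_open[OF x assms(1)] cbox_interval .
    moreover have "blinfun_apply (integral {0..1} (L x)) v =
        integral {0..1} (\<lambda>t. t ^ Suc j * frechet_derivative g (at (t *\<^sub>R x)) v)" for v
    proof -
      have "continuous_on (cbox 0 1) (\<lambda>t. L x t)"
        using continuous_on_compose2[OF contL, of "cbox 0 1" "\<lambda>t. (x, t)"] x
        by (simp add: continuous_on_Pair continuous_on_const continuous_on_id image_subset_iff)
      then have "L x integrable_on {0..1}" using integrable_continuous by fastforce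
      then have "blinfun_apply (integral {0..1} (L x)) v = integral {0..1} (\<lambda>t. L x t v)"
        by (rule blinfun_apply_integral)
      also have "\<dots> = integral {0..1} (\<lambda>t. t ^ Suc j * frechet_derivative g (at (t *\<^sub>R x)) v)"
        by (rule integral_cong) (use L x in auto)
      finally show ?thesis .
    qed
    ultimately show "((\<lambda>x. integral {0..1} (\<lambda>t. t ^ j * g (t *\<^sub>R x))) has_derivative
        (\<lambda>v. integral {0..1} (\<lambda>t. t ^ Suc j * frechet_derivative g (at (t *\<^sub>R x)) v))) (at x)"
      by (rule has_derivative_eq_rhs[OF _ ext])
  next
    show "Ck_on k U (\<lambda>x. integral {0..1} (\<lambda>t. t ^ Suc j * frechet_derivative g (at (t *\<^sub>R x)) v))" for v
      by (rule Suc.IH) (use Suc.prems in auto)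
  qed
qed


section \<open>Smooth partitions of unity\<close>

text \<open>The index set varies with \<open>x\<close>, but near a given point it can be enlarged to
  one fixed finite set, the additional terms being 0. Keeping \<open>p\<close> apart from
  \<open>f\<close> allows \<open>f\<close> to be \<open>p\<close> times a coefficient.\<close>

lemma smooth_on_locally_finite_sum:
  assumes "open U" "\<And>y. smooth_on U (f y)" "\<And>x y. p y x = 0 \<Longrightarrow> f y x = 0"
    "\<And>x. \<exists>N. open N \<and> x \<in> N \<and> finite {y. \<exists>z\<in>N. p y z \<noteq> 0}"
  shows "smooth_on U (\<lambda>x. \<Sum>y | p y x \<noteq> 0. f y x)"
proof (rule smooth_on_local)
  fix x assume x: "x \<in> U"
  obtain N where N: "open N" "x \<in> N" "finite {y. \<exists>z\<in>N. p y z \<noteq> 0}" using assms(4) by blast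
  let ?Y = "{y. \<exists>z\<in>N. p y z \<noteq> 0}"
  have "(\<Sum>y | p y z \<noteq> 0. f y z) = (\<Sum>y\<in>?Y. f y z)" if "z \<in> U \<inter> N" for z
    by (rule sum.mono_neutral_left) (use N that assms(3) in auto)
  moreover have "smooth_on (U \<inter> N) (\<lambda>x. \<Sum>y\<in>?Y. f y x)"
    by (rule smooth_on_subset[OF smooth_on_sum[OF assms(1,2)]]) auto
  ultimately have "smooth_on (U \<inter> N) (\<lambda>x. \<Sum>y | p y x \<noteq> 0. f y x)"
    using smooth_on_cong[of "U \<inter> N"] N assms(1) by (metis (no_types, lifting) open_Int)
  then show "\<exists>N. open N \<and> x \<in> N \<and> smooth_on N (\<lambda>x. \<Sum>y | p y x \<noteq> 0. f y x)"
    using N x assms(1) by (intro exI[of _ "U \<inter> N"]) auto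
qed

text \<open>Each compact shell between the radii k and k + 1 needs finitely many balls, with centres
  in the shell. A bounded region meets finitely many shells, hence contains finitely many
  centres.\<close>

lemma locally_finite_ball_cover:
  fixes r :: "'v::euclidean_space \<Rightarrow> real"
  assumes "\<And>y. r y > 0"
  obtains T where "\<And>R. finite (T \<inter> ball 0 R)" "(\<Union>y\<in>T. ball y (r y)) = UNIV"
proof -
  have "\<exists>T. finite T \<and> T \<subseteq> - ball 0 (real k) \<and> cball 0 (real k + 1) - ball 0 (real k) \<subseteq> (\<Union>y\<in>T. ball y (r y))" for k
  proof -
    have c: "compact (cball 0 (real k + 1) - ball (0::'v) (real k))" by (simp add: compact_diff)
    have "cball 0 (real k + 1) - ball 0 (real k) \<subseteq>
        (\<Union>y\<in>cball 0 (real k + 1) - ball 0 (real k). ball y (r y))"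
      using assms by (auto intro!: bexI)
    from compactE_image[OF c _ this] obtain T where
      "T \<subseteq> cball 0 (real k + 1) - ball 0 (real k)" "finite T"
      "cball 0 (real k + 1) - ball 0 (real k) \<subseteq> (\<Union>y\<in>T. ball y (r y))" by auto
    then show ?thesis by (intro exI[of _ T]) auto
  qed
  then obtain T where T: "\<And>k. finite (T k)" "\<And>k. T k \<subseteq> - ball 0 (real k)"
    "\<And>k. cball 0 (real k + 1) - ball 0 (real k) \<subseteq> (\<Union>y\<in>T k. ball y (r y))" by metis
  show thesis
  proof (rule that[of "\<Union>k. T k"])
    fix R
    have "(\<Union>k. T k) \<inter> ball 0 R \<subseteq> (\<Union>k\<le>nat \<lceil>R\<rceil>. T k)"
    proof
      fix y assume "y \<in> (\<Union>k. T k) \<inter> ball 0 R"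
      then obtain k where k: "y \<in> T k" "norm y < R" by auto
      then have "real k \<le> norm y" using T(2)[of k] by auto
      then have "k \<le> nat \<lceil>R\<rceil>" using k by linarith
      then show "y \<in> (\<Union>k\<le>nat \<lceil>R\<rceil>. T k)" using k by auto
    qed
    then show "finite ((\<Union>k. T k) \<inter> ball 0 R)" by (rule finite_subset) (auto intro: T)
  next
    have "x \<in> (\<Union>y\<in>(\<Union>k. T k). ball y (r y))" for x
    proof -
      have "x \<in> cball 0 (real (nat \<lfloor>norm x\<rfloor>) + 1) - ball 0 (real (nat \<lfloor>norm x\<rfloor>))"
        by (simp add: not_less)
      from subsetD[OF T(3) this] show ?thesis by blast
    qed
    then show "(\<Union>y\<in>(\<Union>k. T k). ball y (r y)) = UNIV" by blast
  qed
qed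

text \<open>The sum is restricted to the nonzero terms because a sum over an infinite index set is \<open>0\<close>.\<close>

definition smooth_partition :: "('v::euclidean_space \<Rightarrow> 'v set) \<Rightarrow> ('v \<Rightarrow> 'v \<Rightarrow> real) \<Rightarrow> bool" where
  "smooth_partition W p \<longleftrightarrow>
     (\<forall>y. smooth_on UNIV (p y)) \<and>
     (\<forall>y. \<exists>K. closed K \<and> K \<subseteq> W y \<and> (\<forall>x. x \<notin> K \<longrightarrow> p y x = 0)) \<and>
     (\<forall>x. \<exists>N. open N \<and> x \<in> N \<and> finite {y. \<exists>z\<in>N. p y z \<noteq> 0}) \<and>
     (\<forall>x. (\<Sum>y | p y x \<noteq> 0. p y x) = 1)"

lemma smooth_partition_exists:
  fixes W :: "'v::euclidean_space \<Rightarrow> 'v set"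
  assumes "\<And>y. open (W y)" "\<And>y. y \<in> W y"
  obtains p where "smooth_partition W p"
proof -
  have "\<exists>r. 0 < r \<and> r \<le> 1 \<and> cball y r \<subseteq> W y" for y
  proof -
    obtain e where "e > 0" "cball y e \<subseteq> W y" using assms open_contains_cball by metis
    \<comment> \<open>The bound 1 on the radii turns finiteness of the centres in bounded regions
      into local finiteness of the balls: a ball that meets \<open>ball x 1\<close> has its centre
      within \<open>norm x + 2\<close> of 0.\<close>
    then show ?thesis by (intro exI[of _ "min e 1"]) auto
  qed
  then obtain r where r: "\<And>y. 0 < r y" "\<And>y. r y \<le> 1" "\<And>y. cball y (r y) \<subseteq> W y" by metis
  obtain T where T: "\<And>R. finite (T \<inter> ball 0 R)" "(\<Union>y\<in>T. ball y (r y)) = UNIV"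
    using locally_finite_ball_cover[of r] r(1) by metis
  \<comment> \<open>Points outside \<open>T\<close> get the zero function, so that the partition is
    indexed by all points, like the family \<open>W\<close>.\<close>
  define q where "q y x = (if y \<in> T then ball_bump (r y) y x else 0)" for y x
  define S where "S x = (\<Sum>y | q y x \<noteq> 0. q y x)" for x
  have q_iff: "q y x \<noteq> 0 \<longleftrightarrow> y \<in> T \<and> x \<in> ball y (r y)" for x y
    by (simp add: q_def ball_bump_nonzero_iff r)
  have fin: "\<exists>N. open N \<and> x \<in> N \<and> finite {y. \<exists>z\<in>N. q y z \<noteq> 0}" for x
  proof (intro exI[of _ "ball x 1"] conjI)
    have "norm y < norm x + 2" if "dist x z < 1" "dist y z < r y" for y z
    proof -
      have "norm y \<le> norm x + (dist x z + dist y z)"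
        using norm_triangle_ineq2[of y x] dist_triangle2[of y x z] by (simp add: dist_norm norm_minus_commute)
      then show ?thesis using that r(2)[of y] by linarith
    qed
    then have "{y. \<exists>z\<in>ball x 1. q y z \<noteq> 0} \<subseteq> T \<inter> ball 0 (norm x + 2)" by (auto simp: q_iff)
    then show "finite {y. \<exists>z\<in>ball x 1. q y z \<noteq> 0}" using T(1) finite_subset by blast
  qed auto
  have finx: "finite {y. q y x \<noteq> 0}" for x
    using fin[of x] by (auto elim: rev_finite_subset)
  have smq: "smooth_on UNIV (q y)" for y
    by (cases "y \<in> T") (auto simp: q_def[abs_def] smooth_on_const smooth_on_ball_bump)
  have smS: "smooth_on UNIV S"
    unfolding S_def by (rule smooth_on_locally_finite_sum) (use smq fin in auto)
  have S_pos: "S x > 0" for x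
  proof -
    obtain y where "y \<in> T" "x \<in> ball y (r y)" using T(2) by blast
    then have "q y x \<noteq> 0" by (simp add: q_iff)
    moreover have "q y x \<ge> 0" for y by (simp add: q_def ball_bump_nonneg)
    ultimately show ?thesis unfolding S_def
      by (intro sum_pos2[OF finx, of y]) (auto simp: less_le)
  qed
  have nz: "q y x * inverse (S x) \<noteq> 0 \<longleftrightarrow> q y x \<noteq> 0" for x y using S_pos[of x] by simp
  show thesis
  proof (rule that[of "\<lambda>y x. q y x * inverse (S x)"], unfold smooth_partition_def nz, intro conjI allI)
    show "smooth_on UNIV (\<lambda>x. q y x * inverse (S x))" for y
      by (intro smooth_on_mult smooth_on_inverse smq smS open_UNIV) (use S_pos in \<open>metis less_irrefl\<close>)
    show "\<exists>K. closed K \<and> K \<subseteq> W y \<and> (\<forall>x. x \<notin> K \<longrightarrow> q y x * inverse (S x) = 0)" for y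
    proof (intro exI[of _ "cball y (r y)"] conjI allI impI)
      show "q y x * inverse (S x) = 0" if "x \<notin> cball y (r y)" for x
        using that q_iff[of y x] by auto
    qed (use r(3) in auto)
    show "(\<Sum>y | q y x \<noteq> 0. q y x * inverse (S x)) = 1" for x
      using S_pos[of x] by (simp add: sum_distrib_right[symmetric] S_def[symmetric])
  qed (rule fin)
qed

lemma smooth_partition_mem: "smooth_partition W p \<Longrightarrow> p y x \<noteq> 0 \<Longrightarrow> x \<in> W y"
  unfolding smooth_partition_def by blast

lemma smooth_partition_sum: "smooth_partition W p \<Longrightarrow> (\<Sum>y | p y x \<noteq> 0. p y x) = 1"
  by (simp add: smooth_partition_def)


section \<open>Alternating forms\<close>

text \<open>The predicate \<^const>\<open>alternating_form\<close> for forms with values in an arbitrary vector space.\<close>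

definition alt_form :: "int \<Rightarrow> ('v::real_vector list \<Rightarrow> 'a::real_vector) \<Rightarrow> bool" where
  "alt_form k \<omega> \<longleftrightarrow>
     (\<forall>vs. int (length vs) \<noteq> k \<longrightarrow> \<omega> vs = 0) \<and>
     (\<forall>vs j. int (length vs) = k \<and> j < length vs \<longrightarrow> linear (\<lambda>u. \<omega> (vs[j := u]))) \<and>
     (\<forall>vs. int (length vs) = k \<and> \<not> distinct vs \<longrightarrow> \<omega> vs = 0)"

lemma alternating_form_eq_alt_form: "alternating_form k \<omega> \<longleftrightarrow> alt_form k \<omega>"
  by (simp add: alternating_form_def alt_form_def)

lemma alt_form_length: "alt_form k \<omega> \<Longrightarrow> int (length vs) \<noteq> k \<Longrightarrow> \<omega> vs = 0"
  by (simp add: alt_form_def)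

lemma alt_form_linear: "alt_form k \<omega> \<Longrightarrow> j < length vs \<Longrightarrow> linear (\<lambda>u. \<omega> (vs[j := u]))"
proof (cases "int (length vs) = k")
  case False
  assume "alt_form k \<omega>"
  then have "\<omega> (vs[j := u]) = 0" for u using False by (simp add: alt_form_def)
  then show ?thesis by (simp add: linear_0 module_hom_zero)
qed (auto simp: alt_form_def)

lemma alt_form_not_distinct: "alt_form k \<omega> \<Longrightarrow> \<not> distinct vs \<Longrightarrow> \<omega> vs = 0"
  by (auto simp: alt_form_def)

lemma alt_formI:
  assumes "\<And>vs. int (length vs) \<noteq> k \<Longrightarrow> \<omega> vs = 0"
    "\<And>vs j. int (length vs) = k \<Longrightarrow> j < length vs \<Longrightarrow> linear (\<lambda>u. \<omega> (vs[j := u]))"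
    "\<And>vs. int (length vs) = k \<Longrightarrow> \<not> distinct vs \<Longrightarrow> \<omega> vs = 0"
  shows "alt_form k \<omega>"
  using assms by (auto simp: alt_form_def)

lemma alt_form_linear_append: "alt_form k \<omega> \<Longrightarrow> linear (\<lambda>u. \<omega> (xs @ u # zs))"
  using alt_form_linear[of k \<omega> "length xs" "xs @ undefined # zs"] by simp

lemma alt_form_zero: "alt_form k (\<lambda>vs. 0)"
  by (auto simp: alt_form_def linear_0 module_hom_zero)

lemma alt_form_add: "alt_form k \<omega> \<Longrightarrow> alt_form k \<eta> \<Longrightarrow> alt_form k (\<lambda>vs. \<omega> vs + \<eta> vs)"
  by (auto simp: alt_form_def linear_compose_add)

lemma alt_form_scaleR: "alt_form k \<omega> \<Longrightarrow> alt_form k (\<lambda>vs. c *\<^sub>R \<omega> vs)"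
  by (auto simp: alt_form_def linear_compose_scale_right)

lemma alt_form_scaleR_right:
  fixes \<omega> :: "'v::real_vector list \<Rightarrow> real"
  assumes "alt_form k \<omega>"
  shows "alt_form k (\<lambda>vs. \<omega> vs *\<^sub>R a)"
proof (rule alt_formI)
  fix vs :: "'v list" and j assume "int (length vs) = k" "j < length vs"
  then have "linear (\<lambda>u. \<omega> (vs[j := u]))" using assms alt_form_linear by blast
  then show "linear (\<lambda>u. \<omega> (vs[j := u]) *\<^sub>R a)"
    by (auto simp: linear_iff scaleR_left_distrib)
qed (use assms in \<open>auto simp: alt_form_def\<close>)

lemma alt_form_sum: "(\<And>i. i \<in> I \<Longrightarrow> alt_form k (\<omega> i)) \<Longrightarrow> alt_form k (\<lambda>vs. \<Sum>i\<in>I. \<omega> i vs)"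
  by (induction I rule: infinite_finite_induct) (auto intro: alt_form_zero alt_form_add)

lemma alt_form_contract:
  assumes "alt_form k \<omega>"
  shows "alt_form (k - 1) (\<lambda>vs. \<omega> (v # vs))"
proof (rule alt_formI)
  fix vs :: "'a list" and j assume "j < length vs"
  then show "linear (\<lambda>u. \<omega> (v # vs[j := u]))"
    using alt_form_linear[OF assms, of "Suc j" "v # vs"] by simp
qed (use alt_form_length[OF assms] alt_form_not_distinct[OF assms] in auto)

text \<open>Polarization: the value with \<open>u + v\<close> in both slots is 0 and is expanded by
  linearity.\<close>

lemma alt_form_swap:
  assumes "alt_form k \<omega>"
  shows "\<omega> (xs @ u # v # zs) = - \<omega> (xs @ v # u # zs)"
proof -
  note l1 = alt_form_linear_append[OF assms]
  have l2: "linear (\<lambda>w. \<omega> (xs @ t # w # zs))" for t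
    using alt_form_linear_append[OF assms, of "xs @ [t]"] by simp
  have z: "\<omega> (xs @ w # w # zs) = 0" for w by (rule alt_form_not_distinct[OF assms]) simp
  have "0 = \<omega> (xs @ (u + v) # (u + v) # zs)" by (simp add: z)
  also have "\<dots> = \<omega> (xs @ u # v # zs) + \<omega> (xs @ v # u # zs)"
    by (simp add: linear_add[OF l1] linear_add[OF l2] z)
  finally show ?thesis by (simp add: eq_neg_iff_add_eq_0)
qed

lemma alt_form_move:
  assumes "alt_form k \<omega>"
  shows "\<omega> (xs @ v # ys @ zs) = (-1) ^ length ys *\<^sub>R \<omega> (xs @ ys @ v # zs)"
proof (induction ys arbitrary: xs)
  case (Cons y ys)
  have "\<omega> (xs @ v # (y # ys) @ zs) = - \<omega> ((xs @ [y]) @ v # ys @ zs)"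
    using alt_form_swap[OF assms, of xs v y "ys @ zs"] by simp
  then show ?case using Cons[of "xs @ [y]"] by simp
qed simp

section \<open>Wedge products\<close>

definition drop_nth :: "nat \<Rightarrow> 'a list \<Rightarrow> 'a list" where
  "drop_nth i vs = take i vs @ drop (Suc i) vs"

lemma length_drop_nth: "i < length vs \<Longrightarrow> length (drop_nth i vs) = length vs - 1"
  by (simp add: drop_nth_def)

lemma nth_drop_nth:
  "i < length vs \<Longrightarrow> j < length vs - 1 \<Longrightarrow> drop_nth i vs ! j = (if j < i then vs ! j else vs ! Suc j)"
  by (auto simp: drop_nth_def nth_append min_def)

lemma alt_form_nth_front:
  assumes "alt_form k \<omega>" "i < length vs"
  shows "\<omega> (vs ! i # drop_nth i vs) = (-1) ^ i *\<^sub>R \<omega> vs"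
  using alt_form_move[OF assms(1), of "[]" "vs ! i" "take i vs" "drop (Suc i) vs"] assms(2)
  by (simp add: drop_nth_def id_take_nth_drop[symmetric])

text \<open>For \<open>\<beta> v = \<theta> v *\<^sub>R \<omega>\<close> this is \<open>\<theta> \<and> \<omega>\<close>, for \<open>\<beta> v\<close> the derivative of a form in direction \<open>v\<close> it is
  the exterior derivative.\<close>

definition wedge :: "('v \<Rightarrow> 'v list \<Rightarrow> 'a::real_vector) \<Rightarrow> 'v list \<Rightarrow> 'a" where
  "wedge \<beta> vs = (\<Sum>i<length vs. (-1) ^ i *\<^sub>R \<beta> (vs ! i) (drop_nth i vs))"

text \<open>Suppose the entries at positions a < b coincide. A summand that removes another entry
  still sees both copies and vanishes. The two summands removing one of the copies differ by moving
  \<open>v\<close> across the b - a - 1 entries in between; together with the signs (-1)^a and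
  (-1)^b this makes them cancel.\<close>

lemma alt_form_wedge:
  fixes \<beta> :: "'v::real_vector \<Rightarrow> 'v list \<Rightarrow> 'a::real_vector"
  assumes alt: "\<And>v. alt_form k (\<beta> v)" and lin: "\<And>vs. linear (\<lambda>v. \<beta> v vs)"
  shows "alt_form (k + 1) (wedge \<beta>)"
proof (rule alt_formI)
  fix vs :: "'v list" assume "int (length vs) \<noteq> k + 1"
  then have "\<beta> (vs ! i) (drop_nth i vs) = 0" if "i < length vs" for i
    using that by (intro alt_form_length[OF alt]) (auto simp: length_drop_nth)
  then show "wedge \<beta> vs = 0" by (simp add: wedge_def)
next
  fix vs :: "'v list" and j assume j: "j < length vs"
  have "linear (\<lambda>u. (-1) ^ i *\<^sub>R \<beta> (vs[j := u] ! i) (drop_nth i (vs[j := u])))" if i: "i < length vs" for i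
  proof (rule linear_compose_scale_right)
    consider "i = j" | "i < j" | "j < i" by linarith
    then show "linear (\<lambda>u. \<beta> (vs[j := u] ! i) (drop_nth i (vs[j := u])))"
    proof cases
      case 1
      then show ?thesis using lin j by (simp add: drop_nth_def)
    next
      case 2
      then have "drop_nth i (vs[j := u]) = (drop_nth i vs)[j - 1 := u]" for u
        using j by (auto simp: list_eq_iff_nth_eq length_drop_nth nth_drop_nth nth_list_update)
      then show ?thesis using 2 j alt_form_linear[OF alt, of "j - 1" "drop_nth i vs"]
        by (simp add: length_drop_nth)
    next
      case 3
      then have "drop_nth i (vs[j := u]) = (drop_nth i vs)[j := u]" for u
        using i by (auto simp: list_eq_iff_nth_eq length_drop_nth nth_drop_nth nth_list_update)
      then show ?thesis using 3 i alt_form_linear[OF alt, of "j" "drop_nth i vs"]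
        by (simp add: length_drop_nth)
    qed
  qed
  then show "linear (\<lambda>u. wedge \<beta> (vs[j := u]))"
    unfolding wedge_def by (simp add: linear_compose_sum)
next
  fix vs :: "'v list" assume "\<not> distinct vs"
  then obtain xs ys zs v where vs: "vs = xs @ [v] @ ys @ [v] @ zs"
    using not_distinct_decomp by blast
  define a b where "a = length xs" and "b = length xs + length ys + 1"
  have ab: "a < b" "b < length vs" "vs ! a = v" "vs ! b = v"
    by (auto simp: a_def b_def vs nth_append)
  have da: "drop_nth a vs = xs @ ys @ v # zs" and db: "drop_nth b vs = xs @ v # ys @ zs"
    by (auto simp: a_def b_def vs drop_nth_def)
  have "\<beta> (vs ! i) (drop_nth i vs) = 0" if i: "i < length vs" "i \<noteq> a" "i \<noteq> b" for i
  proof (rule alt_form_not_distinct[OF alt])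
    \<comment> \<open>The positions of the two equal entries after entry \<open>i\<close> has been
      removed.\<close>
    define a' b' where "a' = (if a < i then a else a - 1)" and "b' = (if b < i then b else b - 1)"
    have "a' < length vs - 1" "b' < length vs - 1" "a' \<noteq> b'"
      using ab i by (auto simp: a'_def b'_def)
    moreover have "drop_nth i vs ! a' = vs ! a" "drop_nth i vs ! b' = vs ! b"
      using ab i by (auto simp: a'_def b'_def nth_drop_nth)
    ultimately show "\<not> distinct (drop_nth i vs)"
      using ab i by (auto simp: distinct_conv_nth length_drop_nth)
  qed
  then have "wedge \<beta> vs = (\<Sum>i\<in>{a, b}. (-1) ^ i *\<^sub>R \<beta> (vs ! i) (drop_nth i vs))"
    unfolding wedge_def by (intro sum.mono_neutral_right) (use ab in auto)
  also have "\<dots> = (-1) ^ a *\<^sub>R \<beta> v (xs @ ys @ v # zs) + (-1) ^ b *\<^sub>R \<beta> v (xs @ v # ys @ zs)"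
    using ab by (simp add: da db)
  also have "\<dots> = 0"
    by (subst alt_form_move[OF alt]) (simp add: a_def b_def power_add flip: power_mult_distrib)
  finally show "wedge \<beta> vs = 0" .
qed

section \<open>A spanning family of constant forms\<close>

text \<open>Indexing by all lists of basis vectors, instead of the increasing ones, gives only a spanning
  family of forms, but one with the expansion formula below. The factor comes from
  \<open>\<Sum>\<^sub>b b\<^sup>* \<and> \<iota>\<^sub>b \<omega> = (k + 1) \<omega>\<close> for a form of degree \<open>k + 1\<close>.\<close>

fun alt_frame :: "'v::euclidean_space list \<Rightarrow> 'v list \<Rightarrow> real" where
  "alt_frame [] vs = (if vs = [] then 1 else 0)"
| "alt_frame (b # bs) vs = wedge (\<lambda>v ws. (v \<bullet> b) * alt_frame bs ws) vs / (real (length bs) + 1)"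

lemma alt_form_alt_frame: "alt_form (int (length bs)) (alt_frame bs)"
proof (induction bs)
  case Nil
  show ?case by (auto intro!: alt_formI)
next
  case (Cons b bs)
  have "alt_form (int (length bs) + 1) (wedge (\<lambda>v ws. (v \<bullet> b) * alt_frame bs ws))"
  proof (rule alt_form_wedge)
    show "alt_form (int (length bs)) (\<lambda>ws. (v \<bullet> b) * alt_frame bs ws)" for v
      using alt_form_scaleR[OF Cons, of "v \<bullet> b"] by simp
    show "linear (\<lambda>v. (v \<bullet> b) * alt_frame bs vs)" for vs
      by (auto simp: linear_iff inner_add_left algebra_simps)
  qed
  from alt_form_scaleR[OF this, of "1 / (real (length bs) + 1)"]
  show ?case by (simp add: add.commute fun_eq_iff)
qed

definition basis_lists :: "int \<Rightarrow> 'v::euclidean_space list set" where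
  "basis_lists k = {bs. set bs \<subseteq> Basis \<and> int (length bs) = k}"

lemma finite_basis_lists: "finite (basis_lists k)"
  using finite_lists_length_eq[OF finite_Basis, of "nat k"]
  by (rule rev_finite_subset) (auto simp: basis_lists_def)

lemma basis_lists_Suc: "basis_lists (int (Suc n)) = (\<lambda>(b, bs). b # bs) ` (Basis \<times> basis_lists (int n))"
proof -
  have "int (length bs) = int (Suc n) \<longleftrightarrow> length bs = Suc n" for bs :: "'a list" by linarith
  then show ?thesis by (auto simp: basis_lists_def length_Suc_conv image_iff)
qed

text \<open>Contraction with a basis vector \<open>b\<close> lowers the degree, so the induction
  hypothesis expands \<open>\<omega> (b # ws)\<close>; summing over \<open>b\<close> puts
  \<open>vs ! i\<close> back into the first slot. Moving it to its place cancels the sign, so each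
  of the n + 1 positions contributes \<open>\<omega> vs\<close>, and the denominator in
  \<open>alt_frame\<close> takes their mean.\<close>

lemma alt_form_expansion_nat:
  fixes \<omega> :: "'v::euclidean_space list \<Rightarrow> 'a::real_vector"
  assumes "alt_form (int n) \<omega>"
  shows "\<omega> vs = (\<Sum>bs\<in>basis_lists (int n). alt_frame bs vs *\<^sub>R \<omega> bs)"
  using assms
proof (induction n arbitrary: \<omega> vs)
  case 0
  have "basis_lists (int 0) = {[] :: 'v list}" by (auto simp: basis_lists_def)
  moreover have "vs \<noteq> [] \<Longrightarrow> \<omega> vs = 0" by (rule alt_form_length[OF 0]) simp
  ultimately show ?case by simp
next
  case (Suc n)
  show ?case
  proof (cases "length vs = Suc n")
    case False
    then have "alt_frame bs vs = 0" if "bs \<in> basis_lists (int (Suc n))" for bs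
      using that by (intro alt_form_length[OF alt_form_alt_frame]) (auto simp: basis_lists_def)
    moreover have "\<omega> vs = 0" by (rule alt_form_length[OF Suc.prems]) (use False in simp)
    ultimately show ?thesis by (simp del: of_nat_Suc)
  next
    case True
    have "(\<Sum>bs\<in>basis_lists (int (Suc n)). alt_frame bs vs *\<^sub>R \<omega> bs) =
        (\<Sum>b\<in>Basis. \<Sum>bs\<in>basis_lists (int n). alt_frame (b # bs) vs *\<^sub>R \<omega> (b # bs))"
    proof -
      have inj: "inj_on (\<lambda>(b, bs). b # bs) (Basis \<times> basis_lists (int n) :: ('v \<times> 'v list) set)"
        by (auto simp: inj_on_def)
      show ?thesis
        unfolding basis_lists_Suc sum.reindex[OF inj] sum.cartesian_product
        by (rule sum.cong) (auto simp del: alt_frame.simps)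
    qed
    also have "\<dots> = (\<Sum>b\<in>Basis. \<Sum>bs\<in>basis_lists (int n). \<Sum>i<length vs.
        (((-1) ^ i * (vs ! i \<bullet> b)) / (real n + 1)) *\<^sub>R alt_frame bs (drop_nth i vs) *\<^sub>R \<omega> (b # bs))"
    proof (intro sum.cong refl)
      fix b :: 'v and bs :: "'v list" assume "bs \<in> basis_lists (int n)"
      then have "alt_frame (b # bs) vs = (\<Sum>i<length vs.
          (((-1) ^ i * (vs ! i \<bullet> b)) / (real n + 1)) * alt_frame bs (drop_nth i vs))"
        by (simp add: wedge_def basis_lists_def sum_divide_distrib mult.assoc)
      then show "alt_frame (b # bs) vs *\<^sub>R \<omega> (b # bs) = (\<Sum>i<length vs.
          (((-1) ^ i * (vs ! i \<bullet> b)) / (real n + 1)) *\<^sub>R alt_frame bs (drop_nth i vs) *\<^sub>R \<omega> (b # bs))"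
        by (simp add: scaleR_sum_left)
    qed
    also have "\<dots> = (\<Sum>b\<in>Basis. \<Sum>i<length vs. \<Sum>bs\<in>basis_lists (int n). 
        (((-1) ^ i * (vs ! i \<bullet> b)) / (real n + 1)) *\<^sub>R alt_frame bs (drop_nth i vs) *\<^sub>R \<omega> (b # bs))"
      by (intro sum.cong refl sum.swap)
    also have "\<dots> = (\<Sum>i<length vs. \<Sum>b\<in>Basis. \<Sum>bs\<in>basis_lists (int n). 
        (((-1) ^ i * (vs ! i \<bullet> b)) / (real n + 1)) *\<^sub>R alt_frame bs (drop_nth i vs) *\<^sub>R \<omega> (b # bs))"
      by (rule sum.swap)
    also have "\<dots> = (\<Sum>i<length vs. ((-1) ^ i / (real n + 1)) *\<^sub>R \<omega> (vs ! i # drop_nth i vs))"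
    proof (intro sum.cong refl)
      fix i assume "i \<in> {..<length vs}"
      have IH: "(\<Sum>bs\<in>basis_lists (int n). alt_frame bs ws *\<^sub>R \<omega> (b # bs)) = \<omega> (b # ws)" for b ws
        using Suc.IH[of "\<lambda>ws. \<omega> (b # ws)" ws] alt_form_contract[OF Suc.prems, of b] by simp
      have lin: "linear (\<lambda>u. \<omega> (u # drop_nth i vs))"
        using alt_form_linear_append[OF Suc.prems, of "[]"] by simp
      have "(\<Sum>b\<in>Basis. \<Sum>bs\<in>basis_lists (int n).
          (((-1) ^ i * (vs ! i \<bullet> b)) / (real n + 1)) *\<^sub>R alt_frame bs (drop_nth i vs) *\<^sub>R \<omega> (b # bs)) =
          (\<Sum>b\<in>Basis. ((-1) ^ i / (real n + 1)) *\<^sub>R (vs ! i \<bullet> b) *\<^sub>R \<omega> (b # drop_nth i vs))"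
        by (rule sum.cong[OF refl], simp only: scaleR_sum_right[symmetric] IH) simp
      also have "\<dots> = ((-1) ^ i / (real n + 1)) *\<^sub>R \<omega> ((\<Sum>b\<in>Basis. (vs ! i \<bullet> b) *\<^sub>R b) # drop_nth i vs)"
        by (simp add: scaleR_sum_right linear_sum[OF lin] linear_cmul[OF lin])
      finally show "(\<Sum>b\<in>Basis. \<Sum>bs\<in>basis_lists (int n).
          (((-1) ^ i * (vs ! i \<bullet> b)) / (real n + 1)) *\<^sub>R alt_frame bs (drop_nth i vs) *\<^sub>R \<omega> (b # bs)) =
          ((-1) ^ i / (real n + 1)) *\<^sub>R \<omega> (vs ! i # drop_nth i vs)"
        by (simp add: euclidean_representation)
    qed
    also have "\<dots> = (\<Sum>i<length vs. (1 / (real n + 1)) *\<^sub>R \<omega> vs)"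
    proof (intro sum.cong refl)
      fix i assume "i \<in> {..<length vs}"
      then show "((-1) ^ i / (real n + 1)) *\<^sub>R \<omega> (vs ! i # drop_nth i vs) = (1 / (real n + 1)) *\<^sub>R \<omega> vs"
        by (simp add: alt_form_nth_front[OF Suc.prems] flip: power_mult_distrib)
    qed
    also have "\<dots> = \<omega> vs" by (simp add: True sum_constant_scaleR add.commute del: of_nat_Suc)
       (simp add: field_simps)
    finally show ?thesis ..
  qed
qed

lemma alt_form_expansion:
  fixes \<omega> :: "'v::euclidean_space list \<Rightarrow> 'a::real_vector"
  assumes "alt_form k \<omega>"
  shows "\<omega> vs = (\<Sum>bs\<in>basis_lists k. alt_frame bs vs *\<^sub>R \<omega> bs)"
proof (cases "k < 0")
  case True
  then have "basis_lists k = ({} :: 'v list set)" by (auto simp: basis_lists_def)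
  then show ?thesis using alt_form_length[OF assms, of vs] True by simp
next
  case False
  then show ?thesis using alt_form_expansion_nat[of "nat k" \<omega> vs] assms by simp
qed


section \<open>Sections of vector bundles\<close>

lemma sections_restrict:
  assumes "s \<in> sections B U" "W \<subseteq> U"
  shows "restrict s W \<in> sections B W"
proof -
  have "\<exists>c. (\<forall>j<r. smooth_on (W \<inter> X) (c j :: 'a \<Rightarrow> real)) \<and>
      (\<forall>x\<in>W \<inter> X. restrict s W x = (\<Sum>j<r. c j x *\<^sub>R e j x))" if "(X, r, e) \<in> frames B" for X r e
  proof -
    obtain c where "\<forall>j<r. smooth_on (U \<inter> X) (c j :: 'a \<Rightarrow> real)"
      "\<forall>x\<in>U \<inter> X. s x = (\<Sum>j<r. c j x *\<^sub>R e j x)"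
      using assms(1) \<open>(X, r, e) \<in> frames B\<close> unfolding sections_def by blast
    then show ?thesis using assms(2)
      by (intro exI[of _ c]) (auto intro: smooth_on_subset)
  qed
  then show ?thesis using assms unfolding sections_def by auto
qed

lemma sections_coefficients:
  assumes "s \<in> sections B U" "(W, r, e) \<in> frames B"
  obtains c :: "nat \<Rightarrow> 'v::euclidean_space \<Rightarrow> real" where "\<And>j. j < r \<Longrightarrow> smooth_on (U \<inter> W) (c j)"
    "\<And>x. x \<in> U \<inter> W \<Longrightarrow> s x = (\<Sum>j<r. c j x *\<^sub>R e j x)"
  using assms unfolding sections_def by blast

lemma sections_fiber: "s \<in> sections B U \<Longrightarrow> x \<in> U \<Longrightarrow> s x \<in> fiber B x"
  by (simp add: sections_def)

lemma sectionsI: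
  fixes B :: "('v::euclidean_space, 'e::real_vector) vector_bundle"
  assumes "s \<in> extensional U" "\<And>x. x \<in> U \<Longrightarrow> s x \<in> fiber B x"
    "\<And>W r e. (W, r, e) \<in> frames B \<Longrightarrow> \<exists>c. (\<forall>j<r. smooth_on (U \<inter> W) (c j :: 'v \<Rightarrow> real)) \<and>
           (\<forall>x\<in>U \<inter> W. s x = (\<Sum>j<r. c j x *\<^sub>R e j x))"
  shows "s \<in> sections B U"
  using assms unfolding sections_def by blast

locale vbundle =
  fixes B :: "('v::euclidean_space, 'e::real_vector) vector_bundle"
  assumes smooth_bundle: "smooth_vector_bundle B"
begin

lemma subspace_fiber: "subspace (fiber B x)"
  using smooth_bundle by (simp add: smooth_vector_bundle_def)

lemma frame_exists: obtains W r e where "(W, r, e) \<in> frames B" "x \<in> W"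
  using smooth_bundle unfolding smooth_vector_bundle_def by blast

lemma frame_open: "(W, r, e) \<in> frames B \<Longrightarrow> open W"
  using smooth_bundle unfolding smooth_vector_bundle_def by blast

lemma frame_section: "(W, r, e) \<in> frames B \<Longrightarrow> j < r \<Longrightarrow> restrict (e j) W \<in> sections B W"
  using smooth_bundle unfolding smooth_vector_bundle_def by blast

lemma frame_basis:
  assumes "(W, r, e) \<in> frames B" "x \<in> W"
  shows "inj_on (\<lambda>j. e j x) {..<r}" "independent ((\<lambda>j. e j x) ` {..<r})"
    "span ((\<lambda>j. e j x) ` {..<r}) = fiber B x"
  using assms smooth_bundle unfolding smooth_vector_bundle_def by blast+

text \<open>A coefficient is read off by a linear functional on the ambient space. Multilinear
  identities between values of sections thereby pass to their coefficients, although the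
  coefficients are obtained by choice.\<close>

lemma frame_dual:
  assumes "(W, r, e) \<in> frames B" "x \<in> W" "j < r"
  obtains g :: "'e \<Rightarrow> real" where "linear g" "\<And>c. g (\<Sum>i<r. c i *\<^sub>R e i x) = c j"
proof -
  obtain g :: "'e \<Rightarrow> real" where g: "linear g"
    "\<And>v. v \<in> (\<lambda>j. e j x) ` {..<r} \<Longrightarrow> g v = (if v = e j x then 1 else 0)"
    using linear_independent_extend[OF frame_basis(2)[OF assms(1,2)], of "\<lambda>v. if v = e j x then 1 else 0"]
    by blast
  have "g (e i x) = (if i = j then 1 else 0)" if "i < r" for i
    using g(2)[of "e i x"] that assms(3) inj_onD[OF frame_basis(1)[OF assms(1,2)], of i j] by auto
  then have "g (\<Sum>i<r. c i *\<^sub>R e i x) = (\<Sum>i<r. if i = j then c i else 0)" for c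
    unfolding linear_sum[OF g(1)] by (intro sum.cong refl) (simp add: linear_cmul[OF g(1)])
  then have "g (\<Sum>i<r. c i *\<^sub>R e i x) = c j" for c using assms(3) by simp
  with g(1) show thesis using that by blast
qed

lemma sections_zero:
  assumes "open U"
  shows "(\<lambda>x\<in>U. 0) \<in> sections B U"
proof (rule sectionsI)
  fix W r e assume fr: "(W, r, e) \<in> frames B"
  show "\<exists>c. (\<forall>j<r. smooth_on (U \<inter> W) (c j :: 'v \<Rightarrow> real)) \<and>
      (\<forall>x\<in>U \<inter> W. (\<lambda>x\<in>U. 0) x = (\<Sum>j<r. c j x *\<^sub>R e j x))"
    by (rule exI[of _ "\<lambda>_ _. 0"]) (simp add: smooth_on_const[OF open_Int[OF assms frame_open[OF fr]]])
qed (simp_all add: subspace_0[OF subspace_fiber])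

lemma sections_add:
  assumes "open U" "s \<in> sections B U" "t \<in> sections B U"
  shows "(\<lambda>x\<in>U. s x + t x) \<in> sections B U"
proof (rule sectionsI)
  fix W r e assume fr: "(W, r, e) \<in> frames B"
  from sections_coefficients[OF assms(2) fr] obtain c :: "nat \<Rightarrow> 'v \<Rightarrow> real" where
    "\<And>j. j < r \<Longrightarrow> smooth_on (U \<inter> W) (c j)" "\<And>x. x \<in> U \<inter> W \<Longrightarrow> s x = (\<Sum>j<r. c j x *\<^sub>R e j x)"
    by blast
  moreover from sections_coefficients[OF assms(3) fr] obtain d :: "nat \<Rightarrow> 'v \<Rightarrow> real" where
    "\<And>j. j < r \<Longrightarrow> smooth_on (U \<inter> W) (d j)" "\<And>x. x \<in> U \<inter> W \<Longrightarrow> t x = (\<Sum>j<r. d j x *\<^sub>R e j x)"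
    by blast
  ultimately show "\<exists>c. (\<forall>j<r. smooth_on (U \<inter> W) (c j :: 'v \<Rightarrow> real)) \<and>
      (\<forall>x\<in>U \<inter> W. (\<lambda>x\<in>U. s x + t x) x = (\<Sum>j<r. c j x *\<^sub>R e j x))"
    using assms(1) frame_open[OF fr]
    by (intro exI[of _ "\<lambda>j x. c j x + d j x"])
      (auto simp: scaleR_left_distrib sum.distrib intro!: smooth_on_add)
qed (use assms in \<open>auto intro: subspace_add[OF subspace_fiber] sections_fiber\<close>)

lemma sections_scaleR:
  assumes "open U" "s \<in> sections B U" "smooth_on U f"
  shows "(\<lambda>x\<in>U. f x *\<^sub>R s x) \<in> sections B U"
proof (rule sectionsI)
  fix W r e assume fr: "(W, r, e) \<in> frames B"
  from sections_coefficients[OF assms(2) fr] obtain c :: "nat \<Rightarrow> 'v \<Rightarrow> real" where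
    "\<And>j. j < r \<Longrightarrow> smooth_on (U \<inter> W) (c j)" "\<And>x. x \<in> U \<inter> W \<Longrightarrow> s x = (\<Sum>j<r. c j x *\<^sub>R e j x)"
    by blast
  then show "\<exists>c. (\<forall>j<r. smooth_on (U \<inter> W) (c j :: 'v \<Rightarrow> real)) \<and>
      (\<forall>x\<in>U \<inter> W. (\<lambda>x\<in>U. f x *\<^sub>R s x) x = (\<Sum>j<r. c j x *\<^sub>R e j x))"
    using assms(1,3) frame_open[OF fr]
    by (intro exI[of _ "\<lambda>j x. f x * c j x"])
      (auto simp: scaleR_sum_right intro!: smooth_on_mult intro: smooth_on_subset)
qed (use assms in \<open>auto intro: subspace_scale[OF subspace_fiber] sections_fiber\<close>)

lemma sections_sum:
  assumes "open U" "\<And>i. i \<in> I \<Longrightarrow> (\<lambda>x\<in>U. s i x) \<in> sections B U"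
  shows "(\<lambda>x\<in>U. \<Sum>i\<in>I. s i x) \<in> sections B U"
  using assms(2)
proof (induction I rule: infinite_finite_induct)
  case (insert i I)
  then have "(\<lambda>x\<in>U. (\<lambda>x\<in>U. s i x) x + (\<lambda>x\<in>U. \<Sum>i\<in>I. s i x) x) \<in> sections B U"
    by (intro sections_add assms(1)) auto
  also have "(\<lambda>x\<in>U. (\<lambda>x\<in>U. s i x) x + (\<lambda>x\<in>U. \<Sum>i\<in>I. s i x) x) = (\<lambda>x\<in>U. \<Sum>i\<in>insert i I. s i x)"
    using insert(1,2) by (auto simp: fun_eq_iff)
  finally show ?case .
qed (auto intro: sections_zero assms(1))

lemma sections_frame_combination:
  assumes "(W, r, e) \<in> frames B" "open U" "U \<subseteq> W" "\<And>j. j < r \<Longrightarrow> smooth_on U (c j)"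
  shows "(\<lambda>x\<in>U. \<Sum>j<r. c j x *\<^sub>R e j x) \<in> sections B U"
proof (rule sections_sum[OF assms(2)])
  fix j assume "j \<in> {..<r}"
  then have "restrict (restrict (e j) W) U \<in> sections B U"
    using frame_section[OF assms(1)] sections_restrict assms(3) by blast
  then have "(\<lambda>x\<in>U. c j x *\<^sub>R restrict (restrict (e j) W) U x) \<in> sections B U"
    by (rule sections_scaleR[OF assms(2)]) (use \<open>j \<in> {..<r}\<close> assms(4) in simp)
  also have "(\<lambda>x\<in>U. c j x *\<^sub>R restrict (restrict (e j) W) U x) = (\<lambda>x\<in>U. c j x *\<^sub>R e j x)"
    using assms(3) by (auto simp: fun_eq_iff)
  finally show "(\<lambda>x\<in>U. c j x *\<^sub>R e j x) \<in> sections B U" .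
qed

text \<open>Only the values of \<open>s y\<close> on \<open>W y\<close> enter, because
  \<open>p y\<close> vanishes elsewhere. In a frame over \<open>X\<close> the coefficients of
  \<open>s y\<close> are smooth merely on \<open>W y \<inter> X\<close>; multiplied by
  \<open>p y\<close> they extend smoothly by 0 to \<open>X\<close>.\<close>

lemma sections_glue:
  assumes p: "smooth_partition W p" and W: "\<And>y. open (W y)"
    and s: "\<And>y. restrict (s y) (W y) \<in> sections B (W y)"
  shows "(\<lambda>x. \<Sum>y | p y x \<noteq> 0. p y x *\<^sub>R s y x) \<in> sections B UNIV"
proof (rule sectionsI)
  show "(\<Sum>y | p y x \<noteq> 0. p y x *\<^sub>R s y x) \<in> fiber B x" for x
  proof (rule subspace_sum[OF subspace_fiber])
    fix y assume "y \<in> {y. p y x \<noteq> 0}"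
    then have "x \<in> W y" using smooth_partition_mem[OF p] by simp
    then show "p y x *\<^sub>R s y x \<in> fiber B x"
      using sections_fiber[OF s, of x] by (simp add: subspace_scale[OF subspace_fiber])
  qed
next
  fix X r e assume fr: "(X, r, e) \<in> frames B"
  have "\<exists>c. (\<forall>j<r. smooth_on (W y \<inter> X) (c j :: 'v \<Rightarrow> real))
      \<and> (\<forall>x\<in>W y \<inter> X. s y x = (\<Sum>j<r. c j x *\<^sub>R e j x))" for y
  proof -
    from sections_coefficients[OF s[of y] fr] obtain c :: "nat \<Rightarrow> 'v \<Rightarrow> real" where
      "\<And>j. j < r \<Longrightarrow> smooth_on (W y \<inter> X) (c j)"
      "\<And>x. x \<in> W y \<inter> X \<Longrightarrow> restrict (s y) (W y) x = (\<Sum>j<r. c j x *\<^sub>R e j x)"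
      by blast
    then show ?thesis by (intro exI[of _ c]) simp
  qed
  then have "\<exists>c. \<forall>y. (\<forall>j<r. smooth_on (W y \<inter> X) (c y j :: 'v \<Rightarrow> real))
      \<and> (\<forall>x\<in>W y \<inter> X. s y x = (\<Sum>j<r. c y j x *\<^sub>R e j x))"
    by (intro choice allI)
  then obtain c where c: "\<forall>y. (\<forall>j<r. smooth_on (W y \<inter> X) (c y j :: 'v \<Rightarrow> real))
      \<and> (\<forall>x\<in>W y \<inter> X. s y x = (\<Sum>j<r. c y j x *\<^sub>R e j x))"
    by (rule exE)
  have "smooth_on X (\<lambda>x. \<Sum>y | p y x \<noteq> 0. p y x * c y j x)" if j: "j < r" for j
  proof (rule smooth_on_locally_finite_sum)
    show "smooth_on X (\<lambda>x. p y x * c y j x)" for y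
    proof -
      obtain K where K: "closed K" "K \<subseteq> W y" "\<And>x. x \<notin> K \<Longrightarrow> p y x = 0"
        using p unfolding smooth_partition_def by blast
      have "smooth_on X (p y)" using p smooth_on_subset unfolding smooth_partition_def by blast
      then show ?thesis
        by (rule smooth_on_cutoff[OF frame_open[OF fr] W K(1,2) _ _ K(3)])
          (use spec[OF c, of y] j in \<open>simp add: Int_commute\<close>)
    qed
    show "\<exists>N. open N \<and> x \<in> N \<and> finite {y. \<exists>z\<in>N. p y z \<noteq> 0}" for x
      using p unfolding smooth_partition_def by blast
  qed (auto intro: frame_open[OF fr])
  moreover have "(\<Sum>y | p y x \<noteq> 0. p y x *\<^sub>R s y x) =
      (\<Sum>j<r. (\<Sum>y | p y x \<noteq> 0. p y x * c y j x) *\<^sub>R e j x)" if "x \<in> X" for x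
  proof -
    have "(\<Sum>y | p y x \<noteq> 0. p y x *\<^sub>R s y x) = (\<Sum>y | p y x \<noteq> 0. \<Sum>j<r. (p y x * c y j x) *\<^sub>R e j x)"
    proof (rule sum.cong[OF refl])
      fix y assume "y \<in> {y. p y x \<noteq> 0}"
      then have "x \<in> W y \<inter> X" using smooth_partition_mem[OF p] that by simp
      then show "p y x *\<^sub>R s y x = (\<Sum>j<r. (p y x * c y j x) *\<^sub>R e j x)"
        using spec[OF c, of y] by (simp add: scaleR_sum_right)
    qed
    also have "\<dots> = (\<Sum>j<r. (\<Sum>y | p y x \<noteq> 0. p y x * c y j x) *\<^sub>R e j x)"
      by (subst sum.swap) (simp add: scaleR_sum_left)
    finally show ?thesis .
  qed
  ultimately show "\<exists>c. (\<forall>j<r. smooth_on (UNIV \<inter> X) (c j :: 'v \<Rightarrow> real)) \<and>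
      (\<forall>x\<in>UNIV \<inter> X. (\<Sum>y | p y x \<noteq> 0. p y x *\<^sub>R s y x) = (\<Sum>j<r. c j x *\<^sub>R e j x))"
    by (intro exI[of _ "\<lambda>j x. \<Sum>y | p y x \<noteq> 0. p y x * c y j x"]) auto
qed simp

text \<open>The cover consists of a frame domain around \<open>x0\<close> and the complement of
  \<open>x0\<close>. At \<open>x0\<close> only the first member has nonzero weight, so gluing a
  constant combination of the frame with the zero section keeps the value \<open>u\<close>.\<close>

lemma section_through:
  assumes "u \<in> fiber B x0"
  obtains s where "s \<in> sections B UNIV" "s x0 = u"
proof -
  obtain X r e where fr: "(X, r, e) \<in> frames B" "x0 \<in> X" by (rule frame_exists)
  have "u \<in> span ((\<lambda>j. e j x0) ` {..<r})" using assms frame_basis(3)[OF fr] by simp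
  then obtain a where a: "u = (\<Sum>v\<in>(\<lambda>j. e j x0) ` {..<r}. a v *\<^sub>R v)"
    by (auto simp: span_finite)
  have a: "u = (\<Sum>j<r. a (e j x0) *\<^sub>R e j x0)"
    unfolding a by (subst sum.reindex[OF frame_basis(1)[OF fr]]) simp
  define W where "W y = (if y = x0 then X else - {x0})" for y
  define s where "s y x = (if y = x0 then \<Sum>j<r. a (e j x0) *\<^sub>R e j x else 0)" for y x
  have W: "open (W y)" "y \<in> W y" for y using fr frame_open[OF fr(1)] by (auto simp: W_def)
  obtain p where p: "smooth_partition W p" using smooth_partition_exists[OF W] by blast
  have "restrict (s y) (W y) \<in> sections B (W y)" for y
    using sections_frame_combination[OF fr(1) frame_open[OF fr(1)] order_refl, of "\<lambda>j x. a (e j x0)"]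
      sections_zero[of "W y"] W(1)[of y]
    by (cases "y = x0") (simp_all add: s_def W_def smooth_on_const frame_open[OF fr(1)] cong: restrict_cong)
  from sections_glue[OF p W(1) this]
  have "(\<lambda>x. \<Sum>y | p y x \<noteq> 0. p y x *\<^sub>R s y x) \<in> sections B UNIV" .
  moreover have "(\<Sum>y | p y x0 \<noteq> 0. p y x0 *\<^sub>R s y x0) = u"
  proof -
    have "p y x0 \<noteq> 0 \<Longrightarrow> y = x0" for y
      using smooth_partition_mem[OF p, of y x0] by (auto simp: W_def split: if_splits)
    then have "(\<Sum>y | p y x0 \<noteq> 0. p y x0 *\<^sub>R s y x0) = (\<Sum>y | p y x0 \<noteq> 0. p y x0 *\<^sub>R u)"
      by (intro sum.cong) (auto simp: s_def a)
    then show ?thesis using smooth_partition_sum[OF p, of x0] by (simp flip: scaleR_sum_left)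
  qed
  ultimately show thesis using that by blast
qed

lemma linear_on_fibers_zero:
  assumes "linear_on_fibers B \<phi>" shows "\<phi> x 0 = 0"
proof -
  have "\<phi> x (0 + 0) = \<phi> x 0 + \<phi> x 0"
    using assms subspace_0[OF subspace_fiber] unfolding linear_on_fibers_def by blast
  then show ?thesis by simp
qed

lemma linear_on_fibers_sum:
  assumes "linear_on_fibers B \<phi>" "\<And>i. i \<in> I \<Longrightarrow> u i \<in> fiber B x"
  shows "\<phi> x (\<Sum>i\<in>I. c i *\<^sub>R u i) = (\<Sum>i\<in>I. c i *\<^sub>R \<phi> x (u i))"
  using assms(2)
proof (induction I rule: infinite_finite_induct)
  case (insert i I)
  have "c i *\<^sub>R u i \<in> fiber B x" "(\<Sum>i\<in>I. c i *\<^sub>R u i) \<in> fiber B x"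
    using insert by (auto intro!: subspace_sum subspace_scale subspace_fiber)
  then show ?case using insert assms(1) by (simp add: linear_on_fibers_def)
qed (simp_all add: linear_on_fibers_zero[OF assms(1)])

text \<open>Local preimages of \<open>t\<close> are averaged with a partition of unity. By fibrewise
  linearity an average of preimages of \<open>t x\<close> with weights of sum 1 is again a preimage,
  so images in the sense of sheaves are images on global sections.\<close>

lemma image_sheaf_global:
  fixes \<phi> :: "'v \<Rightarrow> 'e \<Rightarrow> 'f::real_vector"
  assumes lin: "linear_on_fibers B \<phi>" and t: "t \<in> image_sheaf (sections B) \<phi> UNIV"
  obtains s where "s \<in> sections B UNIV" "\<And>x. \<phi> x (s x) = t x"
proof -
  have "\<forall>y. \<exists>W s. open W \<and> y \<in> W \<and> s \<in> sections B W \<and> restrict t W = push \<phi> W s"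
    using t unfolding image_sheaf_def by blast
  then obtain W s where W: "\<And>y. open (W y)" "\<And>y. y \<in> W y"
    and s: "\<And>y. s y \<in> sections B (W y)" "\<And>y. restrict t (W y) = push \<phi> (W y) (s y)" by metis
  obtain p where p: "smooth_partition W p" using smooth_partition_exists[OF W] by blast
  have "restrict (s y) (W y) \<in> sections B (W y)" for y using sections_restrict[OF s(1)] by blast
  from sections_glue[OF p W(1) this]
  have "(\<lambda>x. \<Sum>y | p y x \<noteq> 0. p y x *\<^sub>R s y x) \<in> sections B UNIV" .
  moreover have "\<phi> x (\<Sum>y | p y x \<noteq> 0. p y x *\<^sub>R s y x) = t x" for x
  proof -
    have y: "x \<in> W y" if "p y x \<noteq> 0" for y using smooth_partition_mem[OF p that] .
    have "\<phi> x (s y x) = t x" if "p y x \<noteq> 0" for y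
      using fun_cong[OF s(2)[of y], of x] y[OF that] by (simp add: push_def)
    moreover have "\<phi> x (\<Sum>y | p y x \<noteq> 0. p y x *\<^sub>R s y x) = (\<Sum>y | p y x \<noteq> 0. p y x *\<^sub>R \<phi> x (s y x))"
      by (rule linear_on_fibers_sum[OF lin]) (use sections_fiber[OF s(1)] y in auto)
    ultimately show ?thesis
      using smooth_partition_sum[OF p, of x] by (simp flip: scaleR_sum_left)
  qed
  ultimately show thesis using that by blast
qed

end

text \<open>For \<beta> = \<theta> \<omega> this is the antiderivation rule for contraction with
  \<open>v\<close>: the contraction of \<theta> \<and> \<omega> is \<theta>(v) \<omega> minus
  \<theta> wedged with the contraction of \<omega>.\<close>

lemma wedge_Cons: "wedge \<beta> (v # vs) = \<beta> v vs - wedge (\<lambda>u ws. \<beta> u (v # ws)) vs"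
proof -
  have "wedge \<beta> (v # vs) = \<beta> v vs + (\<Sum>i<length vs. - ((-1) ^ i *\<^sub>R \<beta> (vs ! i) (v # drop_nth i vs)))"
    by (simp add: wedge_def sum.lessThan_Suc_shift drop_nth_def del: sum.lessThan_Suc)
  then show ?thesis by (simp add: wedge_def sum_negf)
qed


section \<open>Exactness of the Koszul complex of a vector bundle\<close>

lemma alt_form_linear_compose:
  fixes \<omega> :: "'v::real_vector list \<Rightarrow> 'a::real_vector"
  assumes "linear g" "alt_form k \<omega>"
  shows "alt_form k (\<lambda>vs. g (\<omega> vs))"
proof (rule alt_formI)
  fix vs :: "'v list" and j assume "j < length vs"
  from linear_compose[OF alt_form_linear[OF assms(2) this] assms(1)]
  show "linear (\<lambda>u. g (\<omega> (vs[j := u])))" by (simp add: o_def)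
qed (use assms alt_form_length[OF assms(2)] alt_form_not_distinct[OF assms(2)] in \<open>simp_all add: linear_0\<close>)

lemma frechet_derivative_zero: "frechet_derivative (\<lambda>y. 0) (at x) = (\<lambda>v. 0)"
  by (rule frechet_derivative_at[symmetric]) simp

lemma alt_form_frechet_derivative:
  fixes c :: "'v::euclidean_space \<Rightarrow> 'v list \<Rightarrow> real"
  assumes U: "open U" "x \<in> U" and alt: "\<And>y. y \<in> U \<Longrightarrow> alt_form k (c y)"
    and smooth: "\<And>vs. smooth_on U (\<lambda>y. c y vs)"
  shows "alt_form k (\<lambda>vs. frechet_derivative (\<lambda>y. c y vs) (at x) v)"
proof (rule alt_formI)
  fix vs :: "'v list"
  have zero: "frechet_derivative (\<lambda>y. c y vs) (at x) v = 0" if "\<And>y. y \<in> U \<Longrightarrow> c y vs = 0"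
    using frechet_derivative_cong_open[OF U, of "\<lambda>y. c y vs" "\<lambda>y. 0"] that
    by (simp add: frechet_derivative_zero)
  show "frechet_derivative (\<lambda>y. c y vs) (at x) v = 0" if "int (length vs) \<noteq> k"
    by (rule zero) (use alt alt_form_length that in blast)
  show "frechet_derivative (\<lambda>y. c y vs) (at x) v = 0" if "\<not> distinct vs"
    by (rule zero) (use alt alt_form_not_distinct that in blast)
next
  fix vs :: "'v list" and j assume j: "j < length vs"
  note der = smooth_on_has_derivative[OF smooth U(2)]
  note lin = alt_form_linear[OF alt j]
  show "linear (\<lambda>u. frechet_derivative (\<lambda>y. c y (vs[j := u])) (at x) v)"
  proof (rule linearI)
    fix a b
    have "((\<lambda>y. c y (vs[j := a]) + c y (vs[j := b])) has_derivative
        (\<lambda>v. frechet_derivative (\<lambda>y. c y (vs[j := a])) (at x) v +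
          frechet_derivative (\<lambda>y. c y (vs[j := b])) (at x) v)) (at x)"
      by (rule has_derivative_add[OF der der])
    note sum = frechet_derivative_at[OF this]
    have "frechet_derivative (\<lambda>y. c y (vs[j := a + b])) (at x) =
        frechet_derivative (\<lambda>y. c y (vs[j := a]) + c y (vs[j := b])) (at x)"
      by (rule frechet_derivative_cong_open[OF U]) (rule linear_add[OF lin])
    then show "frechet_derivative (\<lambda>y. c y (vs[j := a + b])) (at x) v =
        frechet_derivative (\<lambda>y. c y (vs[j := a])) (at x) v +
        frechet_derivative (\<lambda>y. c y (vs[j := b])) (at x) v"
      unfolding sum[symmetric] by simp
  next
    fix r :: real and a
    have "((\<lambda>y. r *\<^sub>R c y (vs[j := a])) has_derivative
        (\<lambda>v. r *\<^sub>R frechet_derivative (\<lambda>y. c y (vs[j := a])) (at x) v)) (at x)"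
      by (rule has_derivative_scaleR_right[OF der])
    note scale = frechet_derivative_at[OF this]
    have "frechet_derivative (\<lambda>y. c y (vs[j := r *\<^sub>R a])) (at x) =
        frechet_derivative (\<lambda>y. r *\<^sub>R c y (vs[j := a])) (at x)"
      by (rule frechet_derivative_cong_open[OF U]) (rule linear_cmul[OF lin])
    then show "frechet_derivative (\<lambda>y. c y (vs[j := r *\<^sub>R a])) (at x) v =
        r *\<^sub>R frechet_derivative (\<lambda>y. c y (vs[j := a])) (at x) v"
      unfolding scale[symmetric] by simp
  qed
qed

lemma alt_form_integral:
  fixes \<omega> :: "real \<Rightarrow> 'v::euclidean_space list \<Rightarrow> real"
  assumes alt: "\<And>t. t \<in> S \<Longrightarrow> alt_form k (\<omega> t)"
    and int: "\<And>vs. (\<lambda>t. \<omega> t vs) integrable_on S"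
  shows "alt_form k (\<lambda>vs. integral S (\<lambda>t. \<omega> t vs))"
proof (rule alt_formI)
  fix vs :: "'v list"
  have zero: "integral S (\<lambda>t. \<omega> t vs) = 0" if "\<And>t. t \<in> S \<Longrightarrow> \<omega> t vs = 0"
    using integral_cong[of S "\<lambda>t. \<omega> t vs" "\<lambda>t. 0"] that by simp
  show "integral S (\<lambda>t. \<omega> t vs) = 0" if "int (length vs) \<noteq> k"
    by (rule zero) (use alt alt_form_length that in blast)
  show "integral S (\<lambda>t. \<omega> t vs) = 0" if "\<not> distinct vs"
    by (rule zero) (use alt alt_form_not_distinct that in blast)
next
  fix vs :: "'v list" and j assume j: "j < length vs"
  note lin = alt_form_linear[OF alt j]
  show "linear (\<lambda>u. integral S (\<lambda>t. \<omega> t (vs[j := u])))"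
  proof (rule linearI)
    fix a b
    have "integral S (\<lambda>t. \<omega> t (vs[j := a + b])) = integral S (\<lambda>t. \<omega> t (vs[j := a]) + \<omega> t (vs[j := b]))"
      by (rule integral_cong) (rule linear_add[OF lin])
    then show "integral S (\<lambda>t. \<omega> t (vs[j := a + b])) =
        integral S (\<lambda>t. \<omega> t (vs[j := a])) + integral S (\<lambda>t. \<omega> t (vs[j := b]))"
      by (simp add: integral_add int)
  next
    fix r :: real and a
    have "integral S (\<lambda>t. \<omega> t (vs[j := r *\<^sub>R a])) = integral S (\<lambda>t. r *\<^sub>R \<omega> t (vs[j := a]))"
      by (rule integral_cong) (rule linear_cmul[OF lin])
    then show "integral S (\<lambda>t. \<omega> t (vs[j := r *\<^sub>R a])) = r *\<^sub>R integral S (\<lambda>t. \<omega> t (vs[j := a]))"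
      by simp
  qed
qed

text \<open>Cartan's formula for the Euler field: if \<open>\<iota> c = 0\<close> then \<open>t\<^sup>k (\<iota> dc)(t x)\<close> is the
  \<open>t\<close>-derivative of \<open>t\<^sup>k c(t x)\<close>.\<close>

lemma koszul_star_domain:
  fixes c :: "'v::euclidean_space \<Rightarrow> 'v list \<Rightarrow> real"
  assumes U: "open U" "convex U" "0 \<in> U"
    and alt: "\<And>y. y \<in> U \<Longrightarrow> alt_form (int k) (c y)"
    and smooth: "\<And>vs. smooth_on U (\<lambda>y. c y vs)"
    and cycle: "\<And>y vs. y \<in> U \<Longrightarrow> c y (y # vs) = 0"
    and van: "k = 0 \<Longrightarrow> c 0 [] = 0"
  obtains w :: "'v \<Rightarrow> 'v list \<Rightarrow> real" where "\<And>y. y \<in> U \<Longrightarrow> alt_form (int k + 1) (w y)"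
    "\<And>vs. smooth_on U (\<lambda>y. w y vs)" "\<And>y vs. y \<in> U \<Longrightarrow> w y (y # vs) = c y vs"
proof -
  have ray: "t *\<^sub>R x \<in> U" if "x \<in> U" "t \<in> {0..1}" for x :: 'v and t :: real
    using convexD[OF U(2,3) that(1), of "1 - t" t] that by auto
  define dc where "dc y v ws = frechet_derivative (\<lambda>y. c y ws) (at y) v" for y v ws
  have der: "((\<lambda>y. c y ws) has_derivative (\<lambda>v. dc y v ws)) (at y)" if "y \<in> U" for y ws
    using smooth_on_has_derivative[OF smooth that] by (simp add: dc_def)
  have lin_dc: "linear (\<lambda>v. dc y v ws)" if "y \<in> U" for y ws
    by (rule has_derivative_linear[OF der[OF that]])
  have alt_dc: "alt_form (int k) (dc y v)" if "y \<in> U" for y v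
    using alt_form_frechet_derivative[OF U(1) that alt smooth] by (simp add: dc_def[abs_def])
  have smooth_dc: "smooth_on U (\<lambda>y. dc y v ws)" for v ws
    using smooth_on_frechet_derivative[OF smooth] by (simp add: dc_def)
  have cont_ray: "continuous_on {0..1} (\<lambda>t. f (t *\<^sub>R x))" if "smooth_on U f" "x \<in> U" for f :: "'v \<Rightarrow> real" and x
  proof -
    have "continuous_on U f" using that(1) Ck_on.simps(1) unfolding smooth_on_def by blast
    then show ?thesis
      by (rule continuous_on_compose2[of U f _ "\<lambda>t. t *\<^sub>R x"])
        (use ray[OF that(2)] in \<open>auto intro!: continuous_intros\<close>)
  qed
  have int_ray: "(\<lambda>t. t ^ j * f (t *\<^sub>R x)) integrable_on {0..1}" if "smooth_on U f" "x \<in> U"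
    for f :: "'v \<Rightarrow> real" and x j
    by (intro integrable_continuous_real continuous_on_mult continuous_on_power continuous_on_id cont_ray that)
  \<comment> \<open>The integral over the ray is taken before antisymmetrizing:
    \<open>\<beta> x v\<close> is then still a \<open>k\<close>-form that is linear in
    \<open>v\<close>, as \<open>alt_form_wedge\<close> demands, and its wedge is the integral of t^k
    (dc)(t x).\<close>
  define \<beta> where "\<beta> x v ws = integral {0..1} (\<lambda>t. t ^ k * dc (t *\<^sub>R x) v ws)" for x v ws
  define w where "w x = wedge (\<beta> x)" for x
  have alt_w: "alt_form (int k + 1) (w x)" if x: "x \<in> U" for x
    unfolding w_def
  proof (rule alt_form_wedge)
    show "alt_form (int k) (\<beta> x v)" for v
      unfolding \<beta>_def
    proof (rule alt_form_integral)
      show "alt_form (int k) (\<lambda>ws. t ^ k * dc (t *\<^sub>R x) v ws)" if "t \<in> {0..1}" for t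
        using alt_form_scaleR[OF alt_dc[OF ray[OF x that]]] by simp
      show "(\<lambda>t. t ^ k * dc (t *\<^sub>R x) v ws) integrable_on {0..1}" for ws
        by (rule int_ray[OF smooth_dc x])
    qed
    show "linear (\<lambda>v. \<beta> x v ws)" for ws
    proof (rule linearI)
      fix a b
      have "\<beta> x (a + b) ws =
          integral {0..1} (\<lambda>t. t ^ k * dc (t *\<^sub>R x) a ws + t ^ k * dc (t *\<^sub>R x) b ws)"
        unfolding \<beta>_def
      proof (rule integral_cong)
        fix t :: real assume "t \<in> {0..1}"
        from linear_add[OF lin_dc[OF ray[OF x this]]]
        show "t ^ k * dc (t *\<^sub>R x) (a + b) ws = t ^ k * dc (t *\<^sub>R x) a ws + t ^ k * dc (t *\<^sub>R x) b ws"
          by (simp add: distrib_left)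
      qed
      then show "\<beta> x (a + b) ws = \<beta> x a ws + \<beta> x b ws"
        unfolding \<beta>_def by (simp add: integral_add int_ray[OF smooth_dc x])
    next
      fix r :: real and a
      have "\<beta> x (r *\<^sub>R a) ws = integral {0..1} (\<lambda>t. r *\<^sub>R (t ^ k * dc (t *\<^sub>R x) a ws))"
        unfolding \<beta>_def
      proof (rule integral_cong)
        fix t :: real assume "t \<in> {0..1}"
        from linear_cmul[OF lin_dc[OF ray[OF x this]]]
        show "t ^ k * dc (t *\<^sub>R x) (r *\<^sub>R a) ws = r *\<^sub>R (t ^ k * dc (t *\<^sub>R x) a ws)" by simp
      qed
      then show "\<beta> x (r *\<^sub>R a) ws = r *\<^sub>R \<beta> x a ws" unfolding \<beta>_def by simp
    qed
  qed
  have smooth_w: "smooth_on U (\<lambda>x. w x vs)" for vs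
  proof -
    have "smooth_on U (\<lambda>x. \<beta> x v ws)" for v ws
      unfolding \<beta>_def smooth_on_def
      using Ck_on_ray_integral[OF U] smooth_dc[unfolded smooth_on_def] by blast
    then show ?thesis
      unfolding w_def wedge_def real_scaleR_def
      by (intro smooth_on_sum smooth_on_mult smooth_on_const U(1))
  qed
  \<comment> \<open>differentiate \<open>cycle\<close> in direction \<open>u\<close>\<close>
  have dc_self: "dc y u (y # ws) = - c y (u # ws)" if y: "y \<in> U" for y u ws
  proof -
    have lin1: "linear (\<lambda>v. c y (v # ws))" if "y \<in> U" for y
      using alt_form_linear_append[OF alt[OF that], where xs = "[]"] by simp
    have lin2: "linear (\<lambda>v. dc y u (v # ws))" 
      using alt_form_linear_append[OF alt_dc[OF y], where xs = "[]"] by simp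
    have expand: "f v = (\<Sum>b\<in>Basis. (v \<bullet> b) * f b)" if "linear f" for f :: "'v \<Rightarrow> real" and v
      using linear_sum[OF that, of "\<lambda>b. (v \<bullet> b) *\<^sub>R b" Basis] linear_cmul[OF that]
      by (simp add: euclidean_representation)
    have "((\<lambda>y. \<Sum>b\<in>Basis. (y \<bullet> b) * c y (b # ws)) has_derivative
        (\<lambda>u. \<Sum>b\<in>Basis. (y \<bullet> b) * dc y u (b # ws) + (u \<bullet> b) * c y (b # ws))) (at y)"
    proof (rule has_derivative_sum)
      fix b :: 'v
      have "((\<lambda>y. y \<bullet> b) has_derivative (\<lambda>u. u \<bullet> b)) (at y)"
        by (rule bounded_linear_imp_has_derivative) (rule bounded_linear_inner_left)
      from has_derivative_mult[OF this der[OF y]]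
      show "((\<lambda>y. (y \<bullet> b) * c y (b # ws)) has_derivative
          (\<lambda>u. (y \<bullet> b) * dc y u (b # ws) + (u \<bullet> b) * c y (b # ws))) (at y)" .
    qed
    moreover have "((\<lambda>y. \<Sum>b\<in>Basis. (y \<bullet> b) * c y (b # ws)) has_derivative (\<lambda>u. 0)) (at y)"
    proof (rule has_derivative_transform_within_open[OF _ U(1) y])
      show "((\<lambda>y. 0) has_derivative (\<lambda>u. 0)) (at y)" by simp
      show "0 = (\<Sum>b\<in>Basis. (y \<bullet> b) * c y (b # ws))" if "y \<in> U" for y
        using expand[OF lin1[OF that], of y] cycle[OF that] by simp
    qed
    ultimately have "(\<lambda>u. \<Sum>b\<in>Basis. (y \<bullet> b) * dc y u (b # ws) + (u \<bullet> b) * c y (b # ws)) = (\<lambda>u. 0)"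
      by (rule has_derivative_unique)
    from fun_cong[OF this, of u]
    have "(\<Sum>b\<in>Basis. (y \<bullet> b) * dc y u (b # ws) + (u \<bullet> b) * c y (b # ws)) = 0" .
    then have "dc y u (y # ws) + c y (u # ws) = 0"
      using expand[OF lin2, of y] expand[OF lin1[OF y], of u] by (simp add: sum.distrib)
    then show ?thesis by simp
  qed
  \<comment> \<open>One of the \<open>k\<close> factors \<open>t\<close> is absorbed by linearity
    into the first argument, which becomes the base point \<open>t *\<^sub>R x\<close>; there
    \<open>dc_self\<close> applies. This takes \<open>k > 0\<close>.\<close>
  have dc_ray: "t ^ k * dc (t *\<^sub>R x) u (x # ws) = - (t ^ (k - 1) * c (t *\<^sub>R x) (u # ws))"
    if "x \<in> U" "t \<in> {0..1}" "k > 0" for x t u ws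
  proof -
    have "linear (\<lambda>v. dc (t *\<^sub>R x) u (v # ws))" 
      using alt_form_linear_append[OF alt_dc[OF ray[OF that(1,2)]], where xs = "[]"] by simp
    then have "t * dc (t *\<^sub>R x) u (x # ws) = - c (t *\<^sub>R x) (u # ws)"
      using dc_self[OF ray[OF that(1,2)], of u ws] linear_cmul by fastforce
    moreover have "t ^ k = t ^ (k - 1) * t" using that(3) by (simp add: power_eq_if mult.commute)
    ultimately show ?thesis by (simp add: mult.assoc)
  qed
  have boundary: "w x (x # vs) = c x vs" if x: "x \<in> U" for x vs
  proof (cases "length vs = k")
    case False
    then show ?thesis using alt_form_length[OF alt_w[OF x], of "x # vs"] alt_form_length[OF alt[OF x], of vs]
      by simp
  next
    case True
    let ?I = "integral {0..1} (\<lambda>t. t ^ (k - 1) * c (t *\<^sub>R x) vs)"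
    \<comment> \<open>Moving \<open>vs ! i\<close> to the front yields a sign equal to that of the
      summand, so every slot contributes the same amount. In degree 0 there is no slot, and the
      truncated exponent \<open>k - 1\<close> only occurs multiplied by
      \<open>real k = 0\<close>.\<close>
    have summand: "(-1) ^ i *\<^sub>R \<beta> x (vs ! i) (x # drop_nth i vs) = - ?I" if i: "i < length vs" for i
    proof -
      have "\<beta> x (vs ! i) (x # drop_nth i vs) =
          integral {0..1} (\<lambda>t. (- ((-1) ^ i)) * (t ^ (k - 1) * c (t *\<^sub>R x) vs))"
        unfolding \<beta>_def
      proof (rule integral_cong)
        fix t :: real assume t: "t \<in> {0..1}"
        have "t ^ k * dc (t *\<^sub>R x) (vs ! i) (x # drop_nth i vs) =
            - (t ^ (k - 1) * c (t *\<^sub>R x) (vs ! i # drop_nth i vs))"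
          by (rule dc_ray[OF x t]) (use i True in auto)
        also have "c (t *\<^sub>R x) (vs ! i # drop_nth i vs) = (-1) ^ i *\<^sub>R c (t *\<^sub>R x) vs"
          by (rule alt_form_nth_front[OF alt[OF ray[OF x t]] i])
        finally show "t ^ k * dc (t *\<^sub>R x) (vs ! i) (x # drop_nth i vs) =
            (- ((-1) ^ i)) * (t ^ (k - 1) * c (t *\<^sub>R x) vs)" by simp
      qed
      also have "\<dots> = (- ((-1) ^ i)) * ?I" by (rule integral_mult_right)
      finally show ?thesis by (simp flip: power_mult_distrib)
    qed
    have "wedge (\<lambda>u ws. \<beta> x u (x # ws)) vs = (\<Sum>i<length vs. - ?I)"
      unfolding wedge_def by (rule sum.cong[OF refl]) (rule summand, simp)
    then have "w x (x # vs) = \<beta> x x vs + real k * ?I"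
      by (simp add: w_def wedge_Cons True)
    also have "\<dots> = integral {0..1} (\<lambda>t. t ^ k * dc (t *\<^sub>R x) x vs + real k * (t ^ (k - 1) * c (t *\<^sub>R x) vs))"
      unfolding \<beta>_def
      by (subst integral_add) (use int_ray[OF smooth_dc x] int_ray[OF smooth x] in \<open>auto intro: integrable_on_mult_right\<close>)
    \<comment> \<open>The term at t = 0 vanishes for \<open>k > 0\<close> because of the power. For
      \<open>k = 0\<close> the power is 1, and \<open>van\<close> is what removes it.\<close>
    also have "\<dots> = 1 ^ k * c (1 *\<^sub>R x) vs - 0 ^ k * c (0 *\<^sub>R x) vs"
    proof (rule integral_unique, rule fundamental_theorem_of_calculus)
      fix t :: real assume t: "t \<in> {0..1}"
      have "((\<lambda>t. c (t *\<^sub>R x) vs) has_derivative (\<lambda>h. dc (t *\<^sub>R x) (h *\<^sub>R x) vs)) (at t within {0..1})"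
        by (rule has_derivative_compose[of "\<lambda>t. t *\<^sub>R x" "\<lambda>h. h *\<^sub>R x" t "{0..1}" "\<lambda>y. c y vs"])
          (auto intro!: derivative_eq_intros der[OF ray[OF x t]])
      moreover have "dc (t *\<^sub>R x) (h *\<^sub>R x) vs = h * dc (t *\<^sub>R x) x vs" for h
        using linear_cmul[OF lin_dc[OF ray[OF x t]]] by simp
      ultimately have "((\<lambda>t. c (t *\<^sub>R x) vs) has_vector_derivative dc (t *\<^sub>R x) x vs) (at t within {0..1})"
        by (simp add: has_vector_derivative_def)
      moreover have "((\<lambda>t. t ^ k) has_vector_derivative real k * t ^ (k - 1)) (at t within {0..1})"
        unfolding has_real_derivative_iff_has_vector_derivative[symmetric]
        by (auto intro!: derivative_eq_intros)
      ultimately show "((\<lambda>t. t ^ k * c (t *\<^sub>R x) vs) has_vector_derivative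
          t ^ k * dc (t *\<^sub>R x) x vs + real k * (t ^ (k - 1) * c (t *\<^sub>R x) vs)) (at t within {0..1})"
        using has_vector_derivative_mult by (fastforce simp: mult.assoc)
    qed simp
    also have "\<dots> = c x vs" using van True by (cases "k = 0") auto
    finally show ?thesis .
  qed
  show thesis using that[OF alt_w smooth_w boundary] .
qed

context vbundle
begin

lemma koszul_exact_away:
  assumes alt: "\<And>x. alt_form k (\<Omega> x)"
    and sec: "\<And>vs. (\<lambda>x. \<Omega> x vs) \<in> sections B UNIV"
    and cycle: "\<And>x vs. \<Omega> x (x # vs) = 0"
  obtains w where "\<And>x. alt_form (k + 1) (w x)"
    "\<And>vs. restrict (\<lambda>x. w x vs) (- {0}) \<in> sections B (- {0})"
    "\<And>x vs. x \<noteq> 0 \<Longrightarrow> w x (x # vs) = \<Omega> x vs"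
proof
  define \<beta> where "\<beta> x v ws = ((v \<bullet> x) * inverse (x \<bullet> x)) *\<^sub>R \<Omega> x ws" for x v ws
  show "alt_form (k + 1) (wedge (\<beta> x))" for x
  proof (rule alt_form_wedge)
    show "alt_form k (\<beta> x v)" for v unfolding \<beta>_def by (rule alt_form_scaleR[OF alt])
    show "linear (\<lambda>v. \<beta> x v ws)" for ws
      by (rule linearI) (simp_all add: \<beta>_def inner_add_left scaleR_left_distrib distrib_right)
  qed
  show "restrict (\<lambda>x. wedge (\<beta> x) vs) (- {0}) \<in> sections B (- {0})" for vs
  proof -
    have U: "open (- {0::'v})" by auto
    have "(\<lambda>x\<in>- {0}. (-1) ^ i *\<^sub>R \<beta> x v ws) \<in> sections B (- {0})" for i v ws
    proof -
      have inner: "smooth_on (- {0}) (\<lambda>x::'v. x \<bullet> x)"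
        using smooth_on_norm_sq[OF U, of 0] by simp
      have "smooth_on (- {0}) (\<lambda>x. (-1) ^ i * ((x \<bullet> v) * inverse (x \<bullet> x)))"
        by (intro smooth_on_mult smooth_on_const smooth_on_inner_left smooth_on_inverse inner U) simp
      from sections_scaleR[OF U sections_restrict[OF sec subset_UNIV] this]
      have "(\<lambda>x\<in>- {0}. ((-1) ^ i * ((x \<bullet> v) * inverse (x \<bullet> x))) *\<^sub>R
          restrict (\<lambda>x. \<Omega> x ws) (- {0}) x) \<in> sections B (- {0})" .
      also have "(\<lambda>x\<in>- {0}. ((-1) ^ i * ((x \<bullet> v) * inverse (x \<bullet> x))) *\<^sub>R
          restrict (\<lambda>x. \<Omega> x ws) (- {0}) x) = (\<lambda>x\<in>- {0}. (-1) ^ i *\<^sub>R \<beta> x v ws)"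
        by (auto simp: fun_eq_iff \<beta>_def inner_commute)
      finally show ?thesis .
    qed
    then show ?thesis
      unfolding wedge_def by (intro sections_sum[OF U])
  qed
  show "wedge (\<beta> x) (x # vs) = \<Omega> x vs" if "x \<noteq> 0" for x vs
  proof -
    \<comment> \<open>In \<open>wedge_Cons\<close> with first entry \<open>x\<close>, the leading
      term carries the factor (x . x) / |x|^2 = 1, and all others contain a contraction of
      \<open>\<Omega>\<close> with \<open>x\<close>.\<close>
    have "wedge (\<lambda>u ws. \<beta> x u (x # ws)) vs = 0"
      by (simp add: \<beta>_def cycle wedge_def)
    then show ?thesis using that by (simp add: wedge_Cons \<beta>_def)
  qed
qed

text \<open>In a frame over a ball around 0 the problem splits into scalar ones. The coefficients of
  \<open>\<Omega> x vs\<close> are chosen for each \<open>vs\<close> separately; the functionals of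
  \<open>frame_dual\<close> show that they nevertheless inherit alternation, the cycle condition and
  the vanishing at 0.\<close>

lemma koszul_exact_near:
  assumes alt: "\<And>x. alt_form (int k) (\<Omega> x)"
    and sec: "\<And>vs. (\<lambda>x. \<Omega> x vs) \<in> sections B UNIV"
    and cycle: "\<And>x vs. \<Omega> x (x # vs) = 0"
    and van: "k = 0 \<Longrightarrow> \<Omega> 0 [] = 0"
  obtains U w where "open U" "0 \<in> U" "\<And>x. x \<in> U \<Longrightarrow> alt_form (int k + 1) (w x)"
    "\<And>vs. restrict (\<lambda>x. w x vs) U \<in> sections B U"
    "\<And>x vs. x \<in> U \<Longrightarrow> w x (x # vs) = \<Omega> x vs"
proof -
  obtain W r e where fr: "(W, r, e) \<in> frames B" "0 \<in> W" by (rule frame_exists)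
  obtain \<epsilon> where \<epsilon>: "\<epsilon> > 0" "ball 0 \<epsilon> \<subseteq> W" using frame_open[OF fr(1)] fr(2) open_contains_ball by blast
  let ?U = "ball (0::'v) \<epsilon>"
  have "\<exists>c. (\<forall>j<r. smooth_on W (c j :: 'v \<Rightarrow> real)) \<and> (\<forall>x\<in>W. \<Omega> x vs = (\<Sum>j<r. c j x *\<^sub>R e j x))" for vs
  proof -
    from sections_coefficients[OF sec[of vs] fr(1)] obtain c :: "nat \<Rightarrow> 'v \<Rightarrow> real" where
      "\<And>j. j < r \<Longrightarrow> smooth_on (UNIV \<inter> W) (c j)" "\<And>x. x \<in> UNIV \<inter> W \<Longrightarrow> \<Omega> x vs = (\<Sum>j<r. c j x *\<^sub>R e j x)"
      by blast
    then show ?thesis by (intro exI[of _ c]) simp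
  qed
  then have "\<exists>c. \<forall>vs. (\<forall>j<r. smooth_on W (c vs j :: 'v \<Rightarrow> real)) \<and>
      (\<forall>x\<in>W. \<Omega> x vs = (\<Sum>j<r. c vs j x *\<^sub>R e j x))"
    by (intro choice allI)
  then obtain c where c: "\<forall>vs. (\<forall>j<r. smooth_on W (c vs j :: 'v \<Rightarrow> real)) \<and>
      (\<forall>x\<in>W. \<Omega> x vs = (\<Sum>j<r. c vs j x *\<^sub>R e j x))"
    by (rule exE)
  have c_dual: "\<exists>g::'e \<Rightarrow> real. linear g \<and> (\<forall>vs. c vs j x = g (\<Omega> x vs))" if "x \<in> W" "j < r" for x j
  proof -
    from frame_dual[OF fr(1) that] obtain g :: "'e \<Rightarrow> real"
      where g: "linear g" "\<And>c. g (\<Sum>i<r. c i *\<^sub>R e i x) = c j"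
      by blast
    have "c vs j x = g (\<Omega> x vs)" for vs
      using spec[OF c, of vs] g(2)[of "\<lambda>j. c vs j x"] that(1) by simp
    then show ?thesis using g(1) by blast
  qed
  have "\<exists>w. (\<forall>y\<in>?U. alt_form (int k + 1) (w y)) \<and> (\<forall>vs. smooth_on ?U (\<lambda>y. w y vs :: real)) \<and>
      (\<forall>y\<in>?U. \<forall>vs. w y (y # vs) = c vs j y)" if j: "j < r" for j
  proof -
    have "alt_form (int k) (\<lambda>vs. c vs j y)" if "y \<in> ?U" for y
    proof -
      have "y \<in> W" using that \<epsilon>(2) by blast
      from c_dual[OF this j] obtain g :: "'e \<Rightarrow> real" where "linear g" "\<And>vs. c vs j y = g (\<Omega> y vs)"
        by blast
      then show ?thesis using alt_form_linear_compose[OF _ alt[of y]] by simp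
    qed
    moreover have "smooth_on ?U (\<lambda>y. c vs j y)" for vs
      using spec[OF c, of vs] j smooth_on_subset[OF _ \<epsilon>(2)] by blast
    moreover have "c (y # vs) j y = 0" if y: "y \<in> ?U" for y vs
    proof -
      obtain g :: "'e \<Rightarrow> real" where "linear g" "\<And>vs. c vs j y = g (\<Omega> y vs)"
        using c_dual[of y j] y \<epsilon> j by blast
      then show ?thesis by (simp add: cycle linear_0)
    qed
    moreover have "c [] j 0 = 0" if "k = 0"
    proof -
      obtain g :: "'e \<Rightarrow> real" where "linear g" "\<And>vs. c vs j 0 = g (\<Omega> 0 vs)"
        using c_dual[of 0 j] fr(2) j by blast
      then show ?thesis by (simp add: van[OF that] linear_0)
    qed
    ultimately show ?thesis
      using koszul_star_domain[of ?U k "\<lambda>y vs. c vs j y"] \<epsilon>(1)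
      by (metis open_ball convex_ball centre_in_ball)
  qed
  then have "\<exists>w. \<forall>j. j < r \<longrightarrow> (\<forall>y\<in>?U. alt_form (int k + 1) (w j y)) \<and> (\<forall>vs. smooth_on ?U (\<lambda>y. w j y vs :: real)) \<and>
      (\<forall>y\<in>?U. \<forall>vs. w j y (y # vs) = c vs j y)"
    by (intro choice allI) blast
  then obtain w where w: "\<forall>j. j < r \<longrightarrow> (\<forall>y\<in>?U. alt_form (int k + 1) (w j y)) \<and>
      (\<forall>vs. smooth_on ?U (\<lambda>y. w j y vs :: real)) \<and> (\<forall>y\<in>?U. \<forall>vs. w j y (y # vs) = c vs j y)"
    by (rule exE)
  show thesis
  proof (rule that[of ?U "\<lambda>x vs. \<Sum>j<r. w j x vs *\<^sub>R e j x"])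
    show "alt_form (int k + 1) (\<lambda>vs. \<Sum>j<r. w j x vs *\<^sub>R e j x)" if "x \<in> ?U" for x
      by (intro alt_form_sum alt_form_scaleR_right) (use w that in blast)
    show "(\<lambda>x\<in>?U. \<Sum>j<r. w j x vs *\<^sub>R e j x) \<in> sections B ?U" for vs
      by (rule sections_frame_combination[OF fr(1) open_ball \<epsilon>(2)]) (use w in blast)
    show "(\<Sum>j<r. w j x (x # vs) *\<^sub>R e j x) = \<Omega> x vs" if "x \<in> ?U" for x vs
    proof -
      have "(\<Sum>j<r. w j x (x # vs) *\<^sub>R e j x) = (\<Sum>j<r. c vs j x *\<^sub>R e j x)"
        by (rule sum.cong[OF refl]) (use w that in simp)
      then show ?thesis using spec[OF c, of vs] that \<epsilon>(2) by auto
    qed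
  qed (use \<epsilon> in auto)
qed

text \<open>Contraction is linear over functions, so an average of local solutions is a solution.
  Index 0 carries the neighbourhood of the origin, every other index the punctured space.\<close>

lemma koszul_exact:
  assumes alt: "\<And>x. alt_form (int k) (\<Omega> x)"
    and sec: "\<And>vs. (\<lambda>x. \<Omega> x vs) \<in> sections B UNIV"
    and cycle: "\<And>x vs. \<Omega> x (x # vs) = 0"
    and van: "k = 0 \<Longrightarrow> \<Omega> 0 [] = 0"
  obtains \<eta> where "\<And>x. alt_form (int k + 1) (\<eta> x)"
    "\<And>vs. (\<lambda>x. \<eta> x vs) \<in> sections B UNIV" "\<And>x vs. \<eta> x (x # vs) = \<Omega> x vs"
proof -
  obtain w1 where w1: "\<And>x. alt_form (int k + 1) (w1 x)"
    "\<And>vs. restrict (\<lambda>x. w1 x vs) (- {0}) \<in> sections B (- {0})"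
    "\<And>x vs. x \<noteq> 0 \<Longrightarrow> w1 x (x # vs) = \<Omega> x vs"
    by (rule koszul_exact_away[OF alt sec cycle]) blast
  obtain U w0 where w0: "open U" "0 \<in> U" "\<And>x. x \<in> U \<Longrightarrow> alt_form (int k + 1) (w0 x)"
    "\<And>vs. restrict (\<lambda>x. w0 x vs) U \<in> sections B U"
    "\<And>x vs. x \<in> U \<Longrightarrow> w0 x (x # vs) = \<Omega> x vs"
    by (rule koszul_exact_near[OF alt sec cycle van]) blast+
  define W where "W y = (if y = 0 then U else - {0})" for y :: 'v
  define w where "w y = (if y = 0 then w0 else w1)" for y :: 'v
  have W: "open (W y)" "y \<in> W y" for y using w0 by (auto simp: W_def)
  have w: "alt_form (int k + 1) (w y x)" "w y x (x # vs) = \<Omega> x vs" if "x \<in> W y" for x y vs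
    using that w0 w1 by (auto simp: W_def w_def split: if_splits)
  have w_sec: "restrict (\<lambda>x. w y x vs) (W y) \<in> sections B (W y)" for y vs
    using w0 w1 by (simp add: W_def w_def)
  obtain p where p: "smooth_partition W p" using smooth_partition_exists[OF W] by blast
  show thesis
  proof (rule that[of "\<lambda>x vs. \<Sum>y | p y x \<noteq> 0. p y x *\<^sub>R w y x vs"])
    show "alt_form (int k + 1) (\<lambda>vs. \<Sum>y | p y x \<noteq> 0. p y x *\<^sub>R w y x vs)" for x
      by (intro alt_form_sum alt_form_scaleR w) (use smooth_partition_mem[OF p] in simp)
    show "(\<lambda>x. \<Sum>y | p y x \<noteq> 0. p y x *\<^sub>R w y x vs) \<in> sections B UNIV" for vs
      by (rule sections_glue[OF p W(1) w_sec])
    show "(\<Sum>y | p y x \<noteq> 0. p y x *\<^sub>R w y x (x # vs)) = \<Omega> x vs" for x vs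
    proof -
      have "(\<Sum>y | p y x \<noteq> 0. p y x *\<^sub>R w y x (x # vs)) = (\<Sum>y | p y x \<noteq> 0. p y x *\<^sub>R \<Omega> x vs)"
        by (rule sum.cong[OF refl]) (use w smooth_partition_mem[OF p] in simp)
      then show ?thesis using smooth_partition_sum[OF p, of x] by (simp flip: scaleR_sum_left)
    qed
  qed
qed

end


section \<open>Dimension shifting\<close>

definition forms :: "int \<Rightarrow> ('v::euclidean_space \<Rightarrow> 'a::real_vector) set \<Rightarrow> ('v \<Rightarrow> 'v list \<Rightarrow> 'a) set" where
  "forms k M = {\<Omega>. (\<forall>x. alt_form k (\<Omega> x)) \<and> (\<forall>vs. (\<lambda>x. \<Omega> x vs) \<in> M)}"

definition euler_contraction :: "('v \<Rightarrow> 'v list \<Rightarrow> 'a) \<Rightarrow> 'v \<Rightarrow> 'v list \<Rightarrow> 'a" where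
  "euler_contraction \<Omega> = (\<lambda>x vs. \<Omega> x (x # vs))"

definition cycles :: "int \<Rightarrow> ('v::euclidean_space \<Rightarrow> 'a::real_vector) set \<Rightarrow> ('v \<Rightarrow> 'v list \<Rightarrow> 'a) set" where
  "cycles k M = {\<Omega> \<in> forms k M. euler_contraction \<Omega> = (\<lambda>x vs. 0)}"

definition boundaries :: "int \<Rightarrow> ('v::euclidean_space \<Rightarrow> 'a::real_vector) set \<Rightarrow> ('v \<Rightarrow> 'v list \<Rightarrow> 'a) set" where
  "boundaries k M = euler_contraction ` forms (k + 1) M"

text \<open>Addition and scaling in one operation, so that compatibility of a relation with the real
  vector space structure is a single condition.\<close>

definition form_comb :: "real \<Rightarrow> real \<Rightarrow> ('v \<Rightarrow> 'v list \<Rightarrow> 'a::real_vector) \<Rightarrow> ('v \<Rightarrow> 'v list \<Rightarrow> 'a) \<Rightarrow>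
    'v \<Rightarrow> 'v list \<Rightarrow> 'a" where
  "form_comb a b \<Omega> \<Omega>' = (\<lambda>x vs. a *\<^sub>R \<Omega> x vs + b *\<^sub>R \<Omega>' x vs)"

definition function_module :: "('v::euclidean_space \<Rightarrow> 'a::real_vector) set \<Rightarrow> bool" where
  "function_module M \<longleftrightarrow>
     (\<lambda>x. 0) \<in> M \<and>
     (\<forall>s\<in>M. \<forall>t\<in>M. (\<lambda>x. s x + t x) \<in> M) \<and>
     (\<forall>f. \<forall>s\<in>M. smooth_on UNIV f \<longrightarrow> (\<lambda>x. f x *\<^sub>R s x) \<in> M)"

text \<open>A relation inducing a bijection \<open>Z / B \<rightarrow> Z' / B'\<close>, if it is additive and \<open>B\<close>, \<open>B'\<close> are
  subgroups. Relations avoid the choices in the definition of a connecting homomorphism.\<close>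

definition quotient_iso :: "'a set \<Rightarrow> 'a set \<Rightarrow> 'b set \<Rightarrow> 'b set \<Rightarrow> ('a \<Rightarrow> 'b \<Rightarrow> bool) \<Rightarrow> bool" where
  "quotient_iso Z B Z' B' R \<longleftrightarrow>
     (\<forall>z z'. R z z' \<longrightarrow> z \<in> Z \<and> z' \<in> Z' \<and> (z \<in> B \<longleftrightarrow> z' \<in> B')) \<and>
     (\<forall>z\<in>Z. \<exists>z'. R z z') \<and> (\<forall>z'\<in>Z'. \<exists>z. R z z')"

definition comb_compatible ::
  "(real \<Rightarrow> real \<Rightarrow> 'a \<Rightarrow> 'a \<Rightarrow> 'a) \<Rightarrow> (real \<Rightarrow> real \<Rightarrow> 'b \<Rightarrow> 'b \<Rightarrow> 'b) \<Rightarrow> ('a \<Rightarrow> 'b \<Rightarrow> bool) \<Rightarrow> bool" where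
  "comb_compatible f g R \<longleftrightarrow>
     (\<forall>a b z1 z2 w1 w2. R z1 w1 \<longrightarrow> R z2 w2 \<longrightarrow> R (f a b z1 z2) (g a b w1 w2))"

lemma quotient_iso_OO:
  "quotient_iso Z B Z' B' R \<Longrightarrow> quotient_iso Z' B' Z'' B'' S \<Longrightarrow> quotient_iso Z B Z'' B'' (R OO S)"
  unfolding quotient_iso_def relcompp_apply by meson

lemma comb_compatible_OO:
  "comb_compatible f g R \<Longrightarrow> comb_compatible g h S \<Longrightarrow> comb_compatible f h (R OO S)"
  unfolding comb_compatible_def relcompp_apply by meson

lemma function_module_zero: "function_module M \<Longrightarrow> (\<lambda>x. 0) \<in> M"
  by (simp add: function_module_def)

lemma function_module_add: "function_module M \<Longrightarrow> s \<in> M \<Longrightarrow> t \<in> M \<Longrightarrow> (\<lambda>x. s x + t x) \<in> M"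
  by (simp add: function_module_def)

lemma function_module_scaleR:
  "function_module M \<Longrightarrow> s \<in> M \<Longrightarrow> smooth_on UNIV f \<Longrightarrow> (\<lambda>x. f x *\<^sub>R s x) \<in> M"
  by (simp add: function_module_def)

lemma function_module_comb:
  assumes "function_module M" "s \<in> M" "t \<in> M"
  shows "(\<lambda>x. a *\<^sub>R s x + b *\<^sub>R t x) \<in> M"
  by (intro function_module_add function_module_scaleR smooth_on_const open_UNIV assms)

lemma function_module_sum:
  assumes "function_module M" "\<And>i. i \<in> I \<Longrightarrow> s i \<in> M"
  shows "(\<lambda>x. \<Sum>i\<in>I. s i x) \<in> M"
  using assms(2)
proof (induction I rule: infinite_finite_induct)
  case (insert i I)
  then have "(\<lambda>x. s i x + (\<Sum>i\<in>I. s i x)) \<in> M"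
    by (intro function_module_add assms(1)) auto
  then show ?case using insert by simp
qed (use assms(1) in \<open>auto simp: function_module_def\<close>)

lemma forms_comb:
  assumes "function_module M" "\<Omega> \<in> forms k M" "\<Omega>' \<in> forms k M"
  shows "form_comb a b \<Omega> \<Omega>' \<in> forms k M"
  using assms(2,3) function_module_comb[OF assms(1)]
  by (auto simp: forms_def form_comb_def intro!: alt_form_add alt_form_scaleR)

lemma euler_contraction_comb:
  "euler_contraction (form_comb a b \<Omega> \<Omega>') = form_comb a b (euler_contraction \<Omega>) (euler_contraction \<Omega>')"
  by (simp add: euler_contraction_def form_comb_def)

text \<open>Membership in \<open>M\<close> is given for constant arguments only. The argument
  \<open>x\<close> is expanded in the basis; its coordinates are smooth functions, by which elements
  of \<open>M\<close> may be multiplied.\<close>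

lemma euler_contraction_forms:
  assumes "function_module M" "\<Omega> \<in> forms k M"
  shows "euler_contraction \<Omega> \<in> forms (k - 1) M"
proof -
  have alt: "alt_form k (\<Omega> x)" for x using assms(2) by (simp add: forms_def)
  have "(\<lambda>x. \<Omega> x (x # vs)) \<in> M" for vs
  proof -
    have "\<Omega> x (x # vs) = (\<Sum>b\<in>Basis. (x \<bullet> b) *\<^sub>R \<Omega> x (b # vs))" for x
    proof -
      have lin: "linear (\<lambda>v. \<Omega> x (v # vs))"
        using alt_form_linear_append[OF alt, where xs = "[]"] by simp
      have "\<Omega> x ((\<Sum>b\<in>Basis. (x \<bullet> b) *\<^sub>R b) # vs) = (\<Sum>b\<in>Basis. (x \<bullet> b) *\<^sub>R \<Omega> x (b # vs))"
        by (simp only: linear_sum[OF lin] linear_cmul[OF lin])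
      then show ?thesis by (simp add: euclidean_representation)
    qed
    moreover have "(\<lambda>x. \<Sum>b\<in>Basis. (x \<bullet> b) *\<^sub>R \<Omega> x (b # vs)) \<in> M"
    proof (rule function_module_sum[OF assms(1)])
      fix b
      have "(\<lambda>x. \<Omega> x (b # vs)) \<in> M" using assms(2) by (simp add: forms_def)
      then show "(\<lambda>x. (x \<bullet> b) *\<^sub>R \<Omega> x (b # vs)) \<in> M"
        by (intro function_module_scaleR[OF assms(1)] smooth_on_inner_left open_UNIV)
    qed
    ultimately show ?thesis by simp
  qed
  then show ?thesis using alt by (simp add: forms_def euler_contraction_def alt_form_contract)
qed

lemma euler_contraction_twice:
  "\<Omega> \<in> forms k M \<Longrightarrow> euler_contraction (euler_contraction \<Omega>) = (\<lambda>x vs. 0)"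
  unfolding euler_contraction_def forms_def
  by (intro ext) (auto intro: alt_form_not_distinct)

lemma cycles_zero:
  assumes "\<Omega> \<in> forms 0 M"
  shows "\<Omega> \<in> cycles 0 M"
proof -
  have "\<Omega> x (x # vs) = 0" for x vs
    by (rule alt_form_length[of 0]) (use assms in \<open>auto simp: forms_def\<close>)
  then show ?thesis using assms by (simp add: cycles_def euler_contraction_def)
qed

lemma cycles_comb:
  assumes "function_module M" "\<Omega> \<in> cycles k M" "\<Omega>' \<in> cycles k M"
  shows "form_comb a b \<Omega> \<Omega>' \<in> cycles k M"
  using assms forms_comb[OF assms(1)] unfolding cycles_def
  by (auto simp: euler_contraction_comb) (simp add: form_comb_def)

context vbundle
begin

abbreviation "\<Gamma> \<equiv> sections B UNIV"

lemma function_module_sections: "function_module \<Gamma>"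
  using sections_zero[of UNIV] sections_add[of UNIV] sections_scaleR[of UNIV]
  by (simp add: function_module_def restrict_def)

lemma forms_fiber: "\<Omega> \<in> forms k \<Gamma> \<Longrightarrow> \<Omega> x vs \<in> fiber B x"
  using sections_fiber[of "\<lambda>x. \<Omega> x vs" B UNIV x] by (simp add: forms_def)

lemma koszul_exact_forms:
  assumes "\<Omega> \<in> cycles (int k) \<Gamma>" "k = 0 \<Longrightarrow> \<Omega> 0 [] = 0"
  obtains \<eta> where "\<eta> \<in> forms (int k + 1) \<Gamma>" "euler_contraction \<eta> = \<Omega>"
proof -
  have "\<Omega> x (x # vs) = 0" for x vs
    using assms(1) by (auto simp: cycles_def euler_contraction_def dest: fun_cong)
  moreover have "alt_form (int k) (\<Omega> x)" "(\<lambda>x. \<Omega> x vs) \<in> \<Gamma>" for x vs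
    using assms(1) by (auto simp: cycles_def forms_def)
  ultimately obtain \<eta> where "\<And>x. alt_form (int k + 1) (\<eta> x)"
    "\<And>vs. (\<lambda>x. \<eta> x vs) \<in> \<Gamma>" "\<And>x vs. \<eta> x (x # vs) = \<Omega> x vs"
    using koszul_exact[of k \<Omega>] assms(2) by blast
  then show thesis by (intro that[of \<eta>]) (auto simp: forms_def euler_contraction_def)
qed

end

text \<open>One short exact sequence 0 -> kernel -> \<Gamma>(B) -> M -> 0 cut out of the resolution,
  on global sections. The condition \<open>kernel_vanishes\<close> is the form in which minimality
  is used: it makes the kernel invisible in the fibre at 0.\<close>

locale bundle_surjection = vbundle B
  for B :: "('v::euclidean_space, 'e::real_vector) vector_bundle" +
  fixes \<phi> :: "'v \<Rightarrow> 'e \<Rightarrow> 'f::real_vector" and M :: "('v \<Rightarrow> 'f) set"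
  assumes linear: "linear_on_fibers B \<phi>"
    and image: "\<And>s. s \<in> \<Gamma> \<Longrightarrow> (\<lambda>x. \<phi> x (s x)) \<in> M"
    and surjective: "\<And>t. t \<in> M \<Longrightarrow> \<exists>s\<in>\<Gamma>. \<forall>x. \<phi> x (s x) = t x"
    and kernel_vanishes: "\<And>s. s \<in> \<Gamma> \<Longrightarrow> (\<And>x. \<phi> x (s x) = 0) \<Longrightarrow> s 0 = 0"
begin

definition kernel :: "('v \<Rightarrow> 'e) set" where
  "kernel = {s \<in> \<Gamma>. \<forall>x. \<phi> x (s x) = 0}"

definition push_form :: "('v \<Rightarrow> 'v list \<Rightarrow> 'e) \<Rightarrow> 'v \<Rightarrow> 'v list \<Rightarrow> 'f" where
  "push_form \<omega> = (\<lambda>x vs. \<phi> x (\<omega> x vs))"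

lemma push_form_contraction: "push_form (euler_contraction \<omega>) = euler_contraction (push_form \<omega>)"
  by (simp add: push_form_def euler_contraction_def)

lemma push_form_comb:
  assumes "\<omega> \<in> forms k \<Gamma>" "\<omega>' \<in> forms k \<Gamma>"
  shows "push_form (form_comb a b \<omega> \<omega>') = form_comb a b (push_form \<omega>) (push_form \<omega>')"
proof (intro ext)
  fix x vs
  have f: "\<omega> x vs \<in> fiber B x" "\<omega>' x vs \<in> fiber B x" using assms forms_fiber by auto
  then have "a *\<^sub>R \<omega> x vs \<in> fiber B x" "b *\<^sub>R \<omega>' x vs \<in> fiber B x"
    by (auto intro: subspace_scale[OF subspace_fiber])
  then show "push_form (form_comb a b \<omega> \<omega>') x vs = form_comb a b (push_form \<omega>) (push_form \<omega>') x vs"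
    using linear f by (simp add: push_form_def form_comb_def linear_on_fibers_def)
qed

lemma push_form_in_forms:
  assumes "\<omega> \<in> forms k \<Gamma>"
  shows "push_form \<omega> \<in> forms k M"
proof -
  have alt: "alt_form k (\<omega> x)" for x using assms by (simp add: forms_def)
  have "alt_form k (\<lambda>vs. \<phi> x (\<omega> x vs))" for x
  proof (rule alt_formI)
    fix vs :: "'v list" and j assume j: "j < length vs"
    show "linear (\<lambda>u. \<phi> x (\<omega> x (vs[j := u])))"
    proof (rule linearI)
      show "\<phi> x (\<omega> x (vs[j := u + v])) = \<phi> x (\<omega> x (vs[j := u])) + \<phi> x (\<omega> x (vs[j := v]))" for u v
        using linear linear_add[OF alt_form_linear[OF alt j]] forms_fiber[OF assms]
        by (simp add: linear_on_fibers_def)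
      show "\<phi> x (\<omega> x (vs[j := r *\<^sub>R u])) = r *\<^sub>R \<phi> x (\<omega> x (vs[j := u]))" for r u
        using linear linear_cmul[OF alt_form_linear[OF alt j]] forms_fiber[OF assms]
        by (simp add: linear_on_fibers_def)
    qed
  qed (simp_all add: alt_form_length[OF alt] alt_form_not_distinct[OF alt] linear_on_fibers_zero[OF linear])
  then show ?thesis using assms image by (simp add: forms_def push_form_def)
qed

lemma forms_kernelI:
  assumes "\<omega> \<in> forms k \<Gamma>" "push_form \<omega> = (\<lambda>x vs. 0)"
  shows "\<omega> \<in> forms k kernel"
  using assms by (auto simp: forms_def kernel_def push_form_def dest: fun_cong)

lemma forms_kernel_subset: "\<omega> \<in> forms k kernel \<Longrightarrow> \<omega> \<in> forms k \<Gamma>"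
  by (auto simp: forms_def kernel_def)

lemma forms_kernel_push: "\<omega> \<in> forms k kernel \<Longrightarrow> push_form \<omega> = (\<lambda>x vs. 0)"
  by (intro ext) (auto simp: forms_def kernel_def push_form_def)

lemma forms_kernel_vanish: "\<omega> \<in> forms k kernel \<Longrightarrow> \<omega> 0 vs = 0"
  using kernel_vanishes[of "\<lambda>x. \<omega> x vs"] by (auto simp: forms_def kernel_def)

text \<open>Tensoring with the free module of forms preserves surjectivity. Concretely, values on
  basis lists are lifted one by one, without regard to alternation, and reassembled with
  \<open>alt_frame\<close>; the expansion formula shows that the result still lies over
  \<open>\<Omega>\<close>.\<close>

lemma lift_form:
  assumes "\<Omega> \<in> forms k M"
  obtains \<omega> where "\<omega> \<in> forms k \<Gamma>" "push_form \<omega> = \<Omega>"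
proof -
  have "\<exists>s. s \<in> \<Gamma> \<and> (\<forall>x. \<phi> x (s x) = \<Omega> x bs)" for bs
    using surjective[of "\<lambda>x. \<Omega> x bs"] assms by (auto simp: forms_def)
  then obtain s where s: "\<And>bs. s bs \<in> \<Gamma>" "\<And>bs x. \<phi> x (s bs x) = \<Omega> x bs" by metis
  define \<omega> where "\<omega> x vs = (\<Sum>bs\<in>basis_lists k. alt_frame bs vs *\<^sub>R s bs x)" for x and vs :: "'v list"
  have "\<omega> \<in> forms k \<Gamma>"
  proof -
    have "alt_form k (\<omega> x)" for x
      unfolding \<omega>_def
    proof (intro alt_form_sum alt_form_scaleR_right)
      fix bs :: "'v list" assume "bs \<in> basis_lists k"
      then have "k = int (length bs)" by (simp add: basis_lists_def)
      then show "alt_form k (alt_frame bs)" using alt_form_alt_frame by simp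
    qed
    moreover have "(\<lambda>x. \<omega> x vs) \<in> \<Gamma>" for vs
      unfolding \<omega>_def
    proof (rule function_module_sum[OF function_module_sections])
      show "(\<lambda>x. alt_frame bs vs *\<^sub>R s bs x) \<in> \<Gamma>" for bs
        by (intro function_module_scaleR function_module_sections s smooth_on_const open_UNIV)
    qed
    ultimately show ?thesis by (simp add: forms_def)
  qed
  moreover have "push_form \<omega> = \<Omega>"
  proof (intro ext)
    fix x vs
    have "push_form \<omega> x vs = (\<Sum>bs\<in>basis_lists k. alt_frame bs vs *\<^sub>R \<phi> x (s bs x))"
      unfolding push_form_def \<omega>_def
      by (rule linear_on_fibers_sum[OF linear]) (use sections_fiber[OF s(1)] in simp)
    also have "\<dots> = \<Omega> x vs"
      using alt_form_expansion[of k "\<Omega> x" vs] assms by (simp add: s(2) forms_def)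
    finally show "push_form \<omega> x vs = \<Omega> x vs" .
  qed
  ultimately show thesis by (rule that)
qed

text \<open>The graph of the connecting homomorphism on cycles, multivalued because
  \<open>\<omega>\<close> ranges over all lifts of \<open>\<Omega>\<close>.\<close>

definition connecting :: "int \<Rightarrow> ('v \<Rightarrow> 'v list \<Rightarrow> 'f) \<Rightarrow> ('v \<Rightarrow> 'v list \<Rightarrow> 'e) \<Rightarrow> bool" where
  "connecting k \<Omega> \<Omega>' \<longleftrightarrow> \<Omega> \<in> cycles k M \<and>
     (\<exists>\<omega>\<in>forms k \<Gamma>. push_form \<omega> = \<Omega> \<and> euler_contraction \<omega> = \<Omega>')"

text \<open>If \<open>\<Omega>\<close> bounds, subtracting the contraction of a lifted primitive
  from \<open>\<omega>\<close> leaves a kernel-valued form with the same contraction. Conversely,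
  subtracting a kernel-valued primitive of \<open>\<Omega>'\<close> from \<open>\<omega>\<close>
  leaves a cycle over \<open>\<Gamma>\<close> that still lies over \<open>\<Omega>\<close>; its
  degree is positive, so it bounds, and its primitive is pushed to \<open>M\<close>.\<close>

lemma boundary_iff_of_connecting:
  assumes \<omega>: "\<omega> \<in> forms (int k + 1) \<Gamma>" "push_form \<omega> = \<Omega>" "euler_contraction \<omega> = \<Omega>'"
  shows "\<Omega> \<in> boundaries (int k + 1) M \<longleftrightarrow> \<Omega>' \<in> boundaries (int k) kernel"
proof
  note fm = function_module_sections
  assume "\<Omega> \<in> boundaries (int k + 1) M"
  then obtain \<eta> where \<eta>: "\<eta> \<in> forms (int k + 1 + 1) M" "\<Omega> = euler_contraction \<eta>"
    by (auto simp: boundaries_def)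
  obtain \<theta> where \<theta>: "\<theta> \<in> forms (int k + 1 + 1) \<Gamma>" "push_form \<theta> = \<eta>" by (rule lift_form[OF \<eta>(1)])
  have d\<theta>: "euler_contraction \<theta> \<in> forms (int k + 1) \<Gamma>"
    using euler_contraction_forms[OF fm \<theta>(1)] by (simp add: add.commute)
  let ?\<omega>' = "form_comb 1 (-1) \<omega> (euler_contraction \<theta>)"
  have "push_form ?\<omega>' = (\<lambda>x vs. 0)"
    unfolding push_form_comb[OF \<omega>(1) d\<theta>] push_form_contraction \<theta>(2) \<omega>(2) \<eta>(2)
    by (simp add: form_comb_def)
  then have "?\<omega>' \<in> forms (int k + 1) kernel"
    by (rule forms_kernelI[OF forms_comb[OF fm \<omega>(1) d\<theta>]])
  moreover have "euler_contraction ?\<omega>' = \<Omega>'"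
    unfolding euler_contraction_comb euler_contraction_twice[OF \<theta>(1)] \<omega>(3) by (simp add: form_comb_def)
  ultimately show "\<Omega>' \<in> boundaries (int k) kernel" unfolding boundaries_def by blast
next
  note fm = function_module_sections
  assume "\<Omega>' \<in> boundaries (int k) kernel"
  then obtain \<theta> where \<theta>: "\<theta> \<in> forms (int k + 1) kernel" "\<Omega>' = euler_contraction \<theta>"
    by (auto simp: boundaries_def)
  let ?\<omega>' = "form_comb 1 (-1) \<omega> \<theta>"
  have \<omega>': "?\<omega>' \<in> forms (int k + 1) \<Gamma>"
    by (rule forms_comb[OF fm \<omega>(1) forms_kernel_subset[OF \<theta>(1)]])
  have "euler_contraction ?\<omega>' = (\<lambda>x vs. 0)"
    unfolding euler_contraction_comb \<omega>(3) \<theta>(2) by (simp add: form_comb_def)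
  then have "?\<omega>' \<in> cycles (int (Suc k)) \<Gamma>"
    using \<omega>' by (simp add: cycles_def add.commute)
  from koszul_exact_forms[OF this] obtain \<eta> where
    \<eta>: "\<eta> \<in> forms (int k + 1 + 1) \<Gamma>" "euler_contraction \<eta> = ?\<omega>'"
    by (auto simp: add.commute)
  have "\<Omega> = push_form ?\<omega>'"
    unfolding push_form_comb[OF \<omega>(1) forms_kernel_subset[OF \<theta>(1)]] forms_kernel_push[OF \<theta>(1)] \<omega>(2)
    by (simp add: form_comb_def)
  also have "\<dots> = euler_contraction (push_form \<eta>)"
    by (simp add: \<eta>(2) flip: push_form_contraction)
  finally show "\<Omega> \<in> boundaries (int k + 1) M"
    using push_form_in_forms[OF \<eta>(1)] unfolding boundaries_def by blast
qed

lemma quotient_iso_connecting: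
  "quotient_iso (cycles (int k + 1) M) (boundaries (int k + 1) M)
     (cycles (int k) kernel) (boundaries (int k) kernel) (connecting (int k + 1))"
  unfolding quotient_iso_def
proof (intro conjI allI impI ballI)
  note fm = function_module_sections
  fix \<Omega> \<Omega>' assume "connecting (int k + 1) \<Omega> \<Omega>'"
  then obtain \<omega> where \<Omega>: "\<Omega> \<in> cycles (int k + 1) M"
    and \<omega>: "\<omega> \<in> forms (int k + 1) \<Gamma>" "push_form \<omega> = \<Omega>" "euler_contraction \<omega> = \<Omega>'"
    unfolding connecting_def by blast
  show "\<Omega> \<in> cycles (int k + 1) M" by (rule \<Omega>)
  have "\<Omega>' \<in> forms (int k) \<Gamma>" using euler_contraction_forms[OF fm \<omega>(1)] \<omega>(3) by simp
  moreover have "push_form \<Omega>' = (\<lambda>x vs. 0)"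
    using \<Omega> \<omega>(2) unfolding \<omega>(3)[symmetric] push_form_contraction cycles_def by simp
  ultimately have "\<Omega>' \<in> forms (int k) kernel" by (rule forms_kernelI)
  then show "\<Omega>' \<in> cycles (int k) kernel"
    using euler_contraction_twice[OF \<omega>(1)] \<omega>(3) by (simp add: cycles_def)
  show "\<Omega> \<in> boundaries (int k + 1) M \<longleftrightarrow> \<Omega>' \<in> boundaries (int k) kernel"
    by (rule boundary_iff_of_connecting[OF \<omega>])
next
  fix \<Omega> assume \<Omega>: "\<Omega> \<in> cycles (int k + 1) M"
  then have "\<Omega> \<in> forms (int k + 1) M" by (simp add: cycles_def)
  from lift_form[OF this] show "\<exists>\<Omega>'. connecting (int k + 1) \<Omega> \<Omega>'"
    using \<Omega> unfolding connecting_def by metis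
next
  fix \<Omega>' assume \<Omega>': "\<Omega>' \<in> cycles (int k) kernel"
  then have f: "\<Omega>' \<in> forms (int k) kernel" by (simp add: cycles_def)
  have "\<Omega>' \<in> cycles (int k) \<Gamma>"
    using \<Omega>' forms_kernel_subset by (auto simp: cycles_def)
  \<comment> \<open>In degree 0 exactness over \<open>\<Gamma>\<close> is obstructed by the value at
    0, which is 0 for kernel-valued forms. This makes the relation total on the right even for
    \<open>k = 0\<close>.\<close>
  from koszul_exact_forms[OF this forms_kernel_vanish[OF f]]
  obtain \<omega> where \<omega>: "\<omega> \<in> forms (int k + 1) \<Gamma>" "euler_contraction \<omega> = \<Omega>'" by blast
  have "euler_contraction (push_form \<omega>) = (\<lambda>x vs. 0)"
    unfolding push_form_contraction[symmetric] \<omega>(2) by (rule forms_kernel_push[OF f])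
  then have "connecting (int k + 1) (push_form \<omega>) \<Omega>'"
    using \<omega> push_form_in_forms[OF \<omega>(1)] by (auto simp: connecting_def cycles_def)
  then show "\<exists>\<Omega>. connecting (int k + 1) \<Omega> \<Omega>'" by blast
qed

lemma comb_compatible_connecting:
  assumes "function_module M"
  shows "comb_compatible form_comb form_comb (connecting k)"
  unfolding comb_compatible_def
proof (intro allI impI)
  fix a b \<Omega>1 \<Omega>2 \<Omega>1' \<Omega>2' assume "connecting k \<Omega>1 \<Omega>1'" "connecting k \<Omega>2 \<Omega>2'"
  then obtain \<omega>1 \<omega>2 where "\<Omega>1 \<in> cycles k M" "\<Omega>2 \<in> cycles k M"
    and \<omega>: "\<omega>1 \<in> forms k \<Gamma>" "push_form \<omega>1 = \<Omega>1" "euler_contraction \<omega>1 = \<Omega>1'"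
      "\<omega>2 \<in> forms k \<Gamma>" "push_form \<omega>2 = \<Omega>2" "euler_contraction \<omega>2 = \<Omega>2'"
    unfolding connecting_def by blast
  then have "form_comb a b \<Omega>1 \<Omega>2 \<in> cycles k M" by (intro cycles_comb assms)
  moreover have "form_comb a b \<omega>1 \<omega>2 \<in> forms k \<Gamma>"
    by (intro forms_comb function_module_sections \<omega>)
  moreover have "push_form (form_comb a b \<omega>1 \<omega>2) = form_comb a b \<Omega>1 \<Omega>2"
    by (simp add: push_form_comb[OF \<omega>(1,4)] \<omega>)
  moreover have "euler_contraction (form_comb a b \<omega>1 \<omega>2) = form_comb a b \<Omega>1' \<Omega>2'"
    by (simp add: euler_contraction_comb \<omega>)
  ultimately show "connecting k (form_comb a b \<Omega>1 \<Omega>2) (form_comb a b \<Omega>1' \<Omega>2')"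
    unfolding connecting_def by blast
qed

text \<open>The identification of M / IM with the fibre of \<open>B\<close> at 0, where I consists
  of the functions vanishing at 0: lift to a section, then take its value there.\<close>

definition evaluation :: "('v \<Rightarrow> 'v list \<Rightarrow> 'f) \<Rightarrow> 'e \<Rightarrow> bool" where
  "evaluation \<Omega> u \<longleftrightarrow> (\<exists>\<omega>\<in>forms 0 \<Gamma>. push_form \<omega> = \<Omega> \<and> \<omega> 0 [] = u)"

text \<open>Two lifts of the same element differ by a kernel section, which is 0 at the origin, and
  a contraction with the Euler field is 0 there too; so boundaries go to 0. Conversely, a section
  vanishing at 0 is a contraction by Koszul exactness in degree 0.\<close>

lemma quotient_iso_evaluation:
  "quotient_iso (cycles 0 M) (boundaries 0 M) (fiber B 0) {0} evaluation"
  unfolding quotient_iso_def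
proof (intro conjI allI impI ballI)
  note fm = function_module_sections
  fix \<Omega> u assume "evaluation \<Omega> u"
  then obtain \<omega> where \<omega>: "\<omega> \<in> forms 0 \<Gamma>" "push_form \<omega> = \<Omega>" "\<omega> 0 [] = u"
    unfolding evaluation_def by blast
  show "\<Omega> \<in> cycles 0 M" using cycles_zero[OF push_form_in_forms[OF \<omega>(1)]] \<omega>(2) by simp
  show "u \<in> fiber B 0" using forms_fiber[OF \<omega>(1), of 0 "[]"] \<omega>(3) by simp
  show "\<Omega> \<in> boundaries 0 M \<longleftrightarrow> u \<in> {0}"
  proof
    assume "\<Omega> \<in> boundaries 0 M"
    then obtain \<eta> where \<eta>: "\<eta> \<in> forms 1 M" "\<Omega> = euler_contraction \<eta>" by (auto simp: boundaries_def)
    obtain \<theta> where \<theta>: "\<theta> \<in> forms 1 \<Gamma>" "push_form \<theta> = \<eta>" by (rule lift_form[OF \<eta>(1)])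
    have d\<theta>: "euler_contraction \<theta> \<in> forms 0 \<Gamma>" using euler_contraction_forms[OF fm \<theta>(1)] by simp
    let ?\<omega>' = "form_comb 1 (-1) \<omega> (euler_contraction \<theta>)"
    have "push_form ?\<omega>' = (\<lambda>x vs. 0)"
      unfolding push_form_comb[OF \<omega>(1) d\<theta>] push_form_contraction \<theta>(2) \<omega>(2) \<eta>(2)
      by (simp add: form_comb_def)
    then have "?\<omega>' \<in> forms 0 kernel"
      by (rule forms_kernelI[OF forms_comb[OF fm \<omega>(1) d\<theta>]])
    from forms_kernel_vanish[OF this, of "[]"] have "u = \<theta> 0 [0]"
      by (simp add: form_comb_def euler_contraction_def \<omega>(3)[symmetric])
    also have "\<theta> 0 [0] = 0"
    proof -
      have "alt_form 1 (\<theta> 0)" using \<theta>(1) by (simp add: forms_def)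
      from linear_0[OF alt_form_linear_append[OF this, of "[]" "[]"]] show ?thesis by simp
    qed
    finally show "u \<in> {0}" by simp
  next
    assume "u \<in> {0}"
    then have "\<omega> 0 [] = 0" using \<omega>(3) by simp
    with koszul_exact_forms[of \<omega> 0] cycles_zero[OF \<omega>(1)]
    obtain \<eta> where "\<eta> \<in> forms 1 \<Gamma>" "euler_contraction \<eta> = \<omega>" by auto
    then have "push_form \<eta> \<in> forms (0 + 1) M" "\<Omega> = euler_contraction (push_form \<eta>)"
      using push_form_in_forms[of \<eta> 1] push_form_contraction[of \<eta>] \<omega>(2) by auto
    then show "\<Omega> \<in> boundaries 0 M" unfolding boundaries_def by blast
  qed
next
  fix \<Omega> assume "\<Omega> \<in> cycles 0 M"
  then have "\<Omega> \<in> forms 0 M" by (simp add: cycles_def)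
  from lift_form[OF this] show "\<exists>u. evaluation \<Omega> u" unfolding evaluation_def by metis
next
  fix u assume "u \<in> fiber B 0"
  then obtain s where s: "s \<in> \<Gamma>" "s 0 = u" by (rule section_through)
  let ?\<omega> = "\<lambda>x vs. if vs = [] then s x else 0"
  have "(\<lambda>x. ?\<omega> x vs) \<in> \<Gamma>" for vs
    by (cases "vs = []") (simp_all add: s(1) function_module_zero[OF function_module_sections])
  then have "?\<omega> \<in> forms 0 \<Gamma>" by (auto simp: forms_def alt_form_def)
  then show "\<exists>\<Omega>. evaluation \<Omega> u"
    unfolding evaluation_def using s(2) by (intro exI[of _ "push_form ?\<omega>"] bexI[of _ ?\<omega>]) auto
qed

lemma comb_compatible_evaluation:
  "comb_compatible form_comb (\<lambda>a b u v. a *\<^sub>R u + b *\<^sub>R v) evaluation"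
  unfolding comb_compatible_def
proof (intro allI impI)
  fix a b \<Omega>1 \<Omega>2 u1 u2 assume "evaluation \<Omega>1 u1" "evaluation \<Omega>2 u2"
  then obtain \<omega>1 \<omega>2 where \<omega>: "\<omega>1 \<in> forms 0 \<Gamma>" "push_form \<omega>1 = \<Omega>1" "\<omega>1 0 [] = u1"
      "\<omega>2 \<in> forms 0 \<Gamma>" "push_form \<omega>2 = \<Omega>2" "\<omega>2 0 [] = u2"
    unfolding evaluation_def by blast
  have "form_comb a b \<omega>1 \<omega>2 \<in> forms 0 \<Gamma>"
    by (intro forms_comb function_module_sections \<omega>)
  moreover have "push_form (form_comb a b \<omega>1 \<omega>2) = form_comb a b \<Omega>1 \<Omega>2"
    by (simp add: push_form_comb[OF \<omega>(1,4)] \<omega>)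
  moreover have "form_comb a b \<omega>1 \<omega>2 0 [] = a *\<^sub>R u1 + b *\<^sub>R u2"
    by (simp add: form_comb_def \<omega>)
  ultimately show "evaluation (form_comb a b \<Omega>1 \<Omega>2) (a *\<^sub>R u1 + b *\<^sub>R u2)"
    unfolding evaluation_def by blast
qed

end


section \<open>Minimal resolutions\<close>

lemma resolution_bundle:
  "resolution F n E D \<rho> \<Longrightarrow> i \<le> n \<Longrightarrow> vbundle (E i)"
  by (simp add: resolution_def vbundle_def)

lemma resolution_kernel_0:
  assumes "resolution F n E D \<rho>"
  shows "kernel_sheaf (sections (E 0)) \<rho> UNIV =
    (if n = 0 then {\<lambda>x. 0} else image_sheaf (sections (E 1)) (D 1) UNIV)"
proof -
  have "open (UNIV :: 'a set)" "0 \<le> n" by auto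
  then show ?thesis using assms unfolding resolution_def
    by (elim conjE allE[where x = "UNIV :: 'a set"] impE) (auto simp: restrict_def)
qed

lemma resolution_kernel_pos:
  assumes "resolution F n E D \<rho>" "0 < i" "i \<le> n"
  shows "kernel_sheaf (sections (E i)) (D i) UNIV =
    (if i = n then {\<lambda>x. 0} else image_sheaf (sections (E (Suc i))) (D (Suc i)) UNIV)"
proof -
  have "\<forall>i\<le>n. (if i = 0 then kernel_sheaf (sections (E 0)) \<rho> UNIV
                 else kernel_sheaf (sections (E i)) (D i) UNIV) =
                (if i = n then {\<lambda>x\<in>UNIV. 0}
                 else image_sheaf (sections (E (i + 1))) (D (i + 1)) UNIV)"
    using assms(1) open_UNIV unfolding resolution_def by blast
  then show ?thesis using assms(2,3) by (auto simp: restrict_def)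
qed

lemma kernel_sheaf_UNIV: "kernel_sheaf A \<phi> UNIV = {s \<in> A UNIV. \<forall>x. \<phi> x (s x) = 0}"
  by (auto simp: kernel_sheaf_def push_def fun_eq_iff)

lemma push_in_image_sheaf:
  assumes "s \<in> A UNIV" shows "(\<lambda>x. \<phi> x (s x)) \<in> image_sheaf A \<phi> UNIV"
  unfolding image_sheaf_def using assms
  by (auto simp: push_def restrict_def intro!: exI[of _ UNIV] bexI[of _ s])

lemma image_sheaf_vanishes:
  assumes "t \<in> image_sheaf (sections B) \<phi> UNIV" "\<And>u. u \<in> fiber B x \<Longrightarrow> \<phi> x u = 0"
  shows "t x = 0"
proof -
  obtain W s where W: "x \<in> W" "s \<in> sections B W" "restrict t W = push \<phi> W s"
    using assms(1) unfolding image_sheaf_def by blast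
  have "t x = restrict t W x" using W(1) by simp
  also have "\<dots> = \<phi> x (s x)" using W(1) unfolding W(3) by (simp add: push_def)
  finally have "t x = \<phi> x (s x)" .
  then show ?thesis using assms(2) sections_fiber[OF W(2,1)] by simp
qed

context
  fixes F :: "'v::euclidean_space set \<Rightarrow> ('v \<Rightarrow> 'v) set"
    and n :: nat
    and E :: "nat \<Rightarrow> ('v, 'e::real_vector) vector_bundle"
    and D :: "nat \<Rightarrow> 'v \<Rightarrow> 'e \<Rightarrow> 'e"
    and \<rho> :: "'v \<Rightarrow> 'e \<Rightarrow> 'v"
  assumes res: "resolution F n E D \<rho>" and min: "minimal_at 0 n E D"
begin

text \<open>The global sections of Z_j. The case \<open>j = 0\<close> is separate because the anchor
  takes its values in \<open>TV\<close> and not in a bundle of the resolution.\<close>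

definition syzygies :: "nat \<Rightarrow> ('v \<Rightarrow> 'e) set" where
  "syzygies j = (if j = 0 then kernel_sheaf (sections (E 0)) \<rho> UNIV
     else kernel_sheaf (sections (E j)) (D j) UNIV)"

lemma syzygies_eq:
  assumes "j \<le> n"
  shows "syzygies j = (if j = n then {\<lambda>x. 0} else image_sheaf (sections (E (Suc j))) (D (Suc j)) UNIV)"
proof (cases "j = 0")
  case True
  then show ?thesis using resolution_kernel_0[OF res] by (auto simp: syzygies_def)
next
  case False
  then have "0 < j" by simp
  from resolution_kernel_pos[OF res this assms] show ?thesis unfolding syzygies_def if_not_P[OF False] .
qed

lemma syzygies_vanish:
  assumes "j \<le> n" "s \<in> syzygies j"
  shows "s 0 = 0"
proof (cases "j = n")
  case True
  then show ?thesis using assms syzygies_eq[OF assms(1)] by simp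
next
  case False
  then have "Suc j \<in> {1..n}" using assms(1) by simp
  then have "D (Suc j) 0 u = 0" if "u \<in> fiber (E (Suc j)) 0" for u
    using min that unfolding minimal_at_def by blast
  then show ?thesis
    using image_sheaf_vanishes[of s "E (Suc j)" "D (Suc j)"] assms(2) syzygies_eq[OF assms(1)] False by simp
qed

lemma bundle_surjection_anchor: "bundle_surjection (E 0) \<rho> (F UNIV)"
proof -
  interpret vbundle "E 0" by (rule resolution_bundle[OF res]) simp
  have im: "image_sheaf (sections (E 0)) \<rho> UNIV = F UNIV"
    using res open_UNIV unfolding resolution_def by blast
  have lin: "linear_on_fibers (E 0) \<rho>"
    using res unfolding resolution_def anchor_map_def by blast
  show ?thesis
  proof
    show "(\<lambda>x. \<rho> x (s x)) \<in> F UNIV" if "s \<in> \<Gamma>" for s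
      unfolding im[symmetric] by (rule push_in_image_sheaf) (rule that)
    show "\<exists>s\<in>\<Gamma>. \<forall>x. \<rho> x (s x) = t x" if "t \<in> F UNIV" for t
    proof -
      have "t \<in> image_sheaf (sections (E 0)) \<rho> UNIV" using that im by simp
      from image_sheaf_global[OF lin this] show ?thesis by metis
    qed
    show "s 0 = 0" if "s \<in> \<Gamma>" "\<And>x. \<rho> x (s x) = 0" for s
      using syzygies_vanish[of 0 s] that by (simp add: syzygies_def kernel_sheaf_UNIV)
  qed (rule lin)
qed

lemma bundle_surjection_differential:
  assumes "Suc j \<le> n"
  shows "bundle_surjection (E (Suc j)) (D (Suc j)) (syzygies j)"
proof -
  interpret vbundle "E (Suc j)" by (rule resolution_bundle[OF res assms])
  have im: "image_sheaf (sections (E (Suc j))) (D (Suc j)) UNIV = syzygies j"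
    using syzygies_eq[of j] assms by simp
  have "Suc j \<in> {1..n}" using assms by simp
  then have "bundle_map (E (Suc j)) (E (Suc j - 1)) (D (Suc j))"
    using res unfolding resolution_def by blast
  then have lin: "linear_on_fibers (E (Suc j)) (D (Suc j))" unfolding bundle_map_def by blast
  show ?thesis
  proof
    show "(\<lambda>x. D (Suc j) x (s x)) \<in> syzygies j" if "s \<in> \<Gamma>" for s
      unfolding im[symmetric] by (rule push_in_image_sheaf) (rule that)
    show "\<exists>s\<in>\<Gamma>. \<forall>x. D (Suc j) x (s x) = t x" if "t \<in> syzygies j" for t
    proof -
      have "t \<in> image_sheaf (sections (E (Suc j))) (D (Suc j)) UNIV" using that im by simp
      from image_sheaf_global[OF lin this] show ?thesis by metis
    qed
    show "s 0 = 0" if "s \<in> \<Gamma>" "\<And>x. D (Suc j) x (s x) = 0" for s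
      using syzygies_vanish[OF assms, of s] that by (simp add: syzygies_def kernel_sheaf_UNIV)
  qed (rule lin)
qed

lemma kernel_anchor: "bundle_surjection.kernel (E 0) \<rho> = syzygies 0"
  using bundle_surjection.kernel_def[OF bundle_surjection_anchor] by (simp add: syzygies_def kernel_sheaf_UNIV)

lemma kernel_differential:
  assumes "Suc j \<le> n"
  shows "bundle_surjection.kernel (E (Suc j)) (D (Suc j)) = syzygies (Suc j)"
  using bundle_surjection.kernel_def[OF bundle_surjection_differential[OF assms]]
  by (simp add: syzygies_def kernel_sheaf_UNIV)

lemma function_module_syzygies:
  assumes "j \<le> n"
  shows "function_module (syzygies j)"
proof -
  \<comment> \<open>Stated for a general target type, since the anchor and the differentials have
    values in different types.\<close>
  have "function_module (bundle_surjection.kernel B \<phi>)" if "bundle_surjection B \<phi> M"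
    for B :: "('v, 'e) vector_bundle" and \<phi> :: "'v \<Rightarrow> 'e \<Rightarrow> 'f::real_vector" and M
  proof -
    interpret bundle_surjection B \<phi> M by (rule that)
    have "\<phi> x (s x + t x) = \<phi> x (s x) + \<phi> x (t x)" if "s \<in> \<Gamma>" "t \<in> \<Gamma>" for s t x
      using linear sections_fiber[OF that(1), of x] sections_fiber[OF that(2), of x]
      by (simp add: linear_on_fibers_def)
    moreover have "\<phi> x (f *\<^sub>R s x) = f *\<^sub>R \<phi> x (s x)" if "s \<in> \<Gamma>" for s x f
      using linear sections_fiber[OF that(1), of x] by (simp add: linear_on_fibers_def)
    ultimately show ?thesis
      using function_module_sections linear_on_fibers_zero[OF linear]
      by (simp add: function_module_def kernel_def)
  qed
  from this[OF bundle_surjection_anchor] this[OF bundle_surjection_differential]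
  show ?thesis
    using assms kernel_anchor kernel_differential by (cases j) auto
qed

text \<open>The composite of \<open>j + 1\<close> connecting relations, each lowering the degree by
  one. The condition \<open>j < i\<close> keeps the subtraction on natural numbers from
  truncating.\<close>

lemma quotient_iso_syzygies:
  assumes F: "function_module (F UNIV)"
  shows "j < i \<Longrightarrow> i \<le> n \<Longrightarrow> \<exists>R. comb_compatible form_comb form_comb R \<and>
    quotient_iso (cycles (int i) (F UNIV)) (boundaries (int i) (F UNIV))
      (cycles (int (i - Suc j)) (syzygies j)) (boundaries (int (i - Suc j)) (syzygies j)) R"
proof (induction j)
  case 0
  interpret bundle_surjection "E 0" \<rho> "F UNIV" by (rule bundle_surjection_anchor)
  have i: "int (i - Suc 0) + 1 = int i" using 0 by simp
  show ?case
    using comb_compatible_connecting[OF F, of "int i"] quotient_iso_connecting[of "i - Suc 0"]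
    unfolding kernel_anchor i by blast
next
  case (Suc j)
  then obtain R where R: "comb_compatible form_comb form_comb R"
    "quotient_iso (cycles (int i) (F UNIV)) (boundaries (int i) (F UNIV))
      (cycles (int (i - Suc j)) (syzygies j)) (boundaries (int (i - Suc j)) (syzygies j)) R"
    by auto
  have j: "Suc j \<le> n" "j \<le> n" using Suc.prems by auto
  interpret bundle_surjection "E (Suc j)" "D (Suc j)" "syzygies j"
    by (rule bundle_surjection_differential[OF j(1)])
  have i: "int (i - Suc (Suc j)) + 1 = int (i - Suc j)" using Suc.prems by simp
  have "quotient_iso (cycles (int (i - Suc j)) (syzygies j)) (boundaries (int (i - Suc j)) (syzygies j))
      (cycles (int (i - Suc (Suc j))) (syzygies (Suc j))) (boundaries (int (i - Suc (Suc j))) (syzygies (Suc j)))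
      (connecting (int (i - Suc j)))"
    using quotient_iso_connecting[of "i - Suc (Suc j)"] unfolding kernel_differential[OF j(1)] i .
  with R comb_compatible_connecting[OF function_module_syzygies[OF j(2)], of "int (i - Suc j)"]
  show ?case using quotient_iso_OO comb_compatible_OO by blast
qed

lemma quotient_iso_fiber:
  assumes F: "function_module (F UNIV)" and i: "i \<le> n"
  obtains R where "comb_compatible form_comb (\<lambda>a b u v. a *\<^sub>R u + b *\<^sub>R v) R"
    "quotient_iso (cycles (int i) (F UNIV)) (boundaries (int i) (F UNIV)) (fiber (E i) 0) {0} R"
proof (cases i)
  case 0
  interpret bundle_surjection "E 0" \<rho> "F UNIV" by (rule bundle_surjection_anchor)
  show thesis using that comb_compatible_evaluation quotient_iso_evaluation 0 by simp
next
  case (Suc j)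
  interpret bundle_surjection "E (Suc j)" "D (Suc j)" "syzygies j"
    by (rule bundle_surjection_differential) (use Suc i in simp)
  \<comment> \<open>With \<open>i = Suc j\<close> the shift ends in degree 0, where evaluation at
    the origin takes over.\<close>
  obtain R where "comb_compatible form_comb form_comb R"
    "quotient_iso (cycles (int i) (F UNIV)) (boundaries (int i) (F UNIV))
      (cycles 0 (syzygies j)) (boundaries 0 (syzygies j)) R"
    using quotient_iso_syzygies[OF F, of j i] i Suc by auto
  then show thesis
    using that quotient_iso_OO[OF _ quotient_iso_evaluation] comb_compatible_OO[OF _ comb_compatible_evaluation]
      Suc by blast
qed

end


section \<open>Tensor products with the modules of forms\<close>

text \<open>The analogue of \<open>frag_extend\<close> for values in a real vector space, needed
  because \<open>frag_extend\<close> maps into formal sums only.\<close>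

definition frag_eval :: "('a \<Rightarrow> 'b::real_vector) \<Rightarrow> ('a \<Rightarrow>\<^sub>0 int) \<Rightarrow> 'b" where
  "frag_eval f z = (\<Sum>a\<in>Poly_Mapping.keys z. real_of_int (Poly_Mapping.lookup z a) *\<^sub>R f a)"

lemma frag_eval_superset:
  assumes "finite A" "Poly_Mapping.keys z \<subseteq> A"
  shows "frag_eval f z = (\<Sum>a\<in>A. real_of_int (Poly_Mapping.lookup z a) *\<^sub>R f a)"
  unfolding frag_eval_def by (rule sum.mono_neutral_left) (use assms in \<open>auto simp: in_keys_iff\<close>)

lemma frag_eval_zero [simp]: "frag_eval f 0 = 0"
  by (simp add: frag_eval_def)

lemma frag_eval_diff: "frag_eval f (z - w) = frag_eval f z - frag_eval f w"
proof -
  let ?A = "Poly_Mapping.keys z \<union> Poly_Mapping.keys w"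
  have "frag_eval f (z - w) = (\<Sum>a\<in>?A. real_of_int (Poly_Mapping.lookup (z - w) a) *\<^sub>R f a)"
    by (rule frag_eval_superset) (auto dest: subsetD[OF keys_diff])
  also have "\<dots> = frag_eval f z - frag_eval f w"
    by (subst (1 2) frag_eval_superset[of ?A])
      (auto simp: lookup_minus scaleR_left_diff_distrib sum_subtractf)
  finally show ?thesis .
qed

lemma frag_eval_minus: "frag_eval f (- z) = - frag_eval f z"
  using frag_eval_diff[of f 0 z] by simp

lemma frag_eval_add: "frag_eval f (z + w) = frag_eval f z + frag_eval f w"
  using frag_eval_diff[of f z "- w"] by (simp add: frag_eval_minus)

lemma frag_eval_sum: "frag_eval f (\<Sum>i\<in>I. z i) = (\<Sum>i\<in>I. frag_eval f (z i))"
  by (induction I rule: infinite_finite_induct) (auto simp: frag_eval_add)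

lemma frag_eval_of [simp]: "frag_eval f (frag_of a) = f a"
  by (simp add: frag_eval_def)

lemma frag_eval_extend: "frag_eval f (frag_extend g z) = frag_eval (\<lambda>a. frag_eval f (g a)) z"
  by (rule frag_induction[of z UNIV]) (auto simp: frag_extend_diff frag_eval_diff)

text \<open>Represents the map \<omega> \<otimes> X -> \<omega> X from tensors to vector-valued
  forms, before passing to the quotient by the bilinear relations.\<close>

definition tensor_eval ::
  "((('v \<Rightarrow> 'v list \<Rightarrow> real) \<times> ('v \<Rightarrow> 'a::real_vector)) \<Rightarrow>\<^sub>0 int) \<Rightarrow> 'v \<Rightarrow> 'v list \<Rightarrow> 'a" where
  "tensor_eval z = (\<lambda>x vs. frag_eval (\<lambda>(\<omega>, X). \<omega> x vs *\<^sub>R X x) z)"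

lemma tensor_eval_zero [simp]: "tensor_eval 0 = (\<lambda>x vs. 0)"
  by (simp add: tensor_eval_def)

lemma tensor_eval_of [simp]: "tensor_eval (frag_of (\<omega>, X)) = (\<lambda>x vs. \<omega> x vs *\<^sub>R X x)"
  by (simp add: tensor_eval_def)

lemma tensor_eval_diff: "tensor_eval (z - w) = (\<lambda>x vs. tensor_eval z x vs - tensor_eval w x vs)"
  by (simp add: tensor_eval_def frag_eval_diff)

lemma tensor_eval_add: "tensor_eval (z + w) = (\<lambda>x vs. tensor_eval z x vs + tensor_eval w x vs)"
  by (simp add: tensor_eval_def frag_eval_add)

lemma tensor_eval_sum: "tensor_eval (\<Sum>i\<in>I. z i) = (\<lambda>x vs. \<Sum>i\<in>I. tensor_eval (z i) x vs)"
  by (simp add: tensor_eval_def frag_eval_sum)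

lemma forms_module_carrier:
  "\<omega> \<in> carrier (forms_module k) \<longleftrightarrow> (\<forall>x. alt_form k (\<omega> x)) \<and> (\<forall>vs. smooth_on UNIV (\<lambda>x. \<omega> x vs))"
  by (simp add: forms_module_def alternating_form_eq_alt_form)

lemma forms_module_frame:
  assumes "bs \<in> basis_lists k"
  shows "(\<lambda>x. alt_frame bs) \<in> carrier (forms_module k)"
proof -
  have "k = int (length bs)" using assms by (simp add: basis_lists_def)
  then show ?thesis using alt_form_alt_frame by (simp add: forms_module_carrier smooth_on_const)
qed

lemma forms_module_add:
  "m \<in> carrier (forms_module k) \<Longrightarrow> m' \<in> carrier (forms_module k) \<Longrightarrow>
    (\<lambda>x vs. m x vs + m' x vs) \<in> carrier (forms_module k)"
  by (auto simp: forms_module_carrier intro: alt_form_add smooth_on_add)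

lemma forms_module_scale:
  assumes "m \<in> carrier (forms_module k)" "smooth_on UNIV a"
  shows "(\<lambda>x vs. a x * m x vs) \<in> carrier (forms_module k)"
  using assms alt_form_scaleR[of k "m x" "a x" for x]
  by (auto simp: forms_module_carrier intro: smooth_on_mult)

lemma forms_module_zero: "(\<lambda>x vs. 0) \<in> carrier (forms_module k)"
  by (simp add: forms_module_carrier alt_form_zero smooth_on_const)

text \<open>Real-valued forms are \<open>forms\<close> over the module of smooth functions, and
  \<open>euler_field x\<close> is \<open>x\<close>, so this is an instance of
  \<open>euler_contraction_forms\<close>.\<close>

lemma forms_module_contraction:
  assumes "m \<in> carrier (forms_module k)"
  shows "contraction euler_field m \<in> carrier (forms_module (k - 1))"
proof -
  have "function_module {f :: 'a \<Rightarrow> real. smooth_on UNIV f}"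
    by (auto simp: function_module_def intro: smooth_on_const smooth_on_add smooth_on_mult)
  moreover have "m \<in> forms k {f. smooth_on UNIV f}"
    using assms by (simp add: forms_module_carrier forms_def)
  ultimately have "euler_contraction m \<in> forms (k - 1) {f. smooth_on UNIV f}"
    by (rule euler_contraction_forms)
  moreover have "contraction euler_field m = euler_contraction m"
    by (simp add: contraction_def euler_contraction_def euler_field_def euclidean_representation)
  ultimately show ?thesis by (simp add: forms_module_carrier forms_def)
qed

locale koszul_tensor =
  fixes F :: "'v::euclidean_space set \<Rightarrow> ('v \<Rightarrow> 'v) set"
  assumes F_module: "function_module (F UNIV)"
begin

abbreviation "pairs k \<equiv> carrier (forms_module k) \<times> carrier (foliation_module F)"

definition null :: "int \<Rightarrow> ((('v \<Rightarrow> 'v list \<Rightarrow> real) \<times> ('v \<Rightarrow> 'v)) \<Rightarrow>\<^sub>0 int) set" where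
  "null k = tensor_null smooth_ring (forms_module k) (foliation_module F)"

lemma carrier_foliation: "carrier (foliation_module F) = F UNIV"
  by (simp add: foliation_module_def)

lemma relations_closed:
  "bilinear_relations smooth_ring (forms_module k) (foliation_module F) \<subseteq>
     carrier (free_Abelian_group (pairs k))"
proof -
  have d: "Poly_Mapping.keys (z - w) \<subseteq> A" if "Poly_Mapping.keys z \<subseteq> A" "Poly_Mapping.keys w \<subseteq> A"
    for z w :: "(('v \<Rightarrow> 'v list \<Rightarrow> real) \<times> ('v \<Rightarrow> 'v)) \<Rightarrow>\<^sub>0 int" and A
    using keys_diff[of z w] that by blast
  have add: "m \<oplus>\<^bsub>forms_module k\<^esub> m' \<in> carrier (forms_module k)"
    if "m \<in> carrier (forms_module k)" "m' \<in> carrier (forms_module k)" for m m' :: "'v \<Rightarrow> 'v list \<Rightarrow> real"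
    using forms_module_add[OF that] by (simp add: forms_module_def)
  have scale: "a \<odot>\<^bsub>forms_module k\<^esub> m \<in> carrier (forms_module k)"
    if "a \<in> carrier smooth_ring" "m \<in> carrier (forms_module k)" for a and m :: "'v \<Rightarrow> 'v list \<Rightarrow> real"
    using forms_module_scale[OF that(2), of a] that(1) by (simp add: forms_module_def smooth_ring_def)
  have addF: "X \<oplus>\<^bsub>foliation_module F\<^esub> Y \<in> carrier (foliation_module F)"
    if "X \<in> carrier (foliation_module F)" "Y \<in> carrier (foliation_module F)" for X Y
    using function_module_add[OF F_module] that by (simp add: foliation_module_def)
  have scaleF: "a \<odot>\<^bsub>foliation_module F\<^esub> X \<in> carrier (foliation_module F)"
    if "a \<in> carrier smooth_ring" "X \<in> carrier (foliation_module F)" for a X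
    using function_module_scaleR[OF F_module] that by (simp add: foliation_module_def smooth_ring_def)
  show ?thesis
  proof
    fix z assume "z \<in> bilinear_relations smooth_ring (forms_module k) (foliation_module F)"
    then show "z \<in> carrier (free_Abelian_group (pairs k))"
      unfolding bilinear_relations_def carrier_free_Abelian_group_iff
      by (elim UnE CollectE exE conjE; hypsubst; intro d) (simp_all add: keys_frag_of add scale addF scaleF)
  qed
qed

lemma subgroup_null: "subgroup (null k) (free_Abelian_group (pairs k))"
  unfolding null_def tensor_null_def
  by (rule group.generate_is_subgroup[OF group_free_Abelian_group relations_closed])

lemma null_carrier: "z \<in> null k \<Longrightarrow> Poly_Mapping.keys z \<subseteq> pairs k"
  using subgroup.subset[OF subgroup_null] by fastforce

lemma null_zero: "0 \<in> null k"
  using subgroup.one_closed[OF subgroup_null] by simp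

lemma null_add: "z \<in> null k \<Longrightarrow> w \<in> null k \<Longrightarrow> z + w \<in> null k"
  using subgroup.m_closed[OF subgroup_null] by simp

lemma null_minus: "z \<in> null k \<Longrightarrow> - z \<in> null k"
  using subgroup.m_inv_closed[OF subgroup_null] null_carrier by fastforce

lemma null_diff: "z \<in> null k \<Longrightarrow> w \<in> null k \<Longrightarrow> z - w \<in> null k"
  using null_add[OF _ null_minus] by force

lemma null_sum: "(\<And>i. i \<in> I \<Longrightarrow> z i \<in> null k) \<Longrightarrow> (\<Sum>i\<in>I. z i) \<in> null k"
  by (induction I rule: infinite_finite_induct) (auto intro: null_zero null_add)

lemma null_relation:
  "z \<in> bilinear_relations smooth_ring (forms_module k) (foliation_module F) \<Longrightarrow> z \<in> null k"
  unfolding null_def tensor_null_def by (rule generate.incl)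

lemma null_left_add:
  assumes "m \<in> carrier (forms_module k)" "m' \<in> carrier (forms_module k)" "X \<in> F UNIV"
  shows "frag_of (\<lambda>x vs. m x vs + m' x vs, X) - frag_of (m, X) - frag_of (m', X) \<in> null k"
proof (rule null_relation)
  have "frag_of (m \<oplus>\<^bsub>forms_module k\<^esub> m', X) - frag_of (m, X) - frag_of (m', X) \<in>
      bilinear_relations smooth_ring (forms_module k) (foliation_module F)"
    using assms unfolding bilinear_relations_def carrier_foliation by blast
  then show "frag_of (\<lambda>x vs. m x vs + m' x vs, X) - frag_of (m, X) - frag_of (m', X) \<in>
      bilinear_relations smooth_ring (forms_module k) (foliation_module F)"
    by (simp add: forms_module_def)
qed

lemma null_right_add:
  assumes "m \<in> carrier (forms_module k)" "X \<in> F UNIV" "Y \<in> F UNIV"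
  shows "frag_of (m, \<lambda>x. X x + Y x) - frag_of (m, X) - frag_of (m, Y) \<in> null k"
proof (rule null_relation)
  have "frag_of (m, X \<oplus>\<^bsub>foliation_module F\<^esub> Y) - frag_of (m, X) - frag_of (m, Y) \<in>
      bilinear_relations smooth_ring (forms_module k) (foliation_module F)"
    using assms unfolding bilinear_relations_def carrier_foliation by blast
  then show "frag_of (m, \<lambda>x. X x + Y x) - frag_of (m, X) - frag_of (m, Y) \<in>
      bilinear_relations smooth_ring (forms_module k) (foliation_module F)"
    by (simp add: foliation_module_def)
qed

lemma null_balanced:
  assumes "smooth_on UNIV a" "m \<in> carrier (forms_module k)" "X \<in> F UNIV"
  shows "frag_of (\<lambda>x vs. a x * m x vs, X) - frag_of (m, \<lambda>x. a x *\<^sub>R X x) \<in> null k"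
proof (rule null_relation)
  have "a \<in> carrier smooth_ring" using assms(1) by (simp add: smooth_ring_def)
  then have "frag_of (a \<odot>\<^bsub>forms_module k\<^esub> m, X) - frag_of (m, a \<odot>\<^bsub>foliation_module F\<^esub> X) \<in>
      bilinear_relations smooth_ring (forms_module k) (foliation_module F)"
    using assms unfolding bilinear_relations_def carrier_foliation by blast
  then show "frag_of (\<lambda>x vs. a x * m x vs, X) - frag_of (m, \<lambda>x. a x *\<^sub>R X x) \<in>
      bilinear_relations smooth_ring (forms_module k) (foliation_module F)"
    by (simp add: foliation_module_def forms_module_def)
qed

lemma tensor_eval_relation:
  assumes "z \<in> bilinear_relations smooth_ring (forms_module k) (foliation_module F)"
  shows "tensor_eval z = (\<lambda>x vs. 0)"
  using assms unfolding bilinear_relations_def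
  by (elim UnE CollectE exE conjE; hypsubst)
    (simp_all add: tensor_eval_diff forms_module_def foliation_module_def
      scaleR_left_distrib scaleR_right_distrib mult.commute)

lemma tensor_eval_null:
  assumes "z \<in> null k"
  shows "tensor_eval z = (\<lambda>x vs. 0)"
  using assms unfolding null_def tensor_null_def
proof (induction z rule: generate.induct)
  case one
  then show ?case by simp
next
  case (incl h)
  then show ?case by (rule tensor_eval_relation)
next
  case (inv h)
  \<comment> \<open>The group inverse is known to be negation only for elements of the
    carrier.\<close>
  then have "Poly_Mapping.keys h \<subseteq> pairs k" using relations_closed by fastforce
  then have "inv\<^bsub>free_Abelian_group (pairs k)\<^esub> h = 0 - h" by simp
  moreover have "tensor_eval h = (\<lambda>x vs. 0)" by (rule tensor_eval_relation[OF inv])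
  ultimately show ?case by (simp only: tensor_eval_diff) simp
next
  case (eng h1 h2)
  then show ?case by (simp add: tensor_eval_add)
qed

text \<open>The additivity relation for 0 + 0 = 0 reduces to minus the generator in
  question.\<close>

lemma null_zero_left: "X \<in> F UNIV \<Longrightarrow> frag_of (\<lambda>x vs. 0, X) \<in> null k"
  using null_minus[OF null_left_add[OF forms_module_zero forms_module_zero]] by simp

lemma null_left_sum:
  assumes "finite I" "\<And>i. i \<in> I \<Longrightarrow> m i \<in> carrier (forms_module k)" "X \<in> F UNIV"
  shows "(\<lambda>x vs. \<Sum>i\<in>I. m i x vs) \<in> carrier (forms_module k) \<and>
    frag_of (\<lambda>x vs. \<Sum>i\<in>I. m i x vs, X) - (\<Sum>i\<in>I. frag_of (m i, X)) \<in> null k"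
  using assms(1,2)
proof (induction I rule: finite_induct)
  case empty
  then show ?case using forms_module_zero null_zero_left[OF assms(3)] by simp
next
  case (insert i I)
  then have IH: "(\<lambda>x vs. \<Sum>i\<in>I. m i x vs) \<in> carrier (forms_module k)"
    "frag_of (\<lambda>x vs. \<Sum>i\<in>I. m i x vs, X) - (\<Sum>i\<in>I. frag_of (m i, X)) \<in> null k" by auto
  have mi: "m i \<in> carrier (forms_module k)" using insert by simp
  have "frag_of (\<lambda>x vs. m i x vs + (\<Sum>i\<in>I. m i x vs), X) - (frag_of (m i, X) + (\<Sum>i\<in>I. frag_of (m i, X)))
      \<in> null k"
    using null_add[OF null_left_add[OF mi IH(1) assms(3)] IH(2)] by (simp add: algebra_simps)
  then show ?case using insert(1,2) forms_module_add[OF mi IH(1)] by simp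
qed

section \<open>Normal forms of tensors\<close>

definition coset :: "int \<Rightarrow> ((('v \<Rightarrow> 'v list \<Rightarrow> real) \<times> ('v \<Rightarrow> 'v)) \<Rightarrow>\<^sub>0 int) \<Rightarrow>
    ((('v \<Rightarrow> 'v list \<Rightarrow> real) \<times> ('v \<Rightarrow> 'v)) \<Rightarrow>\<^sub>0 int) set" where
  "coset k z = null k #>\<^bsub>free_Abelian_group (pairs k)\<^esub> z"

lemma coset_eq: "coset k z = (\<lambda>h. h + z) ` null k"
  by (auto simp: coset_def r_coset_def)

lemma coset_mem: "w \<in> coset k z \<longleftrightarrow> w - z \<in> null k"
  by (force simp: coset_eq image_iff)

lemma coset_eqI:
  assumes "z - w \<in> null k"
  shows "coset k z = coset k w"
proof -
  have "y - z \<in> null k \<longleftrightarrow> y - w \<in> null k" for y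
    using null_add[of "y - z" k "z - w"] null_diff[of "y - w" k "z - w"] assms by auto
  then show ?thesis by (auto simp: coset_mem)
qed

lemma coset_self: "z \<in> coset k z"
  by (simp add: coset_mem null_zero)

text \<open>A right inverse of \<open>tensor_eval\<close>, given by the expansion formula. The forms
  \<open>alt_frame bs\<close> may be linearly dependent, but the second factors are the values of
  \<open>\<Omega>\<close> on basis lists and so are determined by \<open>\<Omega>\<close>; this
  replaces uniqueness of coefficients.\<close>

definition canonical :: "int \<Rightarrow> ('v \<Rightarrow> 'v list \<Rightarrow> 'v) \<Rightarrow>
    ((('v \<Rightarrow> 'v list \<Rightarrow> real) \<times> ('v \<Rightarrow> 'v)) \<Rightarrow>\<^sub>0 int)" where
  "canonical k \<Omega> = (\<Sum>bs\<in>basis_lists k. frag_of (\<lambda>x. alt_frame bs, \<lambda>x. \<Omega> x bs))"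

lemma canonical_carrier:
  assumes "\<Omega> \<in> forms k (F UNIV)"
  shows "Poly_Mapping.keys (canonical k \<Omega>) \<subseteq> pairs k"
proof -
  have "canonical k \<Omega> \<in> carrier (free_Abelian_group (pairs k))"
    unfolding canonical_def
    by (rule sum_closed_free_Abelian_group)
      (use assms forms_module_frame in \<open>auto simp: keys_frag_of carrier_foliation forms_def\<close>)
  then show ?thesis by simp
qed

lemma tensor_eval_canonical:
  assumes "\<Omega> \<in> forms k (F UNIV)"
  shows "tensor_eval (canonical k \<Omega>) = \<Omega>"
proof (intro ext)
  fix x vs
  have "alt_form k (\<Omega> x)" using assms by (simp add: forms_def)
  from alt_form_expansion[OF this, of vs]
  show "tensor_eval (canonical k \<Omega>) x vs = \<Omega> x vs"
    by (simp add: canonical_def tensor_eval_sum)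
qed

lemma canonical_diff:
  assumes "\<Omega> \<in> forms k (F UNIV)" "\<Omega>' \<in> forms k (F UNIV)"
  shows "canonical k (form_comb 1 (-1) \<Omega> \<Omega>') - (canonical k \<Omega> - canonical k \<Omega>') \<in> null k"
proof -
  have "frag_of (\<lambda>x. alt_frame bs, \<lambda>x. form_comb 1 (-1) \<Omega> \<Omega>' x bs) -
      (frag_of (\<lambda>x. alt_frame bs, \<lambda>x. \<Omega> x bs) - frag_of (\<lambda>x. alt_frame bs, \<lambda>x. \<Omega>' x bs)) \<in> null k"
    if bs: "bs \<in> basis_lists k" for bs
  proof -
    have "form_comb 1 (-1) \<Omega> \<Omega>' \<in> forms k (F UNIV)" by (rule forms_comb[OF F_module assms])
    then have "(\<lambda>x. form_comb 1 (-1) \<Omega> \<Omega>' x bs) \<in> F UNIV" "(\<lambda>x. \<Omega>' x bs) \<in> F UNIV"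
      using assms by (auto simp: forms_def)
    from null_minus[OF null_right_add[OF forms_module_frame[OF bs] this]]
    show ?thesis by (simp add: form_comb_def algebra_simps)
  qed
  then have "(\<Sum>bs\<in>basis_lists k. frag_of (\<lambda>x. alt_frame bs, \<lambda>x. form_comb 1 (-1) \<Omega> \<Omega>' x bs) -
      (frag_of (\<lambda>x. alt_frame bs, \<lambda>x. \<Omega> x bs) - frag_of (\<lambda>x. alt_frame bs, \<lambda>x. \<Omega>' x bs))) \<in> null k"
    by (rule null_sum)
  then show ?thesis by (simp add: canonical_def sum_subtractf)
qed

text \<open>Expanding \<open>\<omega>\<close> in the constant forms \<open>alt_frame bs\<close>
  gives coefficients that are smooth functions of \<open>x\<close>; bilinearity moves them across
  the tensor sign onto \<open>X\<close>.\<close>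

lemma canonical_of:
  assumes "\<omega> \<in> carrier (forms_module k)" "X \<in> F UNIV"
  shows "frag_of (\<omega>, X) - canonical k (\<lambda>x vs. \<omega> x vs *\<^sub>R X x) \<in> null k"
proof -
  have sm: "smooth_on UNIV (\<lambda>x. \<omega> x vs)" for vs using assms by (simp add: forms_module_carrier)
  let ?m = "\<lambda>bs x vs. \<omega> x bs * alt_frame bs vs"
  have "\<omega> = (\<lambda>x vs. \<Sum>bs\<in>basis_lists k. ?m bs x vs)"
  proof (intro ext)
    fix x vs
    have "alt_form k (\<omega> x)" using assms(1) by (simp add: forms_module_carrier)
    from alt_form_expansion[OF this, of vs]
    show "\<omega> x vs = (\<Sum>bs\<in>basis_lists k. ?m bs x vs)" by (simp add: mult.commute)
  qed
  moreover have "?m bs \<in> carrier (forms_module k)" if "bs \<in> basis_lists k" for bs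
    by (rule forms_module_scale[OF forms_module_frame[OF that] sm])
  then have "frag_of (\<lambda>x vs. \<Sum>bs\<in>basis_lists k. ?m bs x vs, X) -
      (\<Sum>bs\<in>basis_lists k. frag_of (?m bs, X)) \<in> null k"
    using null_left_sum[OF finite_basis_lists _ assms(2), of k ?m k] by blast
  ultimately have "frag_of (\<omega>, X) - (\<Sum>bs\<in>basis_lists k. frag_of (?m bs, X)) \<in> null k" by simp
  moreover have "(\<Sum>bs\<in>basis_lists k. frag_of (?m bs, X) -
      frag_of (\<lambda>x. alt_frame bs, \<lambda>x. \<omega> x bs *\<^sub>R X x)) \<in> null k"
    by (rule null_sum) (rule null_balanced[OF sm forms_module_frame assms(2)])
  ultimately have "(frag_of (\<omega>, X) - (\<Sum>bs\<in>basis_lists k. frag_of (?m bs, X))) +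
      (\<Sum>bs\<in>basis_lists k. frag_of (?m bs, X) -
      frag_of (\<lambda>x. alt_frame bs, \<lambda>x. \<omega> x bs *\<^sub>R X x)) \<in> null k"
    by (rule null_add)
  then show ?thesis by (simp add: canonical_def sum_subtractf)
qed

lemma forms_zero: "(\<lambda>x vs. 0) \<in> forms k (F UNIV)"
  using function_module_zero[OF F_module] by (simp add: forms_def alt_form_zero)

lemma forms_tensor:
  assumes "\<omega> \<in> carrier (forms_module k)" "X \<in> F UNIV"
  shows "(\<lambda>x vs. \<omega> x vs *\<^sub>R X x) \<in> forms k (F UNIV)"
  using assms by (simp add: forms_def forms_module_carrier alt_form_scaleR_right
      function_module_scaleR[OF F_module])

text \<open>Modulo the relations every formal sum equals one that depends only on its evaluation.
  Hence evaluation is injective on tensors, which is the half of the isomorphism that cannot be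
  checked on values.\<close>

lemma canonical_reduce:
  assumes "Poly_Mapping.keys z \<subseteq> pairs k"
  shows "tensor_eval z \<in> forms k (F UNIV) \<and> z - canonical k (tensor_eval z) \<in> null k"
  using assms
proof (induction z rule: free_Abelian_group_induct[consumes 1, case_names zero diff one])
  case zero
  have "canonical k (\<lambda>x vs. 0) \<in> null k"
    using canonical_diff[OF forms_zero forms_zero, of k] by (simp add: form_comb_def)
  then show ?case using forms_zero null_minus by fastforce
next
  case (diff z w)
  have eq: "tensor_eval (z - w) = form_comb 1 (-1) (tensor_eval z) (tensor_eval w)"
    by (simp add: tensor_eval_diff form_comb_def)
  have "(z - canonical k (tensor_eval z)) - (w - canonical k (tensor_eval w)) -
      (canonical k (form_comb 1 (-1) (tensor_eval z) (tensor_eval w)) -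
        (canonical k (tensor_eval z) - canonical k (tensor_eval w))) \<in> null k"
    by (rule null_diff[OF null_diff canonical_diff]) (use diff in auto)
  moreover have "form_comb 1 (-1) (tensor_eval z) (tensor_eval w) \<in> forms k (F UNIV)"
    using diff by (intro forms_comb F_module) auto
  ultimately show ?case unfolding eq by (simp add: algebra_simps)
next
  case (one a)
  then obtain \<omega> X where "a = (\<omega>, X)" "\<omega> \<in> carrier (forms_module k)" "X \<in> F UNIV"
    by (auto simp: carrier_foliation)
  then show ?case using forms_tensor canonical_of by simp
qed

definition tensor_class :: "int \<Rightarrow> ('v \<Rightarrow> 'v list \<Rightarrow> 'v) \<Rightarrow>
    ((('v \<Rightarrow> 'v list \<Rightarrow> real) \<times> ('v \<Rightarrow> 'v)) \<Rightarrow>\<^sub>0 int) set" where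
  "tensor_class k \<Omega> = coset k (canonical k \<Omega>)"

lemma coset_tensor_class:
  assumes "Poly_Mapping.keys z \<subseteq> pairs k"
  shows "coset k z = tensor_class k (tensor_eval z)"
  unfolding tensor_class_def by (rule coset_eqI) (use canonical_reduce[OF assms] in blast)

lemma tensor_class_mem:
  assumes "\<Omega> \<in> forms k (F UNIV)" "z \<in> tensor_class k \<Omega>"
  shows "Poly_Mapping.keys z \<subseteq> pairs k" "tensor_eval z = \<Omega>"
proof -
  have d: "z - canonical k \<Omega> \<in> null k" using assms(2) by (simp add: tensor_class_def coset_mem)
  show "Poly_Mapping.keys z \<subseteq> pairs k"
    using keys_add[of "z - canonical k \<Omega>" "canonical k \<Omega>"] null_carrier[OF d] canonical_carrier[OF assms(1)]
    by simp blast
  have "tensor_eval z x vs = \<Omega> x vs" for x vs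
    using fun_cong[OF fun_cong[OF tensor_eval_null[OF d]], of x vs] tensor_eval_canonical[OF assms(1)]
    by (simp add: tensor_eval_diff)
  then show "tensor_eval z = \<Omega>" by blast
qed

lemma inj_on_tensor_class: "inj_on (tensor_class k) (forms k (F UNIV))"
proof (rule inj_onI)
  fix \<Omega> \<Omega>' assume a: "\<Omega> \<in> forms k (F UNIV)" "\<Omega>' \<in> forms k (F UNIV)" "tensor_class k \<Omega> = tensor_class k \<Omega>'"
  have "canonical k \<Omega> \<in> tensor_class k \<Omega>'" using a(3) coset_self by (metis tensor_class_def)
  from tensor_class_mem(2)[OF a(2) this] show "\<Omega> = \<Omega>'" using tensor_eval_canonical[OF a(1)] by simp
qed

section \<open>The Koszul complex of the foliation as a complex of vector-valued forms\<close>

lemma carrier_koszul_term: "carrier (koszul_term F k) = tensor_class k ` forms k (F UNIV)"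
proof -
  have "carrier (koszul_term F k) = coset k ` carrier (free_Abelian_group (pairs k))"
    by (simp add: koszul_term_def tensor_product_def tensor_group_def carrier_FactGroup coset_def null_def)
  also have "\<dots> = tensor_class k ` forms k (F UNIV)"
  proof
    show "coset k ` carrier (free_Abelian_group (pairs k)) \<subseteq> tensor_class k ` forms k (F UNIV)"
      using coset_tensor_class canonical_reduce by fastforce
    show "tensor_class k ` forms k (F UNIV) \<subseteq> coset k ` carrier (free_Abelian_group (pairs k))"
      using canonical_carrier by (auto simp: tensor_class_def)
  qed
  finally show ?thesis .
qed

lemma zero_koszul_term: "\<zero>\<^bsub>koszul_term F k\<^esub> = tensor_class k (\<lambda>x vs. 0)"
proof -
  have "\<zero>\<^bsub>koszul_term F k\<^esub> = coset k 0"
    by (simp add: koszul_term_def tensor_product_def tensor_group_def coset_eq null_def)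
  also have "\<dots> = tensor_class k (\<lambda>x vs. 0)" by (subst coset_tensor_class) auto
  finally show ?thesis .
qed

lemma add_koszul_term:
  assumes "\<Omega> \<in> forms k (F UNIV)" "\<Omega>' \<in> forms k (F UNIV)"
  shows "tensor_class k \<Omega> \<oplus>\<^bsub>koszul_term F k\<^esub> tensor_class k \<Omega>' = tensor_class k (\<lambda>x vs. \<Omega> x vs + \<Omega>' x vs)"
proof -
  interpret G: comm_group "free_Abelian_group (pairs k)" by (rule abelian_free_Abelian_group)
  have "null k \<lhd> free_Abelian_group (pairs k)"
    using G.subgroup_imp_normal subgroup_null by blast
  then have "coset k (canonical k \<Omega>) <#>\<^bsub>free_Abelian_group (pairs k)\<^esub> coset k (canonical k \<Omega>') =
      coset k (canonical k \<Omega> + canonical k \<Omega>')"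
    unfolding coset_def using normal.rcos_sum canonical_carrier[OF assms(1)] canonical_carrier[OF assms(2)]
    by fastforce
  also have "\<dots> = tensor_class k (tensor_eval (canonical k \<Omega> + canonical k \<Omega>'))"
    by (rule coset_tensor_class)
      (use keys_add canonical_carrier[OF assms(1)] canonical_carrier[OF assms(2)] in fastforce)
  finally show ?thesis
    by (simp add: koszul_term_def tensor_product_def tensor_group_def tensor_class_def[symmetric]
        tensor_eval_add tensor_eval_canonical assms)
qed

text \<open>All representatives of a class have the same evaluation, hence by \<open>P\<close> so do
  their images, and the cosets in the union defining \<open>tensor_map\<close> coincide. The class
  is nonempty, so the union is that common coset.\<close>

lemma tensor_map_tensor_class:
  assumes f: "\<And>m. m \<in> carrier (forms_module k) \<Longrightarrow> f m \<in> carrier (forms_module l)"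
    and P: "\<And>z. Poly_Mapping.keys z \<subseteq> pairs k \<Longrightarrow>
      tensor_eval (frag_extend (\<lambda>(m, X). frag_of (f m, id X)) z) = P (tensor_eval z)"
    and \<Omega>: "\<Omega> \<in> forms k (F UNIV)"
  shows "tensor_map smooth_ring (forms_module l) (foliation_module F) f id (tensor_class k \<Omega>) =
    tensor_class l (P \<Omega>)"
proof -
  have "coset l (frag_extend (\<lambda>(m, X). frag_of (f m, id X)) z) = tensor_class l (P \<Omega>)"
    if "z \<in> tensor_class k \<Omega>" for z
  proof -
    note z = tensor_class_mem[OF \<Omega> that]
    have "Poly_Mapping.keys (frag_extend (\<lambda>(m, X). frag_of (f m, id X)) z) \<subseteq> pairs l"
      using keys_frag_extend[of "\<lambda>(m, X). frag_of (f m, id X)" z] z(1) f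
      by (fastforce simp: keys_frag_of)
    from coset_tensor_class[OF this] show ?thesis unfolding P[OF z(1)] z(2) .
  qed
  moreover have "tensor_class k \<Omega> \<noteq> {}" using coset_self by (auto simp: tensor_class_def)
  ultimately show ?thesis
    unfolding tensor_map_def null_def[symmetric] coset_def[symmetric] by auto
qed

lemma tensor_eval_extend:
  assumes "\<And>m X. f (m, X) = frag_of (g m, X)"
  shows "tensor_eval (frag_extend f z) x vs = frag_eval (\<lambda>(m, X). g m x vs *\<^sub>R X x) z"
proof -
  have "(\<lambda>a. frag_eval (\<lambda>(\<omega>, X). \<omega> x vs *\<^sub>R X x) (f a)) = (\<lambda>(m, X). g m x vs *\<^sub>R X x)"
    using assms by (auto simp: fun_eq_iff)
  then show ?thesis by (simp add: tensor_eval_def frag_eval_extend)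
qed

lemma koszul_map_tensor_class:
  assumes "\<Omega> \<in> forms k (F UNIV)"
  shows "koszul_map F k (tensor_class k \<Omega>) = tensor_class (k - 1) (euler_contraction \<Omega>)"
  unfolding koszul_map_def
proof (rule tensor_map_tensor_class[OF forms_module_contraction _ assms])
  fix z :: "(('v \<Rightarrow> 'v list \<Rightarrow> real) \<times> ('v \<Rightarrow> 'v)) \<Rightarrow>\<^sub>0 int"
  show "tensor_eval (frag_extend (\<lambda>(m, X). frag_of (contraction euler_field m, id X)) z) =
      euler_contraction (tensor_eval z)"
    by (intro ext, subst tensor_eval_extend[of _ "contraction euler_field"])
      (auto simp: contraction_def euler_contraction_def tensor_eval_def euler_field_def euclidean_representation)
qed

lemma smult_koszul_term:
  assumes "\<Omega> \<in> forms k (F UNIV)" "smooth_on UNIV a"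
  shows "a \<odot>\<^bsub>koszul_term F k\<^esub> tensor_class k \<Omega> = tensor_class k (\<lambda>x vs. a x *\<^sub>R \<Omega> x vs)"
proof -
  have "tensor_map smooth_ring (forms_module k) (foliation_module F) (\<lambda>m. a \<odot>\<^bsub>forms_module k\<^esub> m) id
      (tensor_class k \<Omega>) = tensor_class k ((\<lambda>\<Omega> x vs. a x *\<^sub>R \<Omega> x vs) \<Omega>)"
  proof (rule tensor_map_tensor_class[OF _ _ assms(1)])
    show "a \<odot>\<^bsub>forms_module k\<^esub> m \<in> carrier (forms_module k)" if "m \<in> carrier (forms_module k)"
      for m :: "'v \<Rightarrow> 'v list \<Rightarrow> real"
      using forms_module_scale[OF that assms(2)] by (simp add: forms_module_def)
    fix z :: "(('v \<Rightarrow> 'v list \<Rightarrow> real) \<times> ('v \<Rightarrow> 'v)) \<Rightarrow>\<^sub>0 int"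
    have "frag_eval (\<lambda>(m, X). (a x * m x vs) *\<^sub>R X x) z = a x *\<^sub>R tensor_eval z x vs" for x vs
      by (simp add: tensor_eval_def frag_eval_def scaleR_sum_right case_prod_unfold mult.left_commute)
    then show "tensor_eval (frag_extend (\<lambda>(m, X). frag_of (a \<odot>\<^bsub>forms_module k\<^esub> m, id X)) z) =
        (\<lambda>x vs. a x *\<^sub>R tensor_eval z x vs)"
      by (intro ext, subst tensor_eval_extend[of _ "\<lambda>m x vs. a x * m x vs"])
        (auto simp: forms_module_def)
  qed
  then show ?thesis by (simp add: koszul_term_def tensor_product_def)
qed

lemma boundaries_subset_cycles: "boundaries k (F UNIV) \<subseteq> cycles k (F UNIV)"
proof
  fix \<Omega> assume "\<Omega> \<in> boundaries k (F UNIV)"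
  then obtain \<eta> where "\<eta> \<in> forms (k + 1) (F UNIV)" "\<Omega> = euler_contraction \<eta>"
    by (auto simp: boundaries_def)
  then show "\<Omega> \<in> cycles k (F UNIV)"
    using euler_contraction_forms[OF F_module, of \<eta> "k + 1"] euler_contraction_twice
    by (auto simp: cycles_def)
qed

lemma koszul_kernel:
  "a_kernel (koszul_term F k) (koszul_term F (k - 1)) (koszul_map F k) = tensor_class k ` cycles k (F UNIV)"
proof -
  have "koszul_map F k (tensor_class k \<Omega>) = \<zero>\<^bsub>koszul_term F (k - 1)\<^esub> \<longleftrightarrow> euler_contraction \<Omega> = (\<lambda>x vs. 0)"
    if "\<Omega> \<in> forms k (F UNIV)" for \<Omega>
    unfolding koszul_map_tensor_class[OF that] zero_koszul_term
    using inj_on_eq_iff[OF inj_on_tensor_class] euler_contraction_forms[OF F_module that] forms_zero by blast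
  then show ?thesis
    unfolding a_kernel_def' carrier_koszul_term cycles_def by auto
qed

lemma koszul_image:
  "koszul_map F (k + 1) ` carrier (koszul_term F (k + 1)) = tensor_class k ` boundaries k (F UNIV)"
proof -
  have "koszul_map F (k + 1) (tensor_class (k + 1) \<Omega>) = tensor_class k (euler_contraction \<Omega>)"
    if "\<Omega> \<in> forms (k + 1) (F UNIV)" for \<Omega>
    using koszul_map_tensor_class[OF that] by simp
  then show ?thesis
    unfolding carrier_koszul_term boundaries_def image_image by (rule image_cong[OF refl])
qed

section \<open>From a relation on cycles to an isomorphism with homology\<close>

context
  fixes k :: int and U :: "'e::real_vector set" and R :: "('v \<Rightarrow> 'v list \<Rightarrow> 'v) \<Rightarrow> 'e \<Rightarrow> bool"
  assumes iso: "quotient_iso (cycles k (F UNIV)) (boundaries k (F UNIV)) U {0} R"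
    and comb: "comb_compatible form_comb (\<lambda>a b u v. a *\<^sub>R u + b *\<^sub>R v) R"
begin

lemma R_cycle: "R \<Omega> u \<Longrightarrow> \<Omega> \<in> cycles k (F UNIV)"
  and R_mem: "R \<Omega> u \<Longrightarrow> u \<in> U"
  and R_boundary: "R \<Omega> u \<Longrightarrow> \<Omega> \<in> boundaries k (F UNIV) \<longleftrightarrow> u = 0"
  and R_left_total: "\<Omega> \<in> cycles k (F UNIV) \<Longrightarrow> \<exists>u. R \<Omega> u"
  and R_right_total: "u \<in> U \<Longrightarrow> \<exists>\<Omega>. R \<Omega> u"
  using iso unfolding quotient_iso_def by blast+

lemma R_form: "R \<Omega> u \<Longrightarrow> \<Omega> \<in> forms k (F UNIV)"
  using R_cycle by (auto simp: cycles_def)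

lemma R_comb: "R \<Omega> u \<Longrightarrow> R \<Omega>' v \<Longrightarrow> R (form_comb a b \<Omega> \<Omega>') (a *\<^sub>R u + b *\<^sub>R v)"
  using comb unfolding comb_compatible_def by blast

lemma R_add: "R \<Omega> u \<Longrightarrow> R \<Omega>' v \<Longrightarrow> R (\<lambda>x vs. \<Omega> x vs + \<Omega>' x vs) (u + v)"
  using R_comb[of \<Omega> u \<Omega>' v 1 1] by (simp add: form_comb_def)

lemma R_diff: "R \<Omega> u \<Longrightarrow> R \<Omega>' v \<Longrightarrow> R (\<lambda>x vs. \<Omega> x vs - \<Omega>' x vs) (u - v)"
  using R_comb[of \<Omega> u \<Omega>' v 1 "-1"] by (simp add: form_comb_def)

lemma R_scaleR: "R \<Omega> u \<Longrightarrow> R (\<lambda>x vs. c *\<^sub>R \<Omega> x vs) (c *\<^sub>R u)"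
  using R_comb[of \<Omega> u \<Omega> u c 0] by (simp add: form_comb_def)

text \<open>Homology classes are sets of tensors, so the class of \<open>u\<close> can be taken to
  be everything related to \<open>u\<close>; no representative has to be chosen.\<close>

definition fiber_class :: "'e \<Rightarrow> ((('v \<Rightarrow> 'v list \<Rightarrow> real) \<times> ('v \<Rightarrow> 'v)) \<Rightarrow>\<^sub>0 int) set set" where
  "fiber_class u = tensor_class k ` {\<Omega>. R \<Omega> u}"

text \<open>Forms related to the same \<open>u\<close> differ by a form related to 0, and these are
  exactly the boundaries: a boundary is a cycle, hence related to something, which must be
  0.\<close>

lemma fiber_class_coset:
  assumes "R \<Omega> u"
  shows "(\<Union>h\<in>tensor_class k ` boundaries k (F UNIV). {h \<oplus>\<^bsub>koszul_term F k\<^esub> tensor_class k \<Omega>}) =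
    fiber_class u"
proof -
  have b: "R B 0" if B: "B \<in> boundaries k (F UNIV)" for B
  proof -
    obtain u where "R B u" using R_left_total boundaries_subset_cycles B by blast
    then show ?thesis using R_boundary B by metis
  qed
  have "(\<Union>h\<in>tensor_class k ` boundaries k (F UNIV). {h \<oplus>\<^bsub>koszul_term F k\<^esub> tensor_class k \<Omega>}) =
      tensor_class k ` (\<lambda>B x vs. B x vs + \<Omega> x vs) ` boundaries k (F UNIV)"
    using add_koszul_term[OF R_form[OF b] R_form[OF assms]] by (auto simp: image_iff)
  also have "(\<lambda>B x vs. B x vs + \<Omega> x vs) ` boundaries k (F UNIV) = {\<Omega>'. R \<Omega>' u}"
  proof (intro equalityI subsetI)
    fix \<Omega>' assume "\<Omega>' \<in> (\<lambda>B x vs. B x vs + \<Omega> x vs) ` boundaries k (F UNIV)"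
    then show "\<Omega>' \<in> {\<Omega>'. R \<Omega>' u}" using R_add[OF b assms] by auto
  next
    fix \<Omega>' assume "\<Omega>' \<in> {\<Omega>'. R \<Omega>' u}"
    then have "R (\<lambda>x vs. \<Omega>' x vs - \<Omega> x vs) 0" using R_diff[OF _ assms, of \<Omega>' u] by simp
    then have "(\<lambda>x vs. \<Omega>' x vs - \<Omega> x vs) \<in> boundaries k (F UNIV)" using R_boundary by blast
    then show "\<Omega>' \<in> (\<lambda>B x vs. B x vs + \<Omega> x vs) ` boundaries k (F UNIV)"
      by (rule rev_image_eqI) simp
  qed
  finally show ?thesis by (simp add: fiber_class_def)
qed

lemma koszul_homology_alt:
  "koszul_homology F k = quotient_module (koszul_term F k\<lparr>carrier := tensor_class k ` cycles k (F UNIV)\<rparr>)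
     (tensor_class k ` boundaries k (F UNIV))"
  by (simp add: koszul_homology_def homology_module_def koszul_kernel koszul_image)

lemma fiber_class_add:
  assumes "u \<in> U" "v \<in> U"
  shows "fiber_class (u + v) = fiber_class u \<oplus>\<^bsub>koszul_homology F k\<^esub> fiber_class v"
proof -
  have "fiber_class u \<oplus>\<^bsub>koszul_homology F k\<^esub> fiber_class v =
      (\<Union>h\<in>fiber_class u. \<Union>k'\<in>fiber_class v. {h \<oplus>\<^bsub>koszul_term F k\<^esub> k'})"
    by (simp add: koszul_homology_alt quotient_module_def set_add_def')
  also have "\<dots> = fiber_class (u + v)"
  proof (intro equalityI subsetI)
    fix c assume "c \<in> (\<Union>h\<in>fiber_class u. \<Union>k'\<in>fiber_class v. {h \<oplus>\<^bsub>koszul_term F k\<^esub> k'})"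
    then obtain \<Omega> \<Omega>' where o: "R \<Omega> u" "R \<Omega>' v"
      "c = tensor_class k \<Omega> \<oplus>\<^bsub>koszul_term F k\<^esub> tensor_class k \<Omega>'"
      by (auto simp: fiber_class_def)
    then show "c \<in> fiber_class (u + v)"
      using add_koszul_term[OF R_form R_form, OF o(1,2)] R_add[OF o(1,2)] by (simp add: fiber_class_def)
  next
    fix c assume "c \<in> fiber_class (u + v)"
    then obtain \<Omega> where o: "R \<Omega> (u + v)" "c = tensor_class k \<Omega>" by (auto simp: fiber_class_def)
    \<comment> \<open>A representative of \<open>u + v\<close> is split by subtracting any
      representative of \<open>v\<close>; what remains is related to \<open>u\<close>.\<close>
    obtain \<Omega>' where o': "R \<Omega>' v" using R_right_total assms by blast
    have d: "R (\<lambda>x vs. \<Omega> x vs - \<Omega>' x vs) u" using R_diff[OF o(1) o'] by simp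
    have "c = tensor_class k (\<lambda>x vs. \<Omega> x vs - \<Omega>' x vs) \<oplus>\<^bsub>koszul_term F k\<^esub> tensor_class k \<Omega>'"
      using add_koszul_term[OF R_form[OF d] R_form[OF o']] o(2) by simp
    then show "c \<in> (\<Union>h\<in>fiber_class u. \<Union>k'\<in>fiber_class v. {h \<oplus>\<^bsub>koszul_term F k\<^esub> k'})"
      using d o' by (auto simp: fiber_class_def)
  qed
  finally show ?thesis ..
qed

lemma fiber_class_scaleR:
  assumes "u \<in> U"
  shows "fiber_class (c *\<^sub>R u) = (\<lambda>x. c) \<odot>\<^bsub>koszul_homology F k\<^esub> fiber_class u"
proof -
  have "(\<lambda>x. c) \<odot>\<^bsub>koszul_homology F k\<^esub> fiber_class u =
      (\<Union>m\<in>fiber_class u. \<Union>h\<in>tensor_class k ` boundaries k (F UNIV).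
        {h \<oplus>\<^bsub>koszul_term F k\<^esub> ((\<lambda>x. c) \<odot>\<^bsub>koszul_term F k\<^esub> m)})"
    by (simp add: koszul_homology_alt quotient_module_def a_r_coset_def')
  also have "\<dots> = (\<Union>m\<in>fiber_class u. fiber_class (c *\<^sub>R u))"
  proof (rule SUP_cong[OF refl])
    fix m assume "m \<in> fiber_class u"
    then obtain \<Omega> where o: "R \<Omega> u" "m = tensor_class k \<Omega>" by (auto simp: fiber_class_def)
    show "(\<Union>h\<in>tensor_class k ` boundaries k (F UNIV).
        {h \<oplus>\<^bsub>koszul_term F k\<^esub> ((\<lambda>x. c) \<odot>\<^bsub>koszul_term F k\<^esub> m)}) = fiber_class (c *\<^sub>R u)"
      using fiber_class_coset[OF R_scaleR[OF o(1)]] smult_koszul_term[OF R_form[OF o(1)] smooth_on_const[OF open_UNIV]]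
      by (simp add: o(2))
  qed
  \<comment> \<open>All members of the union agree; it collapses to their common value because
    \<open>fiber_class u\<close> is nonempty.\<close>
  also have "\<dots> = fiber_class (c *\<^sub>R u)"
    using R_right_total[OF assms] by (auto simp: fiber_class_def)
  finally show ?thesis ..
qed

lemma fiber_class_bij: "bij_betw fiber_class U (carrier (koszul_homology F k))"
  unfolding bij_betw_def
proof
  show "inj_on fiber_class U"
  proof (rule inj_onI)
    fix u v assume uv: "u \<in> U" "v \<in> U" "fiber_class u = fiber_class v"
    obtain \<Omega> where o: "R \<Omega> u" using R_right_total uv by blast
    then have "tensor_class k \<Omega> \<in> fiber_class v" using uv(3) by (auto simp: fiber_class_def)
    then obtain \<Omega>' where o': "R \<Omega>' v" "tensor_class k \<Omega> = tensor_class k \<Omega>'" by (auto simp: fiber_class_def)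
    have "\<Omega> = \<Omega>'" by (rule inj_onD[OF inj_on_tensor_class o'(2) R_form[OF o] R_form[OF o'(1)]])
    \<comment> \<open>One form related to both \<open>u\<close> and \<open>v\<close> makes the zero
      form related to \<open>u - v\<close>; the zero form is a boundary, so the difference is
      0.\<close>
    then have r: "R (\<lambda>x vs. 0) (u - v)" using R_diff[OF o o'(1)] by simp
    have "(\<lambda>x vs. 0) \<in> boundaries k (F UNIV)"
      unfolding boundaries_def
      by (rule image_eqI[OF _ forms_zero]) (simp add: euler_contraction_def)
    then show "u = v" using R_boundary[OF r] by simp
  qed
  have "carrier (koszul_homology F k) = (\<lambda>\<Omega>. \<Union>h\<in>tensor_class k ` boundaries k (F UNIV).
      {h \<oplus>\<^bsub>koszul_term F k\<^esub> tensor_class k \<Omega>}) ` cycles k (F UNIV)"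
    by (auto simp: koszul_homology_alt quotient_module_def A_RCOSETS_def' a_r_coset_def')
  also have "\<dots> = fiber_class ` U"
  proof (intro equalityI subsetI)
    fix c assume "c \<in> (\<lambda>\<Omega>. \<Union>h\<in>tensor_class k ` boundaries k (F UNIV).
        {h \<oplus>\<^bsub>koszul_term F k\<^esub> tensor_class k \<Omega>}) ` cycles k (F UNIV)"
    then obtain \<Omega> where o: "\<Omega> \<in> cycles k (F UNIV)"
      "c = (\<Union>h\<in>tensor_class k ` boundaries k (F UNIV). {h \<oplus>\<^bsub>koszul_term F k\<^esub> tensor_class k \<Omega>})"
      by blast
    obtain u where u: "R \<Omega> u" using R_left_total o(1) by blast
    then show "c \<in> fiber_class ` U" unfolding o(2) fiber_class_coset[OF u] using R_mem by blast
  next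
    fix c assume "c \<in> fiber_class ` U"
    then obtain u where u: "u \<in> U" "c = fiber_class u" by blast
    obtain \<Omega> where o: "R \<Omega> u" using R_right_total[OF u(1)] by blast
    show "c \<in> (\<lambda>\<Omega>. \<Union>h\<in>tensor_class k ` boundaries k (F UNIV).
        {h \<oplus>\<^bsub>koszul_term F k\<^esub> tensor_class k \<Omega>}) ` cycles k (F UNIV)"
      unfolding u(2)
      by (rule image_eqI[where x = \<Omega>]) (simp only: fiber_class_coset[OF o], rule R_cycle[OF o])
  qed
  finally show "fiber_class ` U = carrier (koszul_homology F k)" ..
qed

lemma real_isomorphic_koszul_homology: "real_isomorphic U (koszul_homology F k)"
  unfolding real_isomorphic_def
  using fiber_class_bij fiber_class_add fiber_class_scaleR by blast

end

end

lemma function_module_subsheaf: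
  assumes "subsheaf_of_modules F"
  shows "function_module (F UNIV)"
proof -
  from assms have "(\<lambda>x\<in>UNIV. 0) \<in> F UNIV \<and>
      (\<forall>X\<in>F UNIV. \<forall>Y\<in>F UNIV. (\<lambda>x\<in>UNIV. X x + Y x) \<in> F UNIV) \<and>
      (\<forall>f. \<forall>X\<in>F UNIV. smooth_on UNIV f \<longrightarrow> (\<lambda>x\<in>UNIV. f x *\<^sub>R X x) \<in> F UNIV)"
    unfolding subsheaf_of_modules_def
    by (elim conjE allE[where x = UNIV] impE[OF _ open_UNIV]) (intro conjI; assumption)
  then show ?thesis by (simp add: function_module_def restrict_def)
qed

theorem proposition4p2:
  fixes F :: "'v::euclidean_space set \<Rightarrow> ('v \<Rightarrow> 'v) set"
    and n :: nat
    and E :: "nat \<Rightarrow> ('v, 'e::real_vector) vector_bundle"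
    and D :: "nat \<Rightarrow> 'v \<Rightarrow> 'e \<Rightarrow> 'e"
    and \<rho> :: "'v \<Rightarrow> 'e \<Rightarrow> 'v"
  assumes "singular_foliation F"
    and "is_leaf F {0}"
    and "resolution F n E D \<rho>"
    and "minimal_at 0 n E D"
  shows "\<forall>i\<in>{0..n}. real_isomorphic (fiber (E i) 0) (koszul_homology F (int i))"
proof
  fix i assume "i \<in> {0..n}"
  then have i: "i \<le> n" by simp
  have "subsheaf_of_modules F" using assms(1) by (simp add: singular_foliation_def)
  then have F: "function_module (F UNIV)" by (rule function_module_subsheaf)
  then interpret koszul_tensor F by unfold_locales
  obtain R where R: "comb_compatible form_comb (\<lambda>a b u v. a *\<^sub>R u + b *\<^sub>R v) R"
    "quotient_iso (cycles (int i) (F UNIV)) (boundaries (int i) (F UNIV)) (fiber (E i) 0) {0} R"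
    by (rule quotient_iso_fiber[OF assms(3,4) F i])
  show "real_isomorphic (fiber (E i) 0) (koszul_homology F (int i))"
    by (rule real_isomorphic_koszul_homology[OF R(2,1)])
qed

end
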